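(* For every integer $m\ge 0$ the diagram formed by $Fr:U^{(m+1)}(\mathcal G)\to U^{(m)}(\mathcal G)$, $\rho_{m+1}:U^{(m+1)}(\mathcal G)\to H^0(X,\mathcal D_X^{(m+1)})$, $1\otimes\rho_m:U^{(m)}(\mathcal G)\to H^0(X,F^*\mathcal D_{X'}^{(m)})$ (sending $u$ to $1\otimes\rho_m(u)$) and $can:H^0(X,\mathcal D_X^{(m+1)})\to H^0(X,F^*\mathcal D_{X'}^{(m)})$ is commutative, i.e. $$can\circ\rho_{m+1}=(1\otimes\rho_m)\circ Fr .$$
   Context: Let $p>2$ be a prime, $k=\mathbb F_p$, $G=SL_2$ over $k$, $\mathcal G$ its Lie algebra with standard basis $(E,F,H)$, and $X=\mathbb P^1_k$ the flag variety of $G$. Let $F:X\to X'$ be the relative Frobenius (since $k=\mathbb F_p$, $X'=X$ and $F$ raises functions to the $p$-th power). Cover $X$ by the two standard affine lines $\mathrm{Spec}\,k[t]$ and $\mathrm{Spec}\,k[t']$, $t'=1/t$. Distributions. $\mathrm{Dist}(G)=U(\mathcal G)$ is the algebra of distributions of $G$, identified with the reduction mod $p$ of the Kostant $\mathbb Z$-form of the enveloping algebra of $sl_2$, with $k$-basis $E^{[a]}\binom{H}{b}F^{[c]}$, where $E^{[n]}=E^n/n!$, $F^{[n]}=F^n/n!$, $\binom{H}{n}=H(H-1)\cdots(H-n+1)/n!$. $\mathrm{Dist}(G)_n$ is the subspace of distributions of order $\le n$ (spanned by the basis elements with $a+b+c\le n$), and $\epsilon_G$ is the unit of $\mathrm{Dist}(G)$.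 For $m\ge0$, $U^{(m)}(\mathcal G)$ is the quotient of the tensor algebra $\mathbb T_k(\mathrm{Dist}(G)_{2p^m-1})$ by the two-sided ideal generated by $\lambda-\lambda\epsilon_G$ ($\lambda\in k$), $\mu\otimes\mu'-\mu'\otimes\mu-[\mu,\mu']$ and $\mu''\otimes\mu-\mu''\mu$ for $\mu,\mu'\in\mathrm{Dist}(G)_{p^m}$, $\mu''\in\mathrm{Dist}(G)_{p^m-1}$. It is generated as an algebra by $E^{[i]},\binom{H}{i},F^{[i]}$, $0\le i\le p^m$. The Frobenius $Fr:U^{(m+1)}(\mathcal G)\to U^{(m)}(\mathcal G)$ is the algebra morphism (induced by the transpose of the Frobenius of $G$) with $E^{[n]}\mapsto E^{[n/p]}$, $F^{[n]}\mapsto F^{[n/p]}$, $\binom{H}{n}\mapsto\binom{H}{n/p}$ if $p\mid n$ and $\mapsto0$ otherwise ($0\le n\le p^{m+1}$). Differential operators. $\mathcal D_X=\bigcup_n\mathcal D_X^n$ is the sheaf of all (Grothendieck) differential operators on $X$ over $k$, filtered by order. $\mathcal D_X^{(m)}$ (Berthelot's differential operators of level $m$) is the sheaf of rings quotient of $\mathbb T_k(\mathcal D_X^{2p^m-1})$ by the two-sided ideal generated by $\lambda-\lambda 1_{O_X}$ ($\lambda\in k$), $D\otimes D'-D'\otimes D-[D,D']$, $D\otimes D''-DD''$ for $D,D'\in\mathcal D_X^{p^m}$, $D''\in\mathcal D_X^{p^m-1}$. If $\tau$ is a local coordinate with divided-power derivations $\partial^{[r]}=\partial_\tau^{r}/r!$,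 put $\partial^{\langle l\rangle_m}=\partial^{[r]}(\partial^{[p^m]})^q\in\mathcal D_X^{(m)}$ for $l=p^mq+r$, $0\le r<p^m$; these form a basis of $\mathcal D_X^{(m)}$ as a left $O_X$-module. Maps. The action of $G$ on $X$ defines the canonical algebra morphism $\rho:U(\mathcal G)\to H^0(X,\mathcal D_X)$, normalized by $E^{[n]}\mapsto\partial_t^{[n]}$, $F^{[n]}\mapsto\partial_{t'}^{[n]}$ (so $H\mapsto 2t'\partial_{t'}=-2t\partial_t$). It respects orders and so induces algebra morphisms $\rho_m:U^{(m)}(\mathcal G)\to H^0(X,\mathcal D_X^{(m)})$. Put $F^*\mathcal D_{X'}^{(m)}=O_X\otimes_{F^{-1}O_{X'}}F^{-1}\mathcal D_{X'}^{(m)}$. Berthelot's canonical map $can:\mathcal D_X^{(m+1)}\to F^*\mathcal D_{X'}^{(m)}$ is the left $O_X$-linear map given in local coordinates by $\partial^{\langle l\rangle_{m+1}}\mapsto 1\otimes\partial'^{\langle l/p\rangle_m}$ if $p\mid l$, and $\mapsto0$ if $p\nmid l$ (where $\partial'$ refers to the corresponding coordinate on $X'$); it is independent of the coordinate. The same notation is used on global sections. *)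

theory Defs
  imports
    "Berlekamp_Zassenhaus.Finite_Field"
    "HOL-Computational_Algebra.Formal_Power_Series"
    "HOL-Computational_Algebra.Fraction_Field"
    "HOL-Library.Poly_Mapping"
    "HOL-Algebra.QuotRing"
    "HOL-Algebra.Generated_Rings"
    "HOL-Algebra.Free_Abelian_Groups"
begin

text \<open>
  The prime is \<open>p = CARD('p)\<close> for a type \<open>'p\<close> of class \<open>prime_card\<close>, and \<open>k\<close> is \<open>'p mod_ring\<close>.
\<close>

section \<open>Tensor algebras\<close>

datatype 'g word = Word "'g list"

instantiation word :: (type) monoid_add
begin

definition zero_word :: "'a word" where "0 = Word []"

fun plus_word :: "'a word \<Rightarrow> 'a word \<Rightarrow> 'a word" where "Word u + Word v = Word (u @ v)"

instance
proof
  fix a b c :: "'a word"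
  show "a + b + c = a + (b + c)" by (cases a; cases b; cases c) simp
  show "0 + a = a" by (cases a) (simp add: zero_word_def)
  show "a + 0 = a" by (cases a) (simp add: zero_word_def)
qed

end

definition ring_on :: "'a::ring_1 set \<Rightarrow> 'a ring" where
  "ring_on S = \<lparr>carrier = S, monoid.mult = (*), monoid.one = 1, ring.zero = 0, ring.add = (+)\<rparr>"

definition free_algebra :: "'g set \<Rightarrow> ('g word \<Rightarrow>\<^sub>0 'r::comm_ring_1) ring" where
  "free_algebra V = ring_on {a. \<forall>w\<in>Poly_Mapping.keys a. set_word w \<subseteq> V}"

definition scalar :: "'r::comm_ring_1 \<Rightarrow> ('g word \<Rightarrow>\<^sub>0 'r)" where
  "scalar c = Poly_Mapping.single 0 c"

definition letter :: "'g \<Rightarrow> ('g word \<Rightarrow>\<^sub>0 'r::comm_ring_1)" where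
  "letter v = Poly_Mapping.single (Word [v]) 1"

definition free_map :: "('g \<Rightarrow> 'h) \<Rightarrow> ('g word \<Rightarrow>\<^sub>0 'r::comm_ring_1) \<Rightarrow> ('h word \<Rightarrow>\<^sub>0 'r)" where
  "free_map h a = (\<Sum>w\<in>Poly_Mapping.keys a.
     Poly_Mapping.single (map_word h w) (Poly_Mapping.lookup a w))"

text \<open>
  For a subspace \<open>V\<close> of a \<open>k\<close>-algebra \<open>A\<close> the tensor algebra \<open>T\<^sub>k(V)\<close> is the free algebra on the set
  \<open>V\<close> modulo the linearity relations, so that its quotient by further relations \<open>S\<close> is the free
  algebra modulo both.  In the uses below the relations lie in the free algebra, since orders of
  products and commutators add up suitably, so that intersecting with its carrier removes nothing;
  it ensures that \<^term>\<open>genideal\<close> is applied to a subset of the carrier.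
\<close>

definition linearity_rels ::
  "('r::comm_ring_1, 'a) module \<Rightarrow> 'a set \<Rightarrow> ('a word \<Rightarrow>\<^sub>0 'r) set" where
  "linearity_rels A V =
     {letter (v \<oplus>\<^bsub>A\<^esub> w) - letter v - letter w | v w. v \<in> V \<and> w \<in> V} \<union>
     {letter (c \<odot>\<^bsub>A\<^esub> v) - scalar c * letter v | c v. v \<in> V}"

definition tensor_ideal ::
  "('r::comm_ring_1, 'a) module \<Rightarrow> 'a set \<Rightarrow> ('a word \<Rightarrow>\<^sub>0 'r) set \<Rightarrow> ('a word \<Rightarrow>\<^sub>0 'r) set" where
  "tensor_ideal A V S =
     Idl\<^bsub>free_algebra V\<^esub> ((linearity_rels A V \<union> S) \<inter> carrier (free_algebra V))"

definition tensor_quotient ::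
  "('r::comm_ring_1, 'a) module \<Rightarrow> 'a set \<Rightarrow> ('a word \<Rightarrow>\<^sub>0 'r) set \<Rightarrow> ('a word \<Rightarrow>\<^sub>0 'r) set ring" where
  "tensor_quotient A V S = free_algebra V Quot tensor_ideal A V S"

definition tensor_class ::
  "('r::comm_ring_1, 'a) module \<Rightarrow> 'a set \<Rightarrow> ('a word \<Rightarrow>\<^sub>0 'r) set \<Rightarrow>
     ('a word \<Rightarrow>\<^sub>0 'r) \<Rightarrow> ('a word \<Rightarrow>\<^sub>0 'r) set" where
  "tensor_class A V S w = tensor_ideal A V S +>\<^bsub>free_algebra V\<^esub> w"

definition unit_rels :: "('r::comm_ring_1, 'a) module \<Rightarrow> ('a word \<Rightarrow>\<^sub>0 'r) set" where
  "unit_rels A = {scalar c - letter (c \<odot>\<^bsub>A\<^esub> \<one>\<^bsub>A\<^esub>) | c. True}"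

definition bracket_rels ::
  "('r::comm_ring_1, 'a) module \<Rightarrow> 'a set \<Rightarrow> ('a word \<Rightarrow>\<^sub>0 'r) set" where
  "bracket_rels A B =
     {letter u * letter v - letter v * letter u - letter (u \<otimes>\<^bsub>A\<^esub> v \<ominus>\<^bsub>A\<^esub> v \<otimes>\<^bsub>A\<^esub> u) | u v.
        u \<in> B \<and> v \<in> B}"

definition product_rels ::
  "('r::comm_ring_1, 'a) module \<Rightarrow> 'a set \<Rightarrow> 'a set \<Rightarrow> ('a word \<Rightarrow>\<^sub>0 'r) set" where
  "product_rels A B C = {letter u * letter v - letter (u \<otimes>\<^bsub>A\<^esub> v) | u v. u \<in> B \<and> v \<in> C}"

section \<open>Distributions of \<open>SL\<^sub>2\<close>\<close>

datatype sl2 = sl2_E | sl2_F | sl2_H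

type_synonym envelope = "(sl2 word \<Rightarrow>\<^sub>0 rat) set"
type_synonym distribution = "envelope set"

definition sl2_ideal :: "(sl2 word \<Rightarrow>\<^sub>0 rat) set" where
  "sl2_ideal = Idl\<^bsub>free_algebra UNIV\<^esub>
     {letter sl2_E * letter sl2_F - letter sl2_F * letter sl2_E - letter sl2_H,
      letter sl2_H * letter sl2_E - letter sl2_E * letter sl2_H - 2 * letter sl2_E,
      letter sl2_H * letter sl2_F - letter sl2_F * letter sl2_H + 2 * letter sl2_F}"

definition sl2_envelope :: "envelope ring" where
  "sl2_envelope = free_algebra UNIV Quot sl2_ideal"

definition envelope_class :: "(sl2 word \<Rightarrow>\<^sub>0 rat) \<Rightarrow> envelope" where
  "envelope_class u = sl2_ideal +>\<^bsub>free_algebra UNIV\<^esub> u"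

definition divided_power :: "sl2 \<Rightarrow> nat \<Rightarrow> envelope" where
  "divided_power g n = envelope_class (scalar (1 / fact n) * letter g ^ n)"

definition binomial_H :: "nat \<Rightarrow> envelope" where
  "binomial_H n =
     envelope_class (scalar (1 / fact n) * prod_list (map (\<lambda>i. letter sl2_H - of_nat i) [0..<n]))"

text \<open>The Kostant \<open>\<int>\<close>-form; it contains the elements \<^term>\<open>binomial_H n\<close>.\<close>

definition kostant_form :: "envelope ring" where
  "kostant_form = sl2_envelope
     \<lparr>carrier := generate_ring sl2_envelope
        (range (divided_power sl2_E) \<union> range (divided_power sl2_F))\<rparr>"

definition reduction_ideal :: "nat \<Rightarrow> envelope set" where
  "reduction_ideal p = Idl\<^bsub>kostant_form\<^esub> {[p] \<cdot>\<^bsub>kostant_form\<^esub> \<one>\<^bsub>kostant_form\<^esub>}"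

definition dist_ring :: "nat \<Rightarrow> distribution ring" where
  "dist_ring p = kostant_form Quot reduction_ideal p"

definition dist_class :: "nat \<Rightarrow> envelope \<Rightarrow> distribution" where
  "dist_class p u = reduction_ideal p +>\<^bsub>kostant_form\<^esub> u"

definition Dist :: "('p::prime_card mod_ring, distribution) module" where
  "Dist = \<lparr>carrier = carrier (dist_ring CARD('p)), monoid.mult = monoid.mult (dist_ring CARD('p)),
     monoid.one = monoid.one (dist_ring CARD('p)), ring.zero = ring.zero (dist_ring CARD('p)),
     ring.add = ring.add (dist_ring CARD('p)),
     module.smult = (\<lambda>c x. [to_int_mod_ring c] \<cdot>\<^bsub>dist_ring CARD('p)\<^esub> x)\<rparr>"

abbreviation dist_E :: "nat \<Rightarrow> nat \<Rightarrow> distribution" where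
  "dist_E p n \<equiv> dist_class p (divided_power sl2_E n)"

abbreviation dist_F :: "nat \<Rightarrow> nat \<Rightarrow> distribution" where
  "dist_F p n \<equiv> dist_class p (divided_power sl2_F n)"

abbreviation dist_H :: "nat \<Rightarrow> nat \<Rightarrow> distribution" where
  "dist_H p n \<equiv> dist_class p (binomial_H n)"

inductive_set lin_span :: "('r, 'a) module \<Rightarrow> 'a set \<Rightarrow> 'a set" for A B where
  zero: "\<zero>\<^bsub>A\<^esub> \<in> lin_span A B"
| step: "b \<in> B \<Longrightarrow> v \<in> lin_span A B \<Longrightarrow> c \<odot>\<^bsub>A\<^esub> b \<oplus>\<^bsub>A\<^esub> v \<in> lin_span A B"

definition dist_order :: "'p::prime_card itself \<Rightarrow> nat \<Rightarrow> distribution set" where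
  "dist_order _ n = (let A = (Dist :: ('p mod_ring, distribution) module); p = CARD('p) in
     lin_span A {dist_E p a \<otimes>\<^bsub>A\<^esub> dist_H p b \<otimes>\<^bsub>A\<^esub> dist_F p c | a b c. a + b + c \<le> n})"

text \<open>The algebra \<open>U\<^sup>(\<^sup>m\<^sup>)(\<G>)\<close>.\<close>

definition U_rels :: "nat \<Rightarrow> (distribution word \<Rightarrow>\<^sub>0 'p::prime_card mod_ring) set" where
  "U_rels m = unit_rels Dist
     \<union> bracket_rels Dist (dist_order TYPE('p) (CARD('p) ^ m))
     \<union> product_rels Dist (dist_order TYPE('p) (CARD('p) ^ m - 1)) (dist_order TYPE('p) (CARD('p) ^ m))"

definition U_level :: "nat \<Rightarrow> (distribution word \<Rightarrow>\<^sub>0 'p::prime_card mod_ring) set ring" where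
  "U_level m = tensor_quotient Dist (dist_order TYPE('p) (2 * CARD('p) ^ m - 1)) (U_rels m)"

definition U_class :: "nat \<Rightarrow> (distribution word \<Rightarrow>\<^sub>0 'p::prime_card mod_ring) \<Rightarrow>
    (distribution word \<Rightarrow>\<^sub>0 'p mod_ring) set" where
  "U_class m = tensor_class Dist (dist_order TYPE('p) (2 * CARD('p) ^ m - 1)) (U_rels m)"

text \<open>
  The transpose of the Frobenius of \<open>G\<close>; it is determined by these conditions since the divided
  powers of \<open>E\<close> and \<open>F\<close> generate \<^term>\<open>Dist\<close>.
\<close>

definition transpose_frobenius :: "'p::prime_card itself \<Rightarrow> (distribution \<Rightarrow> distribution) \<Rightarrow> bool" where
  "transpose_frobenius _ \<phi> \<longleftrightarrow>
     (let A = (Dist :: ('p mod_ring, distribution) module); p = CARD('p) in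
       \<phi> \<in> Ring.ring_hom A A \<and>
       (\<forall>c. \<forall>u\<in>carrier A. \<phi> (c \<odot>\<^bsub>A\<^esub> u) = c \<odot>\<^bsub>A\<^esub> \<phi> u) \<and>
       (\<forall>n. \<phi> (dist_E p n) = (if p dvd n then dist_E p (n div p) else \<zero>\<^bsub>A\<^esub>)) \<and>
       (\<forall>n. \<phi> (dist_F p n) = (if p dvd n then dist_F p (n div p) else \<zero>\<^bsub>A\<^esub>)) \<and>
       (\<forall>n. \<phi> (dist_H p n) = (if p dvd n then dist_H p (n div p) else \<zero>\<^bsub>A\<^esub>)))"

text \<open>
  The map \<open>Fr : U\<^sup>(\<^sup>m\<^sup>+\<^sup>1\<^sup>)(\<G>) \<rightarrow> U\<^sup>(\<^sup>m\<^sup>)(\<G>)\<close> induced by \<open>\<phi>\<close>.  An element of the source is a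
  coset; the union runs over its representatives, all of which give the same coset in the target.
\<close>

definition frobenius_level :: "(distribution \<Rightarrow> distribution) \<Rightarrow> nat \<Rightarrow>
    (distribution word \<Rightarrow>\<^sub>0 'p::prime_card mod_ring) set \<Rightarrow> (distribution word \<Rightarrow>\<^sub>0 'p mod_ring) set" where
  "frobenius_level \<phi> m u = (\<Union>w\<in>u. U_class m (free_map \<phi> w))"

section \<open>The projective line\<close>

type_synonym 'p ratfun = "'p mod_ring poly fract"
type_synonym 'p oper = "'p ratfun \<Rightarrow> 'p ratfun"

definition const :: "'p::prime_card mod_ring \<Rightarrow> 'p ratfun" where
  "const c = Fract [:c:] 1"

definition coord :: "'p::prime_card ratfun" where
  "coord = Fract [:0, 1:] 1"

definition coords :: "'p::prime_card ratfun set" where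
  "coords = {coord, inverse coord}"

definition eval :: "'p::prime_card mod_ring poly \<Rightarrow> 'p ratfun \<Rightarrow> 'p ratfun" where
  "eval a \<tau> = poly (map_poly const a) \<tau>"

text \<open>
  A point of \<open>X\<close> is represented by its local ring inside the function field \<open>k(t)\<close>.  As \<open>X\<close> is
  integral and separated, distinct points have distinct local rings, and identifying equal local
  rings of \<open>Spec k[t]\<close> and \<open>Spec k[t']\<close> is the gluing of the two affine lines.
\<close>

definition localization :: "'p::prime_card ratfun \<Rightarrow> 'p mod_ring poly set \<Rightarrow> 'p ratfun set" where
  "localization \<tau> P = {eval a \<tau> / eval b \<tau> | a b. b \<notin> P}"

definition points :: "'p::prime_card ratfun set set" where
  "points = {localization \<tau> P | \<tau> P. \<tau> \<in> coords \<and> primeideal P (ring_on UNIV)}"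

definition zariski_open :: "'p::prime_card ratfun set set \<Rightarrow> bool" where
  "zariski_open U \<longleftrightarrow> U \<subseteq> points \<and>
     (\<forall>\<tau>\<in>coords. \<exists>S. \<forall>P. primeideal P (ring_on UNIV) \<longrightarrow> (localization \<tau> P \<in> U \<longleftrightarrow> \<not> S \<subseteq> P))"

definition regular :: "'p::prime_card ratfun set set \<Rightarrow> 'p ratfun set" where
  "regular U = \<Inter>U"

section \<open>Differential operators\<close>

fun order_le :: "nat \<Rightarrow> ('a::comm_ring_1 \<Rightarrow> 'a) \<Rightarrow> bool" where
  "order_le 0 D \<longleftrightarrow> (\<forall>f g. D (f * g) - f * D g = 0)"
| "order_le (Suc n) D \<longleftrightarrow> (\<forall>f. order_le n (\<lambda>g. D (f * g) - f * D g))"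

definition klinear :: "'p::prime_card oper \<Rightarrow> bool" where
  "klinear D \<longleftrightarrow> (\<forall>f g. D (f + g) = D f + D g) \<and> (\<forall>c f. D (const c * f) = const c * D f)"

text \<open>
  Sections of \<open>D\<^sub>X\<^sup>n\<close> over a nonempty open \<open>U\<close> are endomorphisms of the sheaf \<open>O\<^sub>U\<close>.  All \<open>O(V)\<close> with
  \<open>V\<close> nonempty lie in the function field, which is their union, and the restriction maps are
  inclusions; hence such an endomorphism is the same as an operator on the function field that maps
  every \<open>O(V)\<close>, \<open>V \<subseteq> U\<close>, to itself, and restriction to a smaller open does not change the operator.
\<close>

definition diffops :: "nat \<Rightarrow> 'p::prime_card ratfun set set \<Rightarrow> 'p oper set" where
  "diffops n U = {D. klinear D \<and> order_le n D \<and>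
     (\<forall>V. zariski_open V \<and> V \<noteq> {} \<and> V \<subseteq> U \<longrightarrow> D ` regular V \<subseteq> regular V)}"

definition stalk_diffops :: "nat \<Rightarrow> 'p::prime_card ratfun set \<Rightarrow> 'p oper set" where
  "stalk_diffops n x = \<Union>{diffops n U | U. zariski_open U \<and> x \<in> U}"

definition oper_algebra :: "'p::prime_card oper set \<Rightarrow> ('p mod_ring, 'p oper) module" where
  "oper_algebra S = \<lparr>carrier = S, monoid.mult = (\<circ>), monoid.one = id, ring.zero = (\<lambda>_. 0),
     ring.add = (\<lambda>D D' f. D f + D' f), module.smult = (\<lambda>c D f. const c * D f)\<rparr>"

definition global_diffops :: "('p::prime_card mod_ring, 'p oper) module" where
  "global_diffops = oper_algebra (\<Union>n. diffops n points)"

definition stalk_algebra :: "'p::prime_card ratfun set \<Rightarrow> ('p mod_ring, 'p oper) module" where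
  "stalk_algebra x = oper_algebra (\<Union>n. stalk_diffops n x)"

text \<open>The coefficient of \<open>s\<^sup>r\<close> in \<open>f(\<tau> + s)\<close>.\<close>

definition taylor_shift :: "'p::prime_card mod_ring poly \<Rightarrow> 'p ratfun \<Rightarrow> 'p ratfun fps" where
  "taylor_shift a \<tau> = poly (map_poly (\<lambda>c. fps_const (const c)) a) (fps_const \<tau> + fps_X)"

definition divided_derivation :: "'p::prime_card ratfun \<Rightarrow> nat \<Rightarrow> 'p oper" where
  "divided_derivation \<tau> r f = (THE y. \<exists>a b. b \<noteq> 0 \<and> f = eval a \<tau> / eval b \<tau> \<and>
     y = fps_nth (taylor_shift a \<tau> * inverse (taylor_shift b \<tau>)) r)"

section \<open>Differential operators of level \<open>m\<close>\<close>

text \<open>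
  Tensor algebras and quotients commute with filtered colimits, so the stalk at \<open>x\<close> of the sheaf
  \<open>D\<^sub>X\<^sup>(\<^sup>m\<^sup>)\<close> is the corresponding quotient of the tensor algebra of the stalk.  Sections of the sheaf are
  the families of germs that are locally given by an element of the tensor algebra of
  \<open>D\<^sub>X\<^sup>n(V)\<close>, \<open>n = 2p\<^sup>m - 1\<close>.
\<close>

definition D_rels :: "nat \<Rightarrow> 'p::prime_card ratfun set \<Rightarrow> ('p oper word \<Rightarrow>\<^sub>0 'p mod_ring) set" where
  "D_rels m x = unit_rels (stalk_algebra x)
     \<union> bracket_rels (stalk_algebra x) (stalk_diffops (CARD('p) ^ m) x)
     \<union> product_rels (stalk_algebra x)
         (stalk_diffops (CARD('p) ^ m) x) (stalk_diffops (CARD('p) ^ m - 1) x)"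

definition D_stalk ::
  "nat \<Rightarrow> 'p::prime_card ratfun set \<Rightarrow> ('p oper word \<Rightarrow>\<^sub>0 'p mod_ring) set ring" where
  "D_stalk m x =
     tensor_quotient (stalk_algebra x) (stalk_diffops (2 * CARD('p) ^ m - 1) x) (D_rels m x)"

definition D_germ :: "nat \<Rightarrow> 'p::prime_card ratfun set \<Rightarrow> ('p oper word \<Rightarrow>\<^sub>0 'p mod_ring) \<Rightarrow>
    ('p oper word \<Rightarrow>\<^sub>0 'p mod_ring) set" where
  "D_germ m x =
     tensor_class (stalk_algebra x) (stalk_diffops (2 * CARD('p) ^ m - 1) x) (D_rels m x)"

definition D_sections :: "nat \<Rightarrow> 'p::prime_card ratfun set set \<Rightarrow>
    ('p ratfun set \<Rightarrow> ('p oper word \<Rightarrow>\<^sub>0 'p mod_ring) set) set" where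
  "D_sections m U = {s \<in> (\<Pi>\<^sub>E x\<in>U. carrier (D_stalk m x)).
     \<forall>x\<in>U. \<exists>V. zariski_open V \<and> x \<in> V \<and> V \<subseteq> U \<and>
       (\<exists>w\<in>carrier (free_algebra (diffops (2 * CARD('p) ^ m - 1) V)).
          \<forall>y\<in>V. s y = D_germ m y w)}"

definition fun_germ :: "nat \<Rightarrow> 'p::prime_card ratfun set \<Rightarrow> 'p ratfun \<Rightarrow>
    ('p oper word \<Rightarrow>\<^sub>0 'p mod_ring) set" where
  "fun_germ m x f = D_germ m x (letter (\<lambda>g. f * g))"

text \<open>The germ at \<open>x\<close> of \<open>\<partial>\<^sub>\<tau>\<^sup>\<langle>\<^sup>l\<^sup>\<rangle>\<close> at level \<open>m\<close>.\<close>

definition angle_derivation :: "nat \<Rightarrow> 'p::prime_card ratfun set \<Rightarrow> 'p ratfun \<Rightarrow> nat \<Rightarrow>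
    ('p oper word \<Rightarrow>\<^sub>0 'p mod_ring) set" where
  "angle_derivation m x \<tau> l = (let q = CARD('p) ^ m in
     D_germ m x (letter (divided_derivation \<tau> (l mod q)) * letter (divided_derivation \<tau> q) ^ (l div q)))"

section \<open>The Frobenius pullback\<close>

text \<open>
  Since \<open>k\<close> is the prime field, \<open>X' = X\<close>, and \<open>F\<close> is the identity on points and the \<open>p\<close>-th power map on
  functions.  The stalk at \<open>x\<close> of the pullback is the tensor product of the local ring \<open>x\<close> and the
  stalk of \<open>D\<^sup>(\<^sup>m\<^sup>)\<close> over the local ring \<open>x\<close>, acting on the left factor through \<open>p\<close>-th powers; it is
  written as a multiplicative abelian group.
\<close>

type_synonym 'p pullback = "('p ratfun \<times> ('p oper word \<Rightarrow>\<^sub>0 'p mod_ring) set \<Rightarrow>\<^sub>0 int) set"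

definition formal_sums :: "nat \<Rightarrow> 'p::prime_card ratfun set \<Rightarrow>
    ('p ratfun \<times> ('p oper word \<Rightarrow>\<^sub>0 'p mod_ring) set \<Rightarrow>\<^sub>0 int) monoid" where
  "formal_sums m x = free_Abelian_group (x \<times> carrier (D_stalk m x))"

definition balanced_subgroup :: "nat \<Rightarrow> 'p::prime_card ratfun set \<Rightarrow> 'p pullback" where
  "balanced_subgroup m x = generate (formal_sums m x)
     ({frag_of (f + g, R) - frag_of (f, R) - frag_of (g, R) | f g R.
         f \<in> x \<and> g \<in> x \<and> R \<in> carrier (D_stalk m x)} \<union>
      {frag_of (f, R \<oplus>\<^bsub>D_stalk m x\<^esub> R') - frag_of (f, R) - frag_of (f, R') | f R R'.
         f \<in> x \<and> R \<in> carrier (D_stalk m x) \<and> R' \<in> carrier (D_stalk m x)} \<union>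
      {frag_of (f * h ^ CARD('p), R) - frag_of (f, fun_germ m x h \<otimes>\<^bsub>D_stalk m x\<^esub> R) | f h R.
         f \<in> x \<and> h \<in> x \<and> R \<in> carrier (D_stalk m x)})"

definition pullback_stalk :: "nat \<Rightarrow> 'p::prime_card ratfun set \<Rightarrow> 'p pullback monoid" where
  "pullback_stalk m x = formal_sums m x Mod balanced_subgroup m x"

definition pullback_class :: "nat \<Rightarrow> 'p::prime_card ratfun set \<Rightarrow>
    ('p ratfun \<times> ('p oper word \<Rightarrow>\<^sub>0 'p mod_ring) set \<Rightarrow>\<^sub>0 int) \<Rightarrow> 'p pullback" where
  "pullback_class m x c = balanced_subgroup m x #>\<^bsub>formal_sums m x\<^esub> c"

definition pure_tensor :: "nat \<Rightarrow> 'p::prime_card ratfun set \<Rightarrow> 'p ratfun \<Rightarrow>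
    ('p oper word \<Rightarrow>\<^sub>0 'p mod_ring) set \<Rightarrow> 'p pullback" where
  "pure_tensor m x f R = pullback_class m x (frag_of (f, R))"

definition pullback_smult ::
  "nat \<Rightarrow> 'p::prime_card ratfun set \<Rightarrow> 'p ratfun \<Rightarrow> 'p pullback \<Rightarrow> 'p pullback" where
  "pullback_smult m x f M =
     (\<Union>c\<in>M. pullback_class m x (frag_extend (\<lambda>(g, R). frag_of (f * g, R)) c))"

definition pullback_sections :: "nat \<Rightarrow> 'p::prime_card ratfun set set \<Rightarrow>
    ('p ratfun set \<Rightarrow> 'p pullback) set" where
  "pullback_sections m U = {s \<in> (\<Pi>\<^sub>E x\<in>U. carrier (pullback_stalk m x)).
     \<forall>x\<in>U. \<exists>V. zariski_open V \<and> x \<in> V \<and> V \<subseteq> U \<and>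
       (\<exists>fws. set fws \<subseteq> regular V \<times> carrier (free_algebra (diffops (2 * CARD('p) ^ m - 1) V)) \<and>
          (\<forall>y\<in>V. s y = pullback_class m y (\<Sum>(f, w)\<leftarrow>fws. frag_of (f, D_germ m y w))))}"

section \<open>The maps of the diagram\<close>

text \<open>
  The morphism \<open>\<rho>\<close> given by the action of \<open>G\<close> on \<open>X\<close>; it is determined by its values on the divided
  powers, which generate \<^term>\<open>Dist\<close>, and it respects orders.
\<close>

definition action_morphism :: "(distribution \<Rightarrow> 'p::prime_card oper) \<Rightarrow> bool" where
  "action_morphism \<rho> \<longleftrightarrow>
     (let A = (Dist :: ('p mod_ring, distribution) module); B = global_diffops; p = CARD('p) in
       \<rho> \<in> Ring.ring_hom A B \<and>
       (\<forall>c. \<forall>u\<in>carrier A. \<rho> (c \<odot>\<^bsub>A\<^esub> u) = c \<odot>\<^bsub>B\<^esub> \<rho> u) \<and>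
       (\<forall>n. \<rho> (dist_E p n) = divided_derivation coord n) \<and>
       (\<forall>n. \<rho> (dist_F p n) = divided_derivation (inverse coord) n) \<and>
       (\<forall>n. \<rho> ` dist_order TYPE('p) n \<subseteq> diffops n points))"

text \<open>The induced map \<open>\<rho>\<^sub>m\<close>, with values in global sections given by their germs.\<close>

definition action_level :: "(distribution \<Rightarrow> 'p::prime_card oper) \<Rightarrow> nat \<Rightarrow>
    (distribution word \<Rightarrow>\<^sub>0 'p mod_ring) set \<Rightarrow>
    ('p ratfun set \<Rightarrow> ('p oper word \<Rightarrow>\<^sub>0 'p mod_ring) set)" where
  "action_level \<rho> m u = (\<lambda>x\<in>points. \<Union>w\<in>u. D_germ m x (free_map \<rho> w))"

text \<open>
  Berthelot's morphism of sheaves \<open>D\<^sub>X\<^sup>(\<^sup>m\<^sup>+\<^sup>1\<^sup>) \<rightarrow> F\<^sup>*D\<^sub>X\<^sub>'\<^sup>(\<^sup>m\<^sup>)\<close>, given by its maps \<open>\<kappa> x\<close> on stalks.  The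
  formula in local coordinates determines it, as \<open>t\<close> or \<open>t'\<close> is a coordinate at each point.
\<close>

definition berthelot_can :: "nat \<Rightarrow> ('p::prime_card ratfun set \<Rightarrow>
    ('p oper word \<Rightarrow>\<^sub>0 'p mod_ring) set \<Rightarrow> 'p pullback) \<Rightarrow> bool" where
  "berthelot_can m \<kappa> \<longleftrightarrow>
     (\<forall>x\<in>points.
        \<kappa> x \<in> carrier (D_stalk (Suc m) x) \<rightarrow> carrier (pullback_stalk m x) \<and>
        (\<forall>R\<in>carrier (D_stalk (Suc m) x). \<forall>R'\<in>carrier (D_stalk (Suc m) x).
           \<kappa> x (R \<oplus>\<^bsub>D_stalk (Suc m) x\<^esub> R') = \<kappa> x R \<otimes>\<^bsub>pullback_stalk m x\<^esub> \<kappa> x R') \<and>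
        (\<forall>f\<in>x. \<forall>R\<in>carrier (D_stalk (Suc m) x).
           \<kappa> x (fun_germ (Suc m) x f \<otimes>\<^bsub>D_stalk (Suc m) x\<^esub> R) = pullback_smult m x f (\<kappa> x R)) \<and>
        (\<forall>\<tau>\<in>coords. \<tau> \<in> x \<longrightarrow> (\<forall>l. \<kappa> x (angle_derivation (Suc m) x \<tau> l) =
           (if CARD('p) dvd l
            then pure_tensor m x 1 (angle_derivation m x \<tau> (l div CARD('p)))
            else \<one>\<^bsub>pullback_stalk m x\<^esub>)))) \<and>
     (\<forall>U. zariski_open U \<longrightarrow>
        (\<forall>s\<in>D_sections (Suc m) U. (\<lambda>x\<in>U. \<kappa> x (s x)) \<in> pullback_sections m U))"

definition can_global :: "nat \<Rightarrow> ('p::prime_card ratfun set \<Rightarrow>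
    ('p oper word \<Rightarrow>\<^sub>0 'p mod_ring) set \<Rightarrow> 'p pullback) \<Rightarrow>
    ('p ratfun set \<Rightarrow> ('p oper word \<Rightarrow>\<^sub>0 'p mod_ring) set) \<Rightarrow> ('p ratfun set \<Rightarrow> 'p pullback)" where
  "can_global m \<kappa> = (\<lambda>s\<in>D_sections (Suc m) points. \<lambda>x\<in>points. \<kappa> x (s x))"

definition one_tensor :: "nat \<Rightarrow> ('p::prime_card ratfun set \<Rightarrow> ('p oper word \<Rightarrow>\<^sub>0 'p mod_ring) set) \<Rightarrow>
    ('p ratfun set \<Rightarrow> 'p pullback)" where
  "one_tensor m = (\<lambda>s\<in>D_sections m points. \<lambda>x\<in>points. pure_tensor m x 1 (s x))"

end

theory Submission
  imports Defs
begin

text \<open>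
  An operator \<open>v\<close> in \<open>Dist\<close> and its Frobenius transform \<open>\<phi> v\<close> act on the function field by operators with
  \<open>\<rho> v (h\<^sup>p) = (\<rho> (\<phi> v) h)\<^sup>p\<close>: this is multiplicative in \<open>v\<close>, and for the divided powers of \<open>E\<close> and \<open>F\<close> it
  is the rule for divided derivations of \<open>p\<close>-th powers.  Writing both operators in a coordinate \<open>\<tau>\<close>
  regular at a point, as \<open>\<Sum> f\<^sub>l \<partial>\<^sup>[\<^sup>l\<^sup>]\<close> and \<open>\<Sum> g\<^sub>l \<partial>\<^sup>[\<^sup>l\<^sup>]\<close>, this says \<open>f\<^sub>p\<^sub>l = g\<^sub>l\<^sup>p\<close>.  On the other hand the Leibniz
  rule defines an action of \<open>\<partial>\<^sup>[\<^sup>n\<^sup>]\<close> on the Frobenius pullback for which Berthelot's map is equivariant;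
  on \<open>1 \<otimes> S\<close> it gives \<open>1 \<otimes> \<partial>\<^sup>[\<^sup>n\<^sup>/\<^sup>p\<^sup>] S\<close> or \<open>0\<close>.  Moving the \<open>p\<close>-th powers \<open>g\<^sub>l\<^sup>p\<close> across the tensor sign, left
  multiplication by \<open>\<rho> v\<close> thus corresponds to left multiplication of \<open>S\<close> by \<open>\<rho> (\<phi> v)\<close>, and the theorem
  follows by induction on words.
\<close>

section \<open>Quotients of tensor algebras\<close>

text \<open>Berthelot's map is given on stalks by additivity, left linearity and its values on the
  elements \<open>angle_derivation\<close>; its target is a mere abelian group. The image of a word
  is a product of operators, and no hypothesis evaluates the map on products. The way out is that
  every germ is a left combination of angle elements (\<open>in_span_all\<close>), so an additive
  operator on the pullback that matches left multiplication by a divided derivation on such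
  combinations matches it on all germs. The delicate point is that this operator,
  \<open>pull_dd\<close>, has to respect the balancing relation, which contains p-th powers; it does
  because divided derivations send a p-th power to a p-th power or to zero. A second obstacle lies
  in \<open>Dist\<close>: the Kostant form is generated by the divided powers of E and F, while the
  filtration by order is spanned by monomials that also contain the binomials in H. Kostant's
  commutation formula is proved in order to place these binomials in the form, since
  \<open>\<phi>\<close> and \<open>\<rho>\<close> can be computed only on products of elements of
  \<open>Dist\<close>.\<close>

lemma ring_on_simps [simp]:
  "carrier (ring_on S) = S" "monoid.mult (ring_on S) = (*)" "monoid.one (ring_on S) = 1"
  "ring.zero (ring_on S) = 0" "ring.add (ring_on S) = (+)"
  by (simp_all add: ring_on_def)

lemma ring_ring_on:
  fixes S :: "'a::ring_1 set"
  assumes "0 \<in> S" "1 \<in> S" "\<And>a b. a \<in> S \<Longrightarrow> b \<in> S \<Longrightarrow> a + b \<in> S"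
    "\<And>a b. a \<in> S \<Longrightarrow> b \<in> S \<Longrightarrow> a * b \<in> S" "\<And>a. a \<in> S \<Longrightarrow> - a \<in> S"
  shows "ring (ring_on S)"
proof (rule ringI)
  show "abelian_group (ring_on S)"
    using assms by (intro abelian_groupI) (auto simp: algebra_simps intro: bexI[of _ "- x" for x])
  show "monoid (ring_on S)"
    using assms by (intro monoidI) (auto simp: algebra_simps)
qed (use assms in \<open>auto simp: algebra_simps\<close>)

section \<open>Free algebras on words\<close>

lemma set_word_plus: "set_word (u + v) = set_word u \<union> set_word v"
  by (cases u; cases v) simp

lemma set_word_zero [simp]: "set_word 0 = {}"
  by (simp add: zero_word_def)

lemma map_word_plus: "map_word h (u + v) = map_word h u + map_word h v"
  by (cases u; cases v) simp

lemma map_word_zero [simp]: "map_word h 0 = 0"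
  by (simp add: zero_word_def)

lemma mem_free_algebra: "a \<in> carrier (free_algebra V) \<longleftrightarrow> (\<forall>w\<in>Poly_Mapping.keys a. set_word w \<subseteq> V)"
  by (simp add: free_algebra_def)

lemma free_algebra_simps [simp]:
  "monoid.mult (free_algebra V) = (*)" "monoid.one (free_algebra V) = 1"
  "ring.zero (free_algebra V) = 0" "ring.add (free_algebra V) = (+)"
  by (simp_all add: free_algebra_def)

lemma free_algebra_closed:
  fixes a b :: "'g word \<Rightarrow>\<^sub>0 'r::comm_ring_1"
  shows "0 \<in> carrier (free_algebra V :: ('g word \<Rightarrow>\<^sub>0 'r) ring)"
    "1 \<in> carrier (free_algebra V :: ('g word \<Rightarrow>\<^sub>0 'r) ring)"
    "a \<in> carrier (free_algebra V) \<Longrightarrow> b \<in> carrier (free_algebra V) \<Longrightarrow> a + b \<in> carrier (free_algebra V)"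
    "a \<in> carrier (free_algebra V) \<Longrightarrow> b \<in> carrier (free_algebra V) \<Longrightarrow> a * b \<in> carrier (free_algebra V)"
    "a \<in> carrier (free_algebra V) \<Longrightarrow> - a \<in> carrier (free_algebra V)"
    "a \<in> carrier (free_algebra V) \<Longrightarrow> b \<in> carrier (free_algebra V) \<Longrightarrow> a - b \<in> carrier (free_algebra V)"
    "set_word w \<subseteq> V \<Longrightarrow> Poly_Mapping.single w c \<in> carrier (free_algebra V :: ('g word \<Rightarrow>\<^sub>0 'r) ring)"
proof -
  show p: "a + b \<in> carrier (free_algebra V)"
    if "a \<in> carrier (free_algebra V)" "b \<in> carrier (free_algebra V)" for a b :: "'g word \<Rightarrow>\<^sub>0 'r"
    using that Poly_Mapping.keys_add[of a b] by (auto simp: mem_free_algebra)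
  show m: "- a \<in> carrier (free_algebra V)" if "a \<in> carrier (free_algebra V)" for a :: "'g word \<Rightarrow>\<^sub>0 'r"
    using that by (auto simp: mem_free_algebra in_keys_iff)
  show "a - b \<in> carrier (free_algebra V)"
    if "a \<in> carrier (free_algebra V)" "b \<in> carrier (free_algebra V)" for a b :: "'g word \<Rightarrow>\<^sub>0 'r"
    using p[OF that(1) m[OF that(2)]] by simp
  show "a * b \<in> carrier (free_algebra V)"
    if "a \<in> carrier (free_algebra V)" "b \<in> carrier (free_algebra V)" for a b :: "'g word \<Rightarrow>\<^sub>0 'r"
    unfolding mem_free_algebra
  proof
    fix w assume "w \<in> Poly_Mapping.keys (a * b)"
    then obtain u v where "w = u + v" "u \<in> Poly_Mapping.keys a" "v \<in> Poly_Mapping.keys b"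
      using keys_mult[of a b] by blast
    then show "set_word w \<subseteq> V" using that by (auto simp: mem_free_algebra set_word_plus)
  qed
qed (auto simp: mem_free_algebra)

lemma letter_closed: "v \<in> V \<Longrightarrow> letter v \<in> carrier (free_algebra V)"
  unfolding letter_def by (rule free_algebra_closed) simp

lemma scalar_closed: "scalar c \<in> carrier (free_algebra V)"
  unfolding scalar_def by (rule free_algebra_closed) simp

lemma power_closed: "a \<in> carrier (free_algebra V) \<Longrightarrow> a ^ n \<in> carrier (free_algebra V)"
  by (induction n) (auto intro: free_algebra_closed)

lemma sum_free_algebra_closed:
  "(\<And>i. i \<in> I \<Longrightarrow> a i \<in> carrier (free_algebra V)) \<Longrightarrow> sum a I \<in> carrier (free_algebra V)"
  by (induction I rule: infinite_finite_induct) (auto intro: free_algebra_closed)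

lemma free_algebra_mono:
  "V \<subseteq> W \<Longrightarrow> a \<in> carrier (free_algebra V) \<Longrightarrow> a \<in> carrier (free_algebra W)"
  by (auto simp: mem_free_algebra)

lemma ring_free_algebra: "ring (free_algebra V)"
proof -
  have "free_algebra V = ring_on (carrier (free_algebra V))" by (simp add: free_algebra_def)
  then show ?thesis
    by (rule ssubst) (rule ring_ring_on; rule free_algebra_closed; assumption)
qed

lemma a_inv_eq:
  assumes "ring R" "\<And>a b. a \<oplus>\<^bsub>R\<^esub> b = a + b" "\<zero>\<^bsub>R\<^esub> = 0" "x \<in> carrier R" "- x \<in> carrier R"
  shows "\<ominus>\<^bsub>R\<^esub> x = - (x :: 'a::ab_group_add)"
proof -
  interpret ring R by fact
  show ?thesis
    by (rule minus_equality) (use assms in auto)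
qed

lemma free_algebra_a_inv: "a \<in> carrier (free_algebra V) \<Longrightarrow> \<ominus>\<^bsub>free_algebra V\<^esub> a = - a"
  by (rule a_inv_eq) (auto intro: ring_free_algebra free_algebra_closed)

lemma scalar_simps:
  "scalar 0 = 0" "scalar 1 = 1" "scalar (c + d) = scalar c + scalar d"
  "scalar (c * d) = scalar c * scalar d"
  by (simp_all add: scalar_def single_add mult_single)

lemma sum_single_lookup: "(\<Sum>w\<in>Poly_Mapping.keys a. Poly_Mapping.single w (Poly_Mapping.lookup a w)) = a"
  by (rule poly_mapping_eqI)
     (simp add: lookup_sum lookup_single when_def in_keys_iff sum.delta)

lemma scalar_mult: "scalar c * a = (\<Sum>w\<in>Poly_Mapping.keys a. Poly_Mapping.single w (c * Poly_Mapping.lookup a w))"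
  by (subst (1) sum_single_lookup[of a, symmetric]) (simp add: sum_distrib_left scalar_def mult_single)

lemma scalar_commute: "scalar c * a = a * scalar c"
proof -
  have "a * scalar c = (\<Sum>w\<in>Poly_Mapping.keys a. Poly_Mapping.single w (c * Poly_Mapping.lookup a w))"
    by (subst (1) sum_single_lookup[of a, symmetric])
      (simp add: sum_distrib_right scalar_def mult_single mult.commute)
  then show ?thesis by (simp add: scalar_mult)
qed

lemma single_Cons: "Poly_Mapping.single (Word (v # u)) c = letter v * Poly_Mapping.single (Word u) c"
  by (simp add: letter_def mult_single)

lemma single_Nil: "Poly_Mapping.single (Word []) c = scalar c"
  by (simp add: scalar_def zero_word_def)

text \<open>An element is the finite sum of its monomials. The last case is a monomial on a list,
  not a product of letters, so that a second induction on the list can split off letters from the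
  left by \<open>single_Cons\<close>.\<close>

lemma free_algebra_induct [consumes 1, case_names zero add word]:
  fixes P :: "('g word \<Rightarrow>\<^sub>0 'r::comm_ring_1) \<Rightarrow> bool"
  assumes "a \<in> carrier (free_algebra V)" and "P 0"
    and "\<And>a b. a \<in> carrier (free_algebra V) \<Longrightarrow> b \<in> carrier (free_algebra V) \<Longrightarrow> P a \<Longrightarrow> P b \<Longrightarrow> P (a + b)"
    and "\<And>u c. set u \<subseteq> V \<Longrightarrow> P (Poly_Mapping.single (Word u) c)"
  shows "P a"
proof -
  have w: "P (Poly_Mapping.single w (Poly_Mapping.lookup a w))"
    "Poly_Mapping.single w (Poly_Mapping.lookup a w) \<in> carrier (free_algebra V)"
    if "w \<in> Poly_Mapping.keys a" for w
  proof -
    obtain u where u: "w = Word u" by (cases w)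
    with that assms(1) have "set u \<subseteq> V" by (force simp: mem_free_algebra)
    then show "P (Poly_Mapping.single w (Poly_Mapping.lookup a w))"
      "Poly_Mapping.single w (Poly_Mapping.lookup a w) \<in> carrier (free_algebra V)"
      unfolding u by (auto intro!: assms(4) free_algebra_closed(7))
  qed
  have "P (\<Sum>w\<in>K. Poly_Mapping.single w (Poly_Mapping.lookup a w)) \<and>
    (\<Sum>w\<in>K. Poly_Mapping.single w (Poly_Mapping.lookup a w)) \<in> carrier (free_algebra V)"
    if "finite K" "K \<subseteq> Poly_Mapping.keys a" for K
    using that by (induction K) (auto intro!: assms(2,3) w intro: free_algebra_closed(1,3))
  from this[of "Poly_Mapping.keys a"] show ?thesis by (simp add: sum_single_lookup)
qed

section \<open>Functoriality of the free algebra\<close>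

lemma free_map_single [simp]: "free_map h (Poly_Mapping.single w c) = Poly_Mapping.single (map_word h w) c"
  by (simp add: free_map_def)

lemma free_map_letter [simp]: "free_map h (letter v) = letter (h v)"
  by (simp add: letter_def)

lemma free_map_scalar [simp]: "free_map h (scalar c) = scalar c"
  by (simp add: scalar_def)

lemma free_map_0 [simp]: "free_map h 0 = 0"
  by (simp add: free_map_def)

lemma free_map_1 [simp]: "free_map h 1 = 1"
  by (simp add: free_map_def)

lemma free_map_add: "free_map h (a + b) = free_map h a + free_map h b"
  unfolding free_map_def by (rule setsum_keys_plus_distrib) (auto simp: single_add)

lemma free_map_uminus: "free_map h (- a) = - free_map h a"
  using free_map_add[of h a "- a"] by (simp add: eq_neg_iff_add_eq_0 add.commute)

lemma free_map_diff: "free_map h (a - b) = free_map h a - free_map h b"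
  using free_map_add[of h a "- b"] by (simp add: free_map_uminus)

lemma free_map_sum: "free_map h (sum f I) = (\<Sum>i\<in>I. free_map h (f i))"
  by (induction I rule: infinite_finite_induct) (auto simp: free_map_add)

lemma free_map_mult: "free_map h (a * b) = free_map h a * free_map h b"
proof -
  have "free_map h (a * b) = free_map h ((\<Sum>w\<in>Poly_Mapping.keys a. Poly_Mapping.single w (Poly_Mapping.lookup a w)) *
      (\<Sum>w\<in>Poly_Mapping.keys b. Poly_Mapping.single w (Poly_Mapping.lookup b w)))"
    by (simp only: sum_single_lookup)
  also have "\<dots> = free_map h (\<Sum>w\<in>Poly_Mapping.keys a. Poly_Mapping.single w (Poly_Mapping.lookup a w)) *
      free_map h (\<Sum>w\<in>Poly_Mapping.keys b. Poly_Mapping.single w (Poly_Mapping.lookup b w))"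
    by (simp add: sum_product free_map_sum mult_single map_word_plus)
  finally show ?thesis by (simp only: sum_single_lookup)
qed

lemma free_map_closed:
  assumes "a \<in> carrier (free_algebra V)" "h ` V \<subseteq> W"
  shows "free_map h a \<in> carrier (free_algebra W)"
  using assms(1)
proof (induction rule: free_algebra_induct)
  case (word u c)
  then have "set_word (map_word h (Word u)) \<subseteq> W" using assms(2) by auto
  then show ?case unfolding free_map_single by (rule free_algebra_closed)
qed (auto simp: free_map_add intro: free_algebra_closed)

section \<open>Ideals of tensor relations and their cosets\<close>

lemma ideal_tensor_ideal: "ideal (tensor_ideal A V S) (free_algebra V)"
  unfolding tensor_ideal_def by (rule ring.genideal_ideal[OF ring_free_algebra]) auto

lemma tensor_ideal_closed:
  shows "0 \<in> tensor_ideal A V S"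
    "a \<in> tensor_ideal A V S \<Longrightarrow> b \<in> tensor_ideal A V S \<Longrightarrow> a + b \<in> tensor_ideal A V S"
    "a \<in> tensor_ideal A V S \<Longrightarrow> - a \<in> tensor_ideal A V S"
    "a \<in> tensor_ideal A V S \<Longrightarrow> b \<in> tensor_ideal A V S \<Longrightarrow> a - b \<in> tensor_ideal A V S"
    "a \<in> tensor_ideal A V S \<Longrightarrow> a \<in> carrier (free_algebra V)"
    "a \<in> tensor_ideal A V S \<Longrightarrow> c \<in> carrier (free_algebra V) \<Longrightarrow> c * a \<in> tensor_ideal A V S"
    "a \<in> tensor_ideal A V S \<Longrightarrow> c \<in> carrier (free_algebra V) \<Longrightarrow> a * c \<in> tensor_ideal A V S"
proof -
  interpret ideal "tensor_ideal A V S" "free_algebra V" by (rule ideal_tensor_ideal)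
  show "0 \<in> tensor_ideal A V S" using additive_subgroup.zero_closed[OF additive_subgroup_axioms] by simp
  show p: "a + b \<in> tensor_ideal A V S" if "a \<in> tensor_ideal A V S" "b \<in> tensor_ideal A V S" for a b
    using additive_subgroup.a_closed[OF additive_subgroup_axioms that] by simp
  show c: "a \<in> carrier (free_algebra V)" if "a \<in> tensor_ideal A V S" for a
    using that by (rule Icarr)
  show m: "- a \<in> tensor_ideal A V S" if "a \<in> tensor_ideal A V S" for a
    using additive_subgroup.a_inv_closed[OF additive_subgroup_axioms that] free_algebra_a_inv[OF c[OF that]] by simp
  show "a - b \<in> tensor_ideal A V S" if "a \<in> tensor_ideal A V S" "b \<in> tensor_ideal A V S" for a b
    using p[OF that(1) m[OF that(2)]] by simp
  show "c * a \<in> tensor_ideal A V S" "a * c \<in> tensor_ideal A V S"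
    if "a \<in> tensor_ideal A V S" "c \<in> carrier (free_algebra V)" for a c
    using I_l_closed[OF that] I_r_closed[OF that] by simp_all
qed

lemma tensor_ideal_rel:
  "r \<in> linearity_rels A V \<union> S \<Longrightarrow> r \<in> carrier (free_algebra V) \<Longrightarrow> r \<in> tensor_ideal A V S"
  unfolding tensor_ideal_def
  using ring.genideal_self[OF ring_free_algebra, of "(linearity_rels A V \<union> S) \<inter> carrier (free_algebra V)"]
  by blast

text \<open>The preimage of an ideal under the ring homomorphism \<open>free_map h\<close> is an
  ideal, so only the generators need checking. Both induced maps, for \<open>\<phi>\<close> and for
  \<open>\<rho>\<close>, are shown to be well defined on cosets in this way.\<close>

lemma tensor_ideal_map:
  assumes hV: "h ` V \<subseteq> W"
    and rels: "\<And>r. r \<in> linearity_rels A V \<union> S \<Longrightarrow> r \<in> carrier (free_algebra V) \<Longrightarrow>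
      free_map h r \<in> tensor_ideal A' W S'"
    and a: "a \<in> tensor_ideal A V S"
  shows "free_map h a \<in> tensor_ideal A' W S'"
proof -
  interpret ring_hom_ring "free_algebra V" "free_algebra W" "free_map h"
    by (rule ring_hom_ringI) (auto simp: ring_free_algebra free_map_add free_map_mult
      intro: free_map_closed[OF _ hV])
  have "ideal {r \<in> carrier (free_algebra V). free_map h r \<in> tensor_ideal A' W S'} (free_algebra V)"
    by (rule ideal_vimage) (rule ideal_tensor_ideal)
  then have "tensor_ideal A V S \<subseteq> {r \<in> carrier (free_algebra V). free_map h r \<in> tensor_ideal A' W S'}"
    unfolding tensor_ideal_def[of A V] by (rule ring.genideal_minimal[OF ring_free_algebra]) (use rels in auto)
  then show ?thesis using a by auto
qed

lemma mem_tensor_class: "b \<in> tensor_class A V S a \<longleftrightarrow> b - a \<in> tensor_ideal A V S"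
  by (auto simp: tensor_class_def a_r_coset_def r_coset_def) (metis diff_add_cancel)

lemma tensor_class_eq: "tensor_class A V S a = tensor_class A V S b \<longleftrightarrow> a - b \<in> tensor_ideal A V S"
proof
  assume "tensor_class A V S a = tensor_class A V S b"
  then show "a - b \<in> tensor_ideal A V S"
    using mem_tensor_class[of a A V S a] by (simp add: tensor_ideal_closed(1) mem_tensor_class)
next
  assume ab: "a - b \<in> tensor_ideal A V S"
  show "tensor_class A V S a = tensor_class A V S b"
  proof (rule Set.set_eqI)
    fix c
    show "c \<in> tensor_class A V S a \<longleftrightarrow> c \<in> tensor_class A V S b"
      using tensor_ideal_closed(2)[OF _ ab, of "c - a"] tensor_ideal_closed(4)[OF _ ab, of "c - b"]
      by (auto simp: mem_tensor_class)
  qed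
qed

lemma carrier_tensor_quotient: "carrier (tensor_quotient A V S) = tensor_class A V S ` carrier (free_algebra V)"
  by (auto simp: tensor_quotient_def FactRing_def A_RCOSETS_def' tensor_class_def)

lemma tensor_class_hom: "tensor_class A V S \<in> Ring.ring_hom (free_algebra V) (tensor_quotient A V S)"
  using ideal.rcos_ring_hom[OF ideal_tensor_ideal[of A V S]]
  unfolding tensor_quotient_def tensor_class_def[abs_def] by simp

lemma tensor_class_add:
  "a \<in> carrier (free_algebra V) \<Longrightarrow> b \<in> carrier (free_algebra V) \<Longrightarrow>
   tensor_class A V S a \<oplus>\<^bsub>tensor_quotient A V S\<^esub> tensor_class A V S b = tensor_class A V S (a + b)"
  using ring_hom_add[OF tensor_class_hom[of A V S], of a b] by simp

lemma tensor_class_mult: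
  "a \<in> carrier (free_algebra V) \<Longrightarrow> b \<in> carrier (free_algebra V) \<Longrightarrow>
   tensor_class A V S a \<otimes>\<^bsub>tensor_quotient A V S\<^esub> tensor_class A V S b = tensor_class A V S (a * b)"
  using ring_hom_mult[OF tensor_class_hom[of A V S], of a b] by simp

lemma tensor_class_cong_add:
  "tensor_class A V S a = tensor_class A V S a' \<Longrightarrow> tensor_class A V S b = tensor_class A V S b' \<Longrightarrow>
   tensor_class A V S (a + b) = tensor_class A V S (a' + b')"
  unfolding tensor_class_eq using tensor_ideal_closed(2)[of "a - a'" A V S "b - b'"] by (simp add: algebra_simps)

lemma tensor_class_cong_sum:
  "(\<And>i. i \<in> I \<Longrightarrow> tensor_class A V S (a i) = tensor_class A V S (b i)) \<Longrightarrow>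
   tensor_class A V S (sum a I) = tensor_class A V S (sum b I)"
proof (induction I rule: infinite_finite_induct)
  case (insert i I)
  then show ?case unfolding sum.insert[OF insert(1,2)] by (intro tensor_class_cong_add) blast+
qed simp_all

text \<open>From a b - a' b' = (a - a') b + a' (b - b'); this is why membership in the algebra is
  asked of a' and b.\<close>

lemma tensor_class_cong_mult:
  assumes "tensor_class A V S a = tensor_class A V S a'" "tensor_class A V S b = tensor_class A V S b'"
    and "a' \<in> carrier (free_algebra V)" "b \<in> carrier (free_algebra V)"
  shows "tensor_class A V S (a * b) = tensor_class A V S (a' * b')"
proof -
  have "(a - a') * b + a' * (b - b') \<in> tensor_ideal A V S"
    using assms by (intro tensor_ideal_closed(2) tensor_ideal_closed(6,7)) (simp_all add: tensor_class_eq)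
  then show ?thesis by (simp add: tensor_class_eq algebra_simps)
qed

lemma tensor_class_letter_add:
  "v \<in> V \<Longrightarrow> w \<in> V \<Longrightarrow> v \<oplus>\<^bsub>A\<^esub> w \<in> V \<Longrightarrow>
   tensor_class A V S (letter (v \<oplus>\<^bsub>A\<^esub> w)) = tensor_class A V S (letter v + letter w)"
  \<comment> \<open>The difference must take the shape a - b - c in which
    \<open>linearity_rels\<close> lists it.\<close>
  unfolding tensor_class_eq diff_diff_eq[symmetric]
  by (rule tensor_ideal_rel, unfold linearity_rels_def, blast)
     (intro free_algebra_closed(6) letter_closed; assumption)

lemma tensor_class_letter_smult:
  "v \<in> V \<Longrightarrow> c \<odot>\<^bsub>A\<^esub> v \<in> V \<Longrightarrow>
   tensor_class A V S (letter (c \<odot>\<^bsub>A\<^esub> v)) = tensor_class A V S (scalar c * letter v)"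
  unfolding tensor_class_eq
  by (rule tensor_ideal_rel, unfold linearity_rels_def, blast)
     (intro free_algebra_closed(4,6) letter_closed scalar_closed; assumption)

lemma tensor_class_scalar:
  "c \<odot>\<^bsub>A\<^esub> \<one>\<^bsub>A\<^esub> \<in> V \<Longrightarrow> unit_rels A \<subseteq> S \<Longrightarrow>
   tensor_class A V S (scalar c) = tensor_class A V S (letter (c \<odot>\<^bsub>A\<^esub> \<one>\<^bsub>A\<^esub>))"
  unfolding tensor_class_eq
  by (rule tensor_ideal_rel, unfold unit_rels_def, blast)
     (intro free_algebra_closed(4,6) letter_closed scalar_closed; assumption)

lemma tensor_class_product:
  assumes "u \<in> B" "v \<in> C" "B \<subseteq> V" "C \<subseteq> V" "u \<otimes>\<^bsub>A\<^esub> v \<in> V" "product_rels A B C \<subseteq> S"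
  shows "tensor_class A V S (letter u * letter v) = tensor_class A V S (letter (u \<otimes>\<^bsub>A\<^esub> v))"
proof -
  have "letter u * letter v - letter (u \<otimes>\<^bsub>A\<^esub> v) \<in> product_rels A B C"
    using assms unfolding product_rels_def by blast
  moreover have "letter u * letter v - letter (u \<otimes>\<^bsub>A\<^esub> v) \<in> carrier (free_algebra V)"
    using assms by (intro free_algebra_closed(4,6) letter_closed) auto
  ultimately show ?thesis
    unfolding tensor_class_eq using assms(6) by (intro tensor_ideal_rel) auto
qed

lemma tensor_class_bracket:
  assumes "u \<in> B" "v \<in> B" "B \<subseteq> V" "u \<otimes>\<^bsub>A\<^esub> v \<ominus>\<^bsub>A\<^esub> v \<otimes>\<^bsub>A\<^esub> u \<in> V" "bracket_rels A B \<subseteq> S"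
  shows "tensor_class A V S (letter u * letter v - letter v * letter u) =
    tensor_class A V S (letter (u \<otimes>\<^bsub>A\<^esub> v \<ominus>\<^bsub>A\<^esub> v \<otimes>\<^bsub>A\<^esub> u))"
proof -
  have "letter u * letter v - letter v * letter u - letter (u \<otimes>\<^bsub>A\<^esub> v \<ominus>\<^bsub>A\<^esub> v \<otimes>\<^bsub>A\<^esub> u) \<in> bracket_rels A B"
    using assms unfolding bracket_rels_def by blast
  moreover have "letter u * letter v - letter v * letter u - letter (u \<otimes>\<^bsub>A\<^esub> v \<ominus>\<^bsub>A\<^esub> v \<otimes>\<^bsub>A\<^esub> u)
      \<in> carrier (free_algebra V)"
    using assms by (intro free_algebra_closed(4,6) letter_closed) auto
  ultimately show ?thesis
    unfolding tensor_class_eq using assms(5) by (intro tensor_ideal_rel) auto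
qed

section \<open>The function field of the projective line\<close>

lemma const_simps:
  "const 0 = 0" "const 1 = 1" "const (a + b) = const a + const b" "const (a * b) = const a * const b"
  by (simp_all add: const_def Zero_fract_def One_fract_def one_pCons mult.commute)

lemma const_eq_0_iff: "const c = 0 \<longleftrightarrow> c = 0"
  by (simp add: const_def Zero_fract_def eq_fract)

lemma const_of_nat: "const (of_nat n) = of_nat n"
  by (induction n) (simp_all add: const_simps)

lemma CHAR_ratfun: "CHAR('p::prime_card ratfun) = CARD('p)"
proof (rule CHAR_eqI)
  show "of_nat CARD('p) = (0 :: 'p ratfun)"
    by (metis const_of_nat const_simps(1) of_nat_card_eq_0)
  show "CARD('p) dvd n" if "of_nat n = (0 :: 'p ratfun)" for n
  proof -
    have "of_nat n = (0 :: 'p mod_ring)"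
      using that by (metis const_of_nat const_eq_0_iff)
    then show ?thesis by (simp add: of_nat_eq_0_iff_char_dvd)
  qed
qed

text \<open>Fermat's little theorem for the prime field. It lets scalars cross the Frobenius-twisted
  tensor sign unchanged.\<close>

lemma const_power_card: "const (c :: 'p::prime_card mod_ring) ^ CARD('p) = const c"
proof -
  have "const c ^ n = const (c ^ n)" for n
    by (induction n) (simp_all add: const_simps)
  then show ?thesis using finite_field_power_card_eq_same[of c] by simp
qed

lemma map_poly_hom:
  fixes h :: "'a::comm_ring_1 \<Rightarrow> 'b::comm_ring_1"
  assumes h: "h 0 = 0" "\<And>x y. h (x + y) = h x + h y" "\<And>x y. h (x * y) = h x * h y"
  shows "map_poly h (a + b) = map_poly h a + map_poly h b"
    "map_poly h (a * b) = map_poly h a * map_poly h b"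
proof -
  have s: "h (sum f I) = (\<Sum>i\<in>I. h (f i))" for f :: "nat \<Rightarrow> 'a" and I
    by (induction I rule: infinite_finite_induct) (auto simp: h)
  show "map_poly h (a + b) = map_poly h a + map_poly h b"
    by (rule poly_eqI) (simp add: coeff_map_poly h)
  show "map_poly h (a * b) = map_poly h a * map_poly h b"
    by (rule poly_eqI) (simp add: coeff_map_poly coeff_mult h s)
qed

lemma eval_simps:
  "eval 0 \<tau> = 0" "eval 1 \<tau> = 1" "eval (a + b) \<tau> = eval a \<tau> + eval b \<tau>"
  "eval (a * b) \<tau> = eval a \<tau> * eval b \<tau>" "eval (pCons c a) \<tau> = const c + \<tau> * eval a \<tau>"
proof -
  show p: "eval (pCons c a) \<tau> = const c + \<tau> * eval a \<tau>" for c a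
    by (cases "c = 0 \<and> a = 0") (auto simp: eval_def map_poly_pCons const_simps)
  show "eval 0 \<tau> = 0" by (simp add: eval_def)
  then show "eval 1 \<tau> = 1" by (simp add: one_pCons p const_simps)
  show "eval (a + b) \<tau> = eval a \<tau> + eval b \<tau>" "eval (a * b) \<tau> = eval a \<tau> * eval b \<tau>"
    by (simp_all add: eval_def map_poly_hom const_simps)
qed

lemma eval_coord: "eval a coord = Fract a 1"
proof (induction a)
  case 0
  then show ?case by (simp add: eval_simps Zero_fract_def)
next
  case (pCons c a)
  then show ?case by (simp add: eval_simps const_def coord_def)
qed

lemma coord_nonzero: "coord \<noteq> 0"
  by (simp add: coord_def Zero_fract_def eq_fract)

lemma eval_coord_eq_0_iff: "eval a coord = 0 \<longleftrightarrow> a = 0"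
  by (simp add: eval_coord Zero_fract_def eq_fract)

text \<open>For the inverse coordinate, the reversed polynomial evaluated at \<open>coord\<close>
  equals \<open>eval a \<tau>\<close> up to a power of \<open>coord\<close>, and reversal kills only
  the zero polynomial.\<close>

lemma eval_eq_0_iff:
  assumes "\<tau> \<in> coords"
  shows "eval a \<tau> = 0 \<longleftrightarrow> a = 0"
proof (cases "\<tau> = coord")
  case False
  then have \<tau>: "\<tau> = inverse coord" using assms by (simp add: coords_def)
  have "degree (map_poly const a) = degree a"
    by (rule degree_map_poly) (simp add: const_eq_0_iff)
  then have "map_poly const (reflect_poly a) = reflect_poly (map_poly const a)"
    by (intro poly_eqI) (simp add: coeff_map_poly coeff_reflect_poly const_simps)
  then have "eval (reflect_poly a) coord = coord ^ degree (map_poly const a) * eval a \<tau>"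
    using poly_reflect_poly_nz[OF coord_nonzero, of "map_poly const a"] by (simp add: eval_def \<tau>)
  then have "eval a \<tau> = 0 \<longleftrightarrow> eval (reflect_poly a) coord = 0" by (simp add: coord_nonzero)
  then show ?thesis by (simp add: eval_coord_eq_0_iff)
qed (simp add: eval_coord_eq_0_iff)

text \<open>The set \<open>Q\<close> of such fractions is closed under sums, products and inverses
  and contains the constants and \<open>coord\<close>; hence it is all of k(t), whichever of the two
  coordinates \<tau> is.\<close>

lemma ratfun_fraction:
  assumes "\<tau> \<in> coords"
  obtains a b where "b \<noteq> 0" "f = eval a \<tau> / eval b \<tau>"
proof -
  define Q where "Q = {eval a \<tau> / eval b \<tau> | a b. b \<noteq> 0}"
  have Qi: "eval a \<tau> / eval b \<tau> \<in> Q" if "b \<noteq> 0" for a b using that unfolding Q_def by blast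
  have e: "eval b \<tau> \<noteq> 0" if "b \<noteq> 0" for b using that eval_eq_0_iff[OF assms] by simp
  have poly: "eval a \<tau> \<in> Q" for a using Qi[of 1 a] by (simp add: eval_simps)
  have add: "x + y \<in> Q" if "x \<in> Q" "y \<in> Q" for x y
  proof -
    obtain a b c d where "x = eval a \<tau> / eval b \<tau>" "y = eval c \<tau> / eval d \<tau>" and bd: "b \<noteq> 0" "d \<noteq> 0"
      using \<open>x \<in> Q\<close> \<open>y \<in> Q\<close> by (auto simp: Q_def)
    then have "x + y = eval (a * d + c * b) \<tau> / eval (b * d) \<tau>"
      using e by (simp add: eval_simps field_simps)
    then show ?thesis using Qi bd by simp
  qed
  have mult: "x * y \<in> Q" if "x \<in> Q" "y \<in> Q" for x y
  proof -
    obtain a b c d where "x = eval a \<tau> / eval b \<tau>" "y = eval c \<tau> / eval d \<tau>" and bd: "b \<noteq> 0" "d \<noteq> 0"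
      using \<open>x \<in> Q\<close> \<open>y \<in> Q\<close> by (auto simp: Q_def)
    then have "x * y = eval (a * c) \<tau> / eval (b * d) \<tau>" by (simp add: eval_simps)
    then show ?thesis using Qi bd by simp
  qed
  have inv: "inverse x \<in> Q" if "x \<in> Q" for x
  proof -
    obtain a b where "x = eval a \<tau> / eval b \<tau>" "b \<noteq> 0" using \<open>x \<in> Q\<close> by (auto simp: Q_def)
    \<comment> \<open>By the convention that the inverse of 0 is 0, closure holds at x = 0 as
      well.\<close>
    then have "inverse x = (if a = 0 then eval 0 \<tau> else eval b \<tau> / eval a \<tau>)"
      by (auto simp: eval_simps)
    then show ?thesis using Qi poly by simp
  qed
  have \<tau>: "\<tau> \<in> Q" using poly[of "[:0, 1:]"] by (simp add: eval_simps const_simps)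
  have coord: "coord \<in> Q" using \<tau> inv[OF \<tau>] assms by (auto simp: coords_def)
  have evQ: "eval a coord \<in> Q" for a
  proof (induction a)
    case 0
    then show ?case using poly[of 0] by (simp add: eval_simps)
  next
    case (pCons c a)
    have "const c \<in> Q" using poly[of "[:c:]"] by (simp add: eval_simps)
    then show ?case using pCons coord by (simp add: eval_simps add mult)
  qed
  obtain a b where "f = Fract a b" "b \<noteq> 0" by (cases f) auto
  then have "f = eval a coord * inverse (eval b coord)" by (simp add: eval_coord)
  then have "f \<in> Q" using evQ mult inv by simp
  then show ?thesis using that by (auto simp: Q_def)
qed

section \<open>Taylor expansion and divided derivations\<close>

lemma taylor_shift_simps:
  "taylor_shift 0 \<tau> = 0" "taylor_shift 1 \<tau> = 1"
  "taylor_shift (a + b) \<tau> = taylor_shift a \<tau> + taylor_shift b \<tau>"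
  "taylor_shift (a * b) \<tau> = taylor_shift a \<tau> * taylor_shift b \<tau>"
  "taylor_shift (pCons c a) \<tau> = fps_const (const c) + (fps_const \<tau> + fps_X) * taylor_shift a \<tau>"
proof -
  show p: "taylor_shift (pCons c a) \<tau> = fps_const (const c) + (fps_const \<tau> + fps_X) * taylor_shift a \<tau>" for c a
    by (cases "c = 0 \<and> a = 0") (auto simp: taylor_shift_def map_poly_pCons const_simps)
  show "taylor_shift 0 \<tau> = 0" by (simp add: taylor_shift_def)
  then show "taylor_shift 1 \<tau> = 1" by (simp add: one_pCons p const_simps)
  show "taylor_shift (a + b) \<tau> = taylor_shift a \<tau> + taylor_shift b \<tau>"
    "taylor_shift (a * b) \<tau> = taylor_shift a \<tau> * taylor_shift b \<tau>"
    by (simp_all add: taylor_shift_def map_poly_hom const_simps)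
qed

lemma taylor_shift_nth_0: "fps_nth (taylor_shift a \<tau>) 0 = eval a \<tau>"
  by (induction a) (simp_all add: taylor_shift_simps eval_simps)

text \<open>The expansion of f(\<tau> + s) in s, as generating series of the divided derivations. It
  turns the Leibniz rule into multiplicativity of a map to power series, and the rule for p-th
  powers into a statement on p-th powers of series.\<close>

definition taylor :: "'p::prime_card ratfun \<Rightarrow> 'p ratfun \<Rightarrow> 'p ratfun fps" where
  "taylor \<tau> f = Abs_fps (\<lambda>r. divided_derivation \<tau> r f)"

lemma divided_derivation_eq_nth: "divided_derivation \<tau> r f = fps_nth (taylor \<tau> f) r"
  by (simp add: taylor_def)

text \<open>The description in \<open>divided_derivation\<close> needs independence of the fraction.
  If a/b = c/d in \<tau>, injectivity of evaluation gives a d = c b as polynomials; the shift is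
  multiplicative, and shifted denominators are invertible because their constant coefficient is the
  nonzero value of the denominator.\<close>

lemma taylor_fraction:
  assumes \<tau>: "\<tau> \<in> coords" and b: "b \<noteq> 0"
  shows "taylor \<tau> (eval a \<tau> / eval b \<tau>) = taylor_shift a \<tau> * inverse (taylor_shift b \<tau>)"
proof (rule fps_ext)
  fix r
  have inv: "taylor_shift d \<tau> * inverse (taylor_shift d \<tau>) = 1" if "d \<noteq> 0" for d
    using that eval_eq_0_iff[OF \<tau>] inverse_mult_eq_1'[of "taylor_shift d \<tau>"] by (simp add: taylor_shift_nth_0)
  have "taylor_shift a \<tau> * inverse (taylor_shift b \<tau>) = taylor_shift c \<tau> * inverse (taylor_shift d \<tau>)"
    if "d \<noteq> 0" "eval a \<tau> / eval b \<tau> = eval c \<tau> / eval d \<tau>" for c d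
  proof -
    have "eval a \<tau> * eval d \<tau> = eval c \<tau> * eval b \<tau>"
      using that b eval_eq_0_iff[OF \<tau>] by (simp add: frac_eq_eq)
    then have "eval (a * d - c * b) \<tau> = 0"
      using eval_simps(3)[of "a * d - c * b" "c * b" \<tau>] by (simp add: eval_simps)
    then have "a * d = c * b" using eval_eq_0_iff[OF \<tau>] by simp
    then have "taylor_shift a \<tau> * taylor_shift d \<tau> = taylor_shift c \<tau> * taylor_shift b \<tau>"
      by (metis taylor_shift_simps(4))
    then have "taylor_shift a \<tau> * taylor_shift d \<tau> * (inverse (taylor_shift b \<tau>) * inverse (taylor_shift d \<tau>)) =
        taylor_shift c \<tau> * taylor_shift b \<tau> * (inverse (taylor_shift b \<tau>) * inverse (taylor_shift d \<tau>))"
      by simp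
    then have "taylor_shift a \<tau> * inverse (taylor_shift b \<tau>) * (taylor_shift d \<tau> * inverse (taylor_shift d \<tau>)) =
        taylor_shift c \<tau> * inverse (taylor_shift d \<tau>) * (taylor_shift b \<tau> * inverse (taylor_shift b \<tau>))"
      by (simp only: mult_ac)
    then show ?thesis using inv b that by simp
  qed
  then show "fps_nth (taylor \<tau> (eval a \<tau> / eval b \<tau>)) r =
      fps_nth (taylor_shift a \<tau> * inverse (taylor_shift b \<tau>)) r"
    unfolding divided_derivation_eq_nth[symmetric] divided_derivation_def
    using b by (intro the_equality) (metis, metis)
qed

lemma taylor_simps:
  assumes \<tau>: "\<tau> \<in> coords"
  shows "taylor \<tau> (f + g) = taylor \<tau> f + taylor \<tau> g"
    "taylor \<tau> (f * g) = taylor \<tau> f * taylor \<tau> g"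
    "taylor \<tau> (const c) = fps_const (const c)"
    "taylor \<tau> \<tau> = fps_const \<tau> + fps_X"
    "fps_nth (taylor \<tau> f) 0 = f"
proof -
  have pol: "taylor \<tau> (eval a \<tau>) = taylor_shift a \<tau>" for a
    using taylor_fraction[OF \<tau>, of 1 a] by (simp add: eval_simps taylor_shift_simps)
  show "taylor \<tau> (const c) = fps_const (const c)" "taylor \<tau> \<tau> = fps_const \<tau> + fps_X"
    using pol[of "[:c:]"] pol[of "[:0, 1:]"] by (simp_all add: eval_simps taylor_shift_simps const_simps)
  obtain a b where b: "b \<noteq> 0" and f: "f = eval a \<tau> / eval b \<tau>" by (rule ratfun_fraction[OF \<tau>])
  obtain c d where d: "d \<noteq> 0" and g: "g = eval c \<tau> / eval d \<tau>" by (rule ratfun_fraction[OF \<tau>])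
  have e: "eval b \<tau> \<noteq> 0" "eval d \<tau> \<noteq> 0" using b d eval_eq_0_iff[OF \<tau>] by simp_all
  have inv: "taylor_shift b \<tau> * inverse (taylor_shift b \<tau>) = 1" "taylor_shift d \<tau> * inverse (taylor_shift d \<tau>) = 1"
    using e by (simp_all add: inverse_mult_eq_1' taylor_shift_nth_0)
  show "fps_nth (taylor \<tau> f) 0 = f"
    using e unfolding f taylor_fraction[OF \<tau> b] by (simp add: taylor_shift_nth_0 divide_inverse)
  have "f * g = eval (a * c) \<tau> / eval (b * d) \<tau>" by (simp add: f g eval_simps)
  then show "taylor \<tau> (f * g) = taylor \<tau> f * taylor \<tau> g"
    using b d by (simp add: f g taylor_fraction[OF \<tau>] taylor_shift_simps fps_inverse_mult)
  have "f + g = eval (a * d + c * b) \<tau> / eval (b * d) \<tau>"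
    using e by (simp add: f g eval_simps field_simps)
  then have "taylor \<tau> (f + g) =
      taylor_shift a \<tau> * inverse (taylor_shift b \<tau>) * (taylor_shift d \<tau> * inverse (taylor_shift d \<tau>)) +
      taylor_shift c \<tau> * inverse (taylor_shift d \<tau>) * (taylor_shift b \<tau> * inverse (taylor_shift b \<tau>))"
    using b d by (simp add: taylor_fraction[OF \<tau>] taylor_shift_simps fps_inverse_mult algebra_simps)
  then show "taylor \<tau> (f + g) = taylor \<tau> f + taylor \<tau> g"
    using b d by (simp add: f g inv taylor_fraction[OF \<tau>])
qed

lemma taylor_power: "\<tau> \<in> coords \<Longrightarrow> taylor \<tau> (f ^ n) = taylor \<tau> f ^ n"
  using taylor_simps(3)[of \<tau> 1] by (induction n) (simp_all add: taylor_simps const_simps)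

text \<open>Writing F = a + X G with G the shifted series, the freshman's dream gives F^p = a^p +
  X^p G^p. The induction hypothesis is applied to G at n - p, hence the quantification over
  F.\<close>

lemma fps_nth_power_CHAR:
  fixes F :: "'a::comm_ring_1 fps"
  assumes p: "prime p" "CHAR('a) = p"
  shows "fps_nth (F ^ p) n = (if p dvd n then fps_nth F (n div p) ^ p else 0)"
proof (induction n arbitrary: F rule: less_induct)
  case (less n)
  have p0: "p > 0" using p prime_gt_0_nat by blast
  have "F = fps_const (fps_nth F 0) + fps_X * fps_shift 1 F"
    by (rule fps_ext) simp
  then have "F ^ p = (fps_const (fps_nth F 0) + fps_X * fps_shift 1 F) ^ p" by simp
  also have "\<dots> = fps_const (fps_nth F 0) ^ p + (fps_X * fps_shift 1 F) ^ p"
    using p by (intro freshmans_dream) simp_all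
  also have "\<dots> = fps_const (fps_nth F 0 ^ p) + fps_X ^ p * fps_shift 1 F ^ p"
    by (simp add: power_mult_distrib fps_const_power)
  finally have F: "fps_nth (F ^ p) n =
      (if n = 0 then fps_nth F 0 ^ p else 0) + (if n < p then 0 else fps_nth (fps_shift 1 F ^ p) (n - p))"
    by (simp add: fps_X_power_mult_nth)
  show ?case
  proof (cases "n < p")
    case True
    then show ?thesis using F p0 by (auto dest: dvd_imp_le)
  next
    case False
    then have "n - p < n" using p0 by simp
    then have "fps_nth (F ^ p) n = (if p dvd n - p then fps_nth (fps_shift 1 F) ((n - p) div p) ^ p else 0)"
      using F False p0 less.IH[of "n - p"] by simp
    moreover have "p dvd n - p \<longleftrightarrow> p dvd n" using False by (simp add: dvd_minus_self)
    moreover have "n div p = Suc ((n - p) div p)" using False p0 by (simp add: le_div_geq)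
    ultimately show ?thesis by simp
  qed
qed

context
  fixes \<tau> :: "'p::prime_card ratfun"
  assumes \<tau>: "\<tau> \<in> coords"
begin

lemma dd_add: "divided_derivation \<tau> n (f + g) = divided_derivation \<tau> n f + divided_derivation \<tau> n g"
  by (simp add: divided_derivation_eq_nth taylor_simps[OF \<tau>])

lemma dd_mult: "divided_derivation \<tau> n (f * g) =
    (\<Sum>i\<le>n. divided_derivation \<tau> i f * divided_derivation \<tau> (n - i) g)"
  by (simp add: divided_derivation_eq_nth taylor_simps[OF \<tau>] fps_mult_nth atLeast0AtMost)

lemma dd_const_mult: "divided_derivation \<tau> n (const c * f) = const c * divided_derivation \<tau> n f"
  by (simp add: divided_derivation_eq_nth taylor_simps[OF \<tau>])

lemma dd_order_0: "divided_derivation \<tau> 0 = id"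
  by (simp add: fun_eq_iff divided_derivation_eq_nth taylor_simps[OF \<tau>])

lemma dd_one: "divided_derivation \<tau> n 1 = (if n = 0 then 1 else 0)"
  using taylor_simps(3)[OF \<tau>, of 1] by (simp add: divided_derivation_eq_nth const_simps)

lemma dd_power_coord: "divided_derivation \<tau> n (\<tau> ^ i) = of_nat (i choose n) * \<tau> ^ (i - n)"
proof -
  have "taylor \<tau> (\<tau> ^ i) = (fps_X + fps_const \<tau>) ^ i"
    by (simp add: taylor_power[OF \<tau>] taylor_simps[OF \<tau>] add.commute)
  also have "\<dots> = (\<Sum>k\<le>i. fps_const (of_nat (i choose k)) * fps_X ^ k * fps_const (\<tau> ^ (i - k)))"
    by (simp add: binomial_ring fps_of_nat fps_const_power)
  finally have "divided_derivation \<tau> n (\<tau> ^ i) =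
      (\<Sum>k\<le>i. fps_nth (fps_const (of_nat (i choose k)) * fps_X ^ k * fps_const (\<tau> ^ (i - k))) n)"
    by (simp add: divided_derivation_eq_nth fps_sum_nth)
  also have "\<dots> = (\<Sum>k\<le>i. if k = n then of_nat (i choose k) * \<tau> ^ (i - k) else 0)"
    by (intro sum.cong) (auto simp: fps_X_power_nth)
  also have "\<dots> = of_nat (i choose n) * \<tau> ^ (i - n)"
    by (cases "n \<le> i") (simp_all add: binomial_eq_0)
  finally show ?thesis .
qed

lemma dd_power_card:
  "divided_derivation \<tau> n (f ^ CARD('p)) =
    (if CARD('p) dvd n then divided_derivation \<tau> (n div CARD('p)) f ^ CARD('p) else 0)"
  by (simp add: divided_derivation_eq_nth taylor_power[OF \<tau>] fps_nth_power_CHAR[OF prime_card CHAR_ratfun])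

lemma klinear_dd: "klinear (divided_derivation \<tau> n)"
  by (simp add: klinear_def dd_add dd_const_mult)

end

section \<open>Differential operators on the projective line\<close>

lemma order_le_zero: "order_le n (\<lambda>_. 0)"
  by (induction n) simp_all

lemma order_le_add: "order_le n D \<Longrightarrow> order_le n D' \<Longrightarrow> order_le n (\<lambda>g. D g + D' g)"
proof (induction n arbitrary: D D')
  case (Suc n)
  have "order_le n (\<lambda>g. (D (f * g) - f * D g) + (D' (f * g) - f * D' g))" for f
    using Suc by (intro Suc.IH) simp_all
  moreover have "(\<lambda>g. (D (f * g) - f * D g) + (D' (f * g) - f * D' g)) =
      (\<lambda>g. D (f * g) + D' (f * g) - f * (D g + D' g))" for f
    by (simp add: algebra_simps)
  ultimately show ?case by simp
qed (simp add: algebra_simps)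

lemma order_le_lmult: "order_le n D \<Longrightarrow> order_le n (\<lambda>g. h * D g)"
proof (induction n arbitrary: D)
  case (Suc n)
  have "order_le n (\<lambda>g. h * (D (f * g) - f * D g))" for f
    using Suc by (intro Suc.IH) simp_all
  moreover have "(\<lambda>g. h * (D (f * g) - f * D g)) = (\<lambda>g. h * D (f * g) - f * (h * D g))" for f
    by (simp add: algebra_simps)
  ultimately show ?case by simp
qed (simp add: algebra_simps)

lemma order_le_rmult: "order_le n D \<Longrightarrow> order_le n (\<lambda>g. D (h * g))"
proof (induction n arbitrary: D)
  case (Suc n)
  have "order_le n (\<lambda>g. D (f * (h * g)) - f * D (h * g))" for f
    using Suc.IH[of "\<lambda>g. D (f * g) - f * D g"] Suc.prems by simp
  then show ?case by (simp add: mult.left_commute)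
qed (simp add: mult.left_commute)

lemma order_le_Suc: "order_le n D \<Longrightarrow> order_le (Suc n) D"
proof (induction n arbitrary: D)
  case 0
  then have "(\<lambda>g. D (f * g) - f * D g) = (\<lambda>_. 0)" for f by auto
  then show ?case by (simp add: fun_eq_iff)
next
  case (Suc n)
  have "order_le (Suc n) (\<lambda>g. D (f * g) - f * D g)" for f
    by (rule Suc.IH) (use Suc.prems in \<open>simp only: order_le.simps(2)\<close>)
  then show ?case by (subst order_le.simps(2)) blast
qed

lemma order_le_mono: "order_le n D \<Longrightarrow> n \<le> k \<Longrightarrow> order_le k D"
  by (rotate_tac, induction k rule: dec_induct) (auto intro: order_le_Suc simp del: order_le.simps)

lemma order_le_sum: "(\<And>i. i \<in> I \<Longrightarrow> order_le n (D i)) \<Longrightarrow> order_le n (\<lambda>g. \<Sum>i\<in>I. D i g)"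
  by (induction I rule: infinite_finite_induct) (simp_all add: order_le_zero order_le_add)

text \<open>The commutator of D D' with f is D [D', f] + [D, f] D', two composites of total order
  one less, so induction on a + b applies. If one order is 0, that operator is multiplication by its
  value at 1. Additivity of D is used to split D (D' (f g)).\<close>

lemma order_le_comp:
  assumes "order_le a D" "order_le b D'" "\<And>f g. D (f + g) = D f + D g"
  shows "order_le (a + b) (\<lambda>g. D (D' g))"
  using assms
proof (induction "a + b" arbitrary: a b D D' rule: less_induct)
  case less
  show ?case
  proof (cases "a = 0 \<or> b = 0")
    case True
    then show ?thesis
    proof
      assume a: "a = 0"
      define c where "c = D 1"
      have "D (f * 1) - f * D 1 = 0" for f
        using less.prems(1) unfolding a order_le.simps by blast
      then have D: "D f = c * f" for f
        unfolding c_def using mult.commute[of "D 1" f] by (metis eq_iff_diff_eq_0 mult.right_neutral)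
      show ?thesis unfolding D using order_le_lmult[OF less.prems(2), of c] a by simp
    next
      assume b: "b = 0"
      define c where "c = D' 1"
      have "D' (f * 1) - f * D' 1 = 0" for f
        using less.prems(2) unfolding b order_le.simps by blast
      then have D': "D' f = c * f" for f
        unfolding c_def using mult.commute[of "D' 1" f] by (metis eq_iff_diff_eq_0 mult.right_neutral)
      show ?thesis unfolding D' using order_le_rmult[OF less.prems(1), of c] b by simp
    qed
  next
    case False
    then obtain a' b' where ab: "a = Suc a'" "b = Suc b'" by (metis not0_implies_Suc)
    have "order_le (a + b') (\<lambda>g. D (D' (f * g) - f * D' g))" for f
      using less.prems(2) ab by (intro less.hyps less.prems) simp_all
    moreover have "order_le (a' + b) (\<lambda>g. D (f * D' g) - f * D (D' g))" for f
    proof (rule less.hyps[of a' b "\<lambda>g. D (f * g) - f * D g" D'])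
      show "D (f * (g + h)) - f * D (g + h) = D (f * g) - f * D g + (D (f * h) - f * D h)" for g h
        by (simp add: less.prems(3) algebra_simps)
    qed (use less.prems ab in simp_all)
    ultimately have "order_le (a' + b) (\<lambda>g. D (D' (f * g) - f * D' g) + (D (f * D' g) - f * D (D' g)))" for f
      using ab by (intro order_le_add) simp_all
    moreover have "D (D' (f * g) - f * D' g) + (D (f * D' g) - f * D (D' g)) = D (D' (f * g)) - f * D (D' g)" for f g
      using less.prems(3)[of "D' (f * g) - f * D' g" "f * D' g"] by simp
    ultimately show ?thesis using ab by simp
  qed
qed

section \<open>Operators determined by their values on powers of a coordinate\<close>

lemma klinear_commutator: "klinear D \<Longrightarrow> klinear (\<lambda>g. D (f * g) - f * D g)"
  unfolding klinear_def
proof (intro conjI allI; elim conjE)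
  fix g h c
  assume add: "\<forall>f g. D (f + g) = D f + D g" and "\<forall>c f. D (const c * f) = const c * D f"
  then have "D (f * (const c * g)) = const c * D (f * g)" "D (const c * g) = const c * D g"
    by (metis mult.left_commute)+
  then show "D (f * (const c * g)) - f * D (const c * g) = const c * (D (f * g) - f * D g)"
    by (simp add: algebra_simps)
  show "D (f * (g + h)) - f * D (g + h) = D (f * g) - f * D g + (D (f * h) - f * D h)"
    by (simp add: add algebra_simps)
qed

lemma klinear_closed:
  "klinear D \<Longrightarrow> klinear D' \<Longrightarrow> klinear (\<lambda>g. D g + D' g)"
  "klinear D \<Longrightarrow> klinear D' \<Longrightarrow> klinear (\<lambda>g. D (D' g))"
  "klinear (\<lambda>g. f * g)"
  by (simp_all add: klinear_def algebra_simps)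

lemma klinear_sum: "klinear D \<Longrightarrow> D (sum f I) = (\<Sum>i\<in>I. D (f i))"
proof (induction I rule: infinite_finite_induct)
  case (infinite I)
  then show ?case unfolding klinear_def using const_simps(1) by (metis mult_zero_left sum.infinite)
next
  case empty
  then show ?case unfolding klinear_def using const_simps(1) by (metis mult_zero_left sum.empty)
qed (simp add: klinear_def)

lemma eval_power: "eval (a ^ n) \<tau> = eval a \<tau> ^ n"
  by (induction n) (simp_all add: eval_simps)

lemma eval_X: "eval [:0, 1:] \<tau> = \<tau>"
  by (simp add: eval_simps const_simps)

text \<open>By induction on n, a commutator [D, h] vanishes once it vanishes on 1, ..., \<tau>^n.
  For h = \<tau> this makes D commute with \<tau>, so D kills all polynomials in \<tau>. For h the
  denominator b of f it gives b D f = D (b f), and b f is a polynomial.\<close>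

lemma diffop_eq_0:
  assumes \<tau>: "\<tau> \<in> coords" and "klinear D" "order_le n D" "\<And>i. i \<le> n \<Longrightarrow> D (\<tau> ^ i) = 0"
  shows "D f = 0"
  using assms(2-)
proof (induction n arbitrary: D f)
  case 0
  then have "D (f * 1) = f * D 1" "D 1 = 0" by (simp_all del: mult_1_right)
  then show ?case by simp
next
  case (Suc n)
  have ind: "D (h * g) - h * D g = 0" if "\<And>i. i \<le> n \<Longrightarrow> D (h * \<tau> ^ i) - h * D (\<tau> ^ i) = 0" for h g
    using Suc.IH[of "\<lambda>g. D (h * g) - h * D g" g] Suc.prems that by (auto intro: klinear_commutator)
  have "D (\<tau> * g) = \<tau> * D g" for g
    using ind[of \<tau> g] Suc.prems(3)[of "Suc i" for i] Suc.prems(3) by simp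
  moreover have "D 1 = 0" "D 0 = 0"
    using Suc.prems(3)[of 0] klinear_sum[OF Suc.prems(1), of "\<lambda>_. 0" "{}"] by simp_all
  moreover have "D (const c) = const c * D 1" for c
    using Suc.prems(1) by (metis klinear_def mult.right_neutral)
  ultimately have poly: "D (eval a \<tau>) = 0" for a
    using Suc.prems(1) by (induction a) (simp_all add: eval_simps klinear_def)
  obtain a b where b: "b \<noteq> 0" and f: "f = eval a \<tau> / eval b \<tau>" by (rule ratfun_fraction[OF \<tau>])
  have e: "eval b \<tau> \<noteq> 0" using b eval_eq_0_iff[OF \<tau>] by simp
  have *: "D (eval b \<tau> * \<tau> ^ i) = 0" "D (\<tau> ^ i) = 0" for i
    using poly[of "b * [:0, 1:] ^ i"] poly[of "[:0, 1:] ^ i"] by (simp_all only: eval_simps(4) eval_power eval_X)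
  have "D (eval b \<tau> * f) - eval b \<tau> * D f = 0" by (rule ind) (simp add: *)
  then show ?case using poly[of a] e by (simp add: f)
qed

text \<open>By Leibniz the commutator with f is the sum over i > 0 of products of the i-th
  derivative of f with the derivation of order n - i, all of smaller order.\<close>

lemma order_le_dd:
  assumes \<tau>: "\<tau> \<in> coords"
  shows "order_le n (divided_derivation \<tau> n)"
proof (induction n rule: less_induct)
  case (less n)
  show ?case
  proof (cases n)
    case 0
    then show ?thesis by (simp add: dd_order_0[OF \<tau>])
  next
    case (Suc k)
    have "order_le k (\<lambda>g. \<Sum>i\<in>{1..n}. divided_derivation \<tau> i f * divided_derivation \<tau> (n - i) g)" for f
    proof (intro order_le_sum order_le_lmult)
      fix i assume "i \<in> {1..n}"
      then show "order_le k (divided_derivation \<tau> (n - i))"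
        using Suc by (intro order_le_mono[OF less.IH[of "n - i"]]) auto
    qed
    moreover have "divided_derivation \<tau> n (f * g) - f * divided_derivation \<tau> n g =
        (\<Sum>i\<in>{1..n}. divided_derivation \<tau> i f * divided_derivation \<tau> (n - i) g)" for f g
    proof -
      have "{..n} = insert 0 {1..n}" by auto
      then show ?thesis by (simp add: dd_mult[OF \<tau>] dd_order_0[OF \<tau>])
    qed
    ultimately show ?thesis using Suc by simp
  qed
qed

text \<open>Both sides are linear of order at most i + j, so by \<open>diffop_eq_0\<close> they need
  to be compared only on powers of \<tau>, where a binomial identity remains.\<close>

lemma dd_comp:
  assumes \<tau>: "\<tau> \<in> coords"
  shows "divided_derivation \<tau> i (divided_derivation \<tau> j f) =
    of_nat (i + j choose i) * divided_derivation \<tau> (i + j) f"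
proof -
  let ?d = "divided_derivation \<tau>"
  let ?c = "- of_nat (i + j choose i)"
  let ?D = "\<lambda>g. ?d i (?d j g) + ?c * ?d (i + j) g"
  have k: "?d i (of_nat n * g) = of_nat n * ?d i g" for i n g
    using dd_const_mult[OF \<tau>, of i "of_nat n" g] by (simp add: const_of_nat)
  have "?D f = 0"
  proof (rule diffop_eq_0[OF \<tau>, of ?D "i + j" f])
    show "klinear ?D"
      by (intro klinear_closed(1) klinear_closed(2)[OF klinear_dd klinear_dd]
        klinear_closed(2)[OF klinear_closed(3) klinear_dd] \<tau>)
    show "order_le (i + j) ?D"
    proof (rule order_le_add)
      show "order_le (i + j) (\<lambda>g. ?d i (?d j g))"
        by (rule order_le_comp[OF order_le_dd[OF \<tau>] order_le_dd[OF \<tau>]]) (rule dd_add[OF \<tau>])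
      show "order_le (i + j) (\<lambda>g. ?c * ?d (i + j) g)"
        by (rule order_le_lmult[OF order_le_dd[OF \<tau>]])
    qed
    fix n
    have "(n choose j) * (n - j choose i) = (i + j choose i) * (n choose (i + j))"
    proof (cases "i + j \<le> n")
      case True
      then show ?thesis using choose_mult[of j "i + j" n] binomial_symmetric[of i "i + j"] by (simp add: mult.commute)
    next
      case False
      then have "n choose (i + j) = 0" "n < j \<or> n - j < i" by auto
      then show ?thesis by (auto simp: binomial_eq_0)
    qed
    then have "of_nat (n choose j) * of_nat (n - j choose i) =
        (of_nat (i + j choose i) * of_nat (n choose (i + j)) :: 'a ratfun)"
      by (metis of_nat_mult)
    moreover have "n - j - i = n - (i + j)" by simp
    ultimately show "?D (\<tau> ^ n) = 0"
      by (simp add: dd_power_coord[OF \<tau>] k mult.assoc[symmetric])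
  qed
  then show ?thesis by (simp add: algebra_simps)
qed

section \<open>Points and Zariski open sets\<close>

lemma primeideal_poly:
  fixes P :: "'a::comm_ring_1 set"
  assumes "primeideal P (ring_on UNIV)"
  shows "1 \<notin> P" "0 \<in> P" "a \<notin> P \<Longrightarrow> b \<notin> P \<Longrightarrow> a * b \<notin> P"
    "a \<in> P \<Longrightarrow> a * b \<in> P" "b \<in> P \<Longrightarrow> a * b \<in> P"
proof -
  interpret primeideal P "ring_on UNIV" by fact
  show "1 \<notin> P" using I_notcarr one_imp_carrier by auto
  show "0 \<in> P" using additive_subgroup.zero_closed[OF additive_subgroup_axioms] by simp
  show "a \<notin> P \<Longrightarrow> b \<notin> P \<Longrightarrow> a * b \<notin> P" using I_prime[of a b] by auto
  show "a \<in> P \<Longrightarrow> a * b \<in> P" "b \<in> P \<Longrightarrow> a * b \<in> P"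
    using I_r_closed[of a b] I_l_closed[of b a] by auto
qed

lemma points_cases:
  assumes "x \<in> points"
  obtains \<tau> P where "\<tau> \<in> coords" "primeideal P (ring_on UNIV)" "x = localization \<tau> P"
  using assms by (auto simp: points_def)

lemma point_eval:
  assumes "primeideal P (ring_on UNIV)"
  shows "eval a \<tau> \<in> localization \<tau> P"
proof -
  have "eval a \<tau> = eval a \<tau> / eval 1 \<tau>" by (simp add: eval_simps)
  then show ?thesis using primeideal_poly(1)[OF assms] unfolding localization_def by blast
qed

lemma point_closed:
  assumes "x \<in> points"
  shows "f \<in> x \<Longrightarrow> g \<in> x \<Longrightarrow> f + g \<in> x" "f \<in> x \<Longrightarrow> g \<in> x \<Longrightarrow> f * g \<in> x" "const c \<in> x"
proof -
  obtain \<tau> P where \<tau>: "\<tau> \<in> coords" and P: "primeideal P (ring_on UNIV)" and x: "x = localization \<tau> P"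
    by (rule points_cases[OF assms])
  have e: "eval b \<tau> \<noteq> 0" if "b \<notin> P" for b
    using that primeideal_poly(2)[OF P] eval_eq_0_iff[OF \<tau>] by metis
  show "const c \<in> x" using point_eval[OF P, of "[:c:]" \<tau>] by (simp add: x eval_simps)
  assume "f \<in> x" "g \<in> x"
  then obtain a b c d where f: "f = eval a \<tau> / eval b \<tau>" and g: "g = eval c \<tau> / eval d \<tau>" and bd: "b \<notin> P" "d \<notin> P"
    by (auto simp: x localization_def)
  have "f + g = eval (a * d + c * b) \<tau> / eval (b * d) \<tau>" "f * g = eval (a * c) \<tau> / eval (b * d) \<tau>"
    using e bd by (simp_all add: f g eval_simps field_simps)
  then show "f + g \<in> x" "f * g \<in> x"
    using primeideal_poly(3)[OF P bd] unfolding x localization_def by blast+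
qed

lemma point_1: "x \<in> points \<Longrightarrow> 1 \<in> x"
  using point_closed(3)[of x 1] by (simp add: const_simps)

lemma point_0: "x \<in> points \<Longrightarrow> 0 \<in> x"
  using point_closed(3)[of x 0] by (simp add: const_simps)

lemma point_power: "x \<in> points \<Longrightarrow> f \<in> x \<Longrightarrow> f ^ n \<in> x"
  by (induction n) (auto simp: point_1 point_closed)

lemma point_sum: "x \<in> points \<Longrightarrow> (\<And>i. i \<in> I \<Longrightarrow> f i \<in> x) \<Longrightarrow> sum f I \<in> x"
  by (induction I rule: infinite_finite_induct) (auto simp: point_0 point_closed)

lemma point_uminus: "x \<in> points \<Longrightarrow> f \<in> x \<Longrightarrow> - f \<in> x"
proof -
  assume x: "x \<in> points" "f \<in> x"
  have "const (- 1 :: 'a mod_ring) + const 1 = 0" by (metis add.left_inverse const_simps(1,3))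
  then have "const (- 1) * f = - f" by (simp add: const_simps eq_neg_iff_add_eq_0[symmetric])
  then show ?thesis using point_closed(2)[OF x(1) point_closed(3)[OF x(1), of "- 1"] x(2)] by simp
qed

lemma point_contains_coord:
  assumes "x \<in> points"
  obtains \<tau> where "\<tau> \<in> coords" "\<tau> \<in> x"
  using point_eval[of _ "[:0, 1:]"] by (metis points_cases[OF assms] eval_X)

lemma zariski_openI:
  assumes "U \<subseteq> points" "\<And>\<tau>. \<tau> \<in> coords \<Longrightarrow>
    \<exists>S. \<forall>P. primeideal P (ring_on UNIV) \<longrightarrow> (localization \<tau> P \<in> U \<longleftrightarrow> \<not> S \<subseteq> P)"
  shows "zariski_open U"
  using assms by (simp add: zariski_open_def)

lemma localization_in_points: "\<tau> \<in> coords \<Longrightarrow> primeideal P (ring_on UNIV) \<Longrightarrow> localization \<tau> P \<in> points"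
  by (auto simp: points_def)

text \<open>On each affine line \<open>?S\<close> is the ideal of denominators of f, and f lies in
  the local ring at P exactly when some denominator avoids P.\<close>

lemma zariski_open_regular_at: "zariski_open {x \<in> points. f \<in> x}"
proof (rule zariski_openI)
  fix \<tau> :: "'a ratfun" assume \<tau>: "\<tau> \<in> coords"
  let ?S = "{b. \<exists>a. eval b \<tau> * f = eval a \<tau>}"
  show "\<exists>S. \<forall>P. primeideal P (ring_on UNIV) \<longrightarrow> (localization \<tau> P \<in> {x \<in> points. f \<in> x} \<longleftrightarrow> \<not> S \<subseteq> P)"
  proof (intro exI[of _ ?S] allI impI)
    fix P :: "'a mod_ring poly set" assume P: "primeideal P (ring_on UNIV)"
    have "f = eval a \<tau> / eval b \<tau> \<longleftrightarrow> eval b \<tau> * f = eval a \<tau>" if "b \<notin> P" for a b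
    proof -
      have "eval b \<tau> \<noteq> 0" using that primeideal_poly(2)[OF P] eval_eq_0_iff[OF \<tau>] by metis
      then show ?thesis by (auto simp: field_simps)
    qed
    then have "f \<in> localization \<tau> P \<longleftrightarrow> \<not> ?S \<subseteq> P" by (auto simp: localization_def)
    then show "localization \<tau> P \<in> {x \<in> points. f \<in> x} \<longleftrightarrow> \<not> ?S \<subseteq> P"
      using localization_in_points[OF \<tau> P] by simp
  qed
qed auto

lemma zariski_open_points: "zariski_open (points :: 'p::prime_card ratfun set set)"
proof -
  have "(points :: 'p ratfun set set) = {x \<in> points. 1 \<in> x}" using point_1 by auto
  then show ?thesis using zariski_open_regular_at[of "1 :: 'p ratfun"] by simp
qed

lemma zariski_open_Int:
  assumes U: "zariski_open U" and V: "zariski_open V"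
  shows "zariski_open (U \<inter> V)"
proof (rule zariski_openI)
  show "U \<inter> V \<subseteq> points" using U by (auto simp: zariski_open_def)
  fix \<tau> :: "'a ratfun" assume \<tau>: "\<tau> \<in> coords"
  obtain S where S: "\<And>P. primeideal P (ring_on UNIV) \<Longrightarrow> localization \<tau> P \<in> U \<longleftrightarrow> \<not> S \<subseteq> P"
    using U \<tau> by (metis zariski_open_def)
  obtain T where T: "\<And>P. primeideal P (ring_on UNIV) \<Longrightarrow> localization \<tau> P \<in> V \<longleftrightarrow> \<not> T \<subseteq> P"
    using V \<tau> by (metis zariski_open_def)
  show "\<exists>S. \<forall>P. primeideal P (ring_on UNIV) \<longrightarrow> (localization \<tau> P \<in> U \<inter> V \<longleftrightarrow> \<not> S \<subseteq> P)"
  proof (intro exI[of _ "{s * t | s t. s \<in> S \<and> t \<in> T}"] allI impI)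
    fix P :: "'a mod_ring poly set" assume P: "primeideal P (ring_on UNIV)"
    have "\<not> {s * t | s t. s \<in> S \<and> t \<in> T} \<subseteq> P \<longleftrightarrow> \<not> S \<subseteq> P \<and> \<not> T \<subseteq> P"
    proof
      assume "\<not> {s * t | s t. s \<in> S \<and> t \<in> T} \<subseteq> P"
      then obtain s t where "s \<in> S" "t \<in> T" "s * t \<notin> P" by blast
      then show "\<not> S \<subseteq> P \<and> \<not> T \<subseteq> P"
        using primeideal_poly(4)[OF P, of s t] primeideal_poly(5)[OF P, of t s] by auto
    next
      assume "\<not> S \<subseteq> P \<and> \<not> T \<subseteq> P"
      then obtain s t where "s \<in> S" "t \<in> T" "s * t \<notin> P"
        using primeideal_poly(3)[OF P] by auto
      then show "\<not> {s * t | s t. s \<in> S \<and> t \<in> T} \<subseteq> P" by blast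
    qed
    then show "localization \<tau> P \<in> U \<inter> V \<longleftrightarrow> \<not> {s * t | s t. s \<in> S \<and> t \<in> T} \<subseteq> P"
      using S[OF P] T[OF P] by simp
  qed
qed

lemma mem_regular: "f \<in> regular V \<longleftrightarrow> (\<forall>x\<in>V. f \<in> x)"
  by (auto simp: regular_def)

section \<open>Operators on open sets and their germs\<close>

lemma diffopsD:
  assumes "D \<in> diffops n U"
  shows "klinear D" "order_le n D"
    "zariski_open V \<Longrightarrow> x \<in> V \<Longrightarrow> V \<subseteq> U \<Longrightarrow> f \<in> regular V \<Longrightarrow> D f \<in> x"
proof -
  show "klinear D" "order_le n D" using assms by (simp_all add: diffops_def)
  assume "zariski_open V" "x \<in> V" "V \<subseteq> U" "f \<in> regular V"
  moreover from this(2) have "V \<noteq> {}" by blast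
  ultimately have "D ` regular V \<subseteq> regular V" using assms unfolding diffops_def by blast
  then have "D f \<in> regular V" using \<open>f \<in> regular V\<close> by blast
  then show "D f \<in> x" using \<open>x \<in> V\<close> unfolding mem_regular by blast
qed

lemma diffopsI:
  assumes "klinear D" "order_le n D"
    "\<And>V x f. zariski_open V \<Longrightarrow> x \<in> V \<Longrightarrow> V \<subseteq> U \<Longrightarrow> f \<in> regular V \<Longrightarrow> D f \<in> x"
  shows "D \<in> diffops n U"
proof -
  have "D ` regular V \<subseteq> regular V" if "zariski_open V" "V \<subseteq> U" for V
    using assms(3)[OF that(1) _ that(2)] by (simp add: image_subset_iff mem_regular)
  then show ?thesis using assms(1,2) by (simp add: diffops_def)
qed

lemma diffops_antimono:
  assumes D: "D \<in> diffops n U" and U': "U' \<subseteq> U"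
  shows "D \<in> diffops n U'"
proof (rule diffopsI[OF diffopsD(1,2)[OF D]])
  show "D f \<in> x" if "zariski_open V" "x \<in> V" "V \<subseteq> U'" "f \<in> regular V" for V x f
    by (rule diffopsD(3)[OF D that(1,2) subset_trans[OF that(3) U'] that(4)])
qed

lemma open_points: "zariski_open V \<Longrightarrow> x \<in> V \<Longrightarrow> x \<in> points"
  unfolding zariski_open_def by (elim conjE, erule subsetD)

lemma diffops_add:
  assumes D: "D \<in> diffops n U" and D': "D' \<in> diffops n U"
  shows "(\<lambda>g. D g + D' g) \<in> diffops n U"
proof (rule diffopsI[OF klinear_closed(1)[of D D'] order_le_add[of n D D']])
  fix V x f assume V: "zariski_open V" "x \<in> V" "V \<subseteq> U" "f \<in> regular V"
  show "D f + D' f \<in> x"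
    by (rule point_closed(1)[OF open_points[OF V(1,2)] diffopsD(3)[OF D V] diffopsD(3)[OF D' V]])
qed (fact diffopsD(1,2)[OF D] diffopsD(1,2)[OF D'])+

lemma diffops_comp:
  assumes D: "D \<in> diffops a U" and D': "D' \<in> diffops b U"
  shows "D \<circ> D' \<in> diffops (a + b) U"
  unfolding comp_def
proof (rule diffopsI[OF klinear_closed(2)[of D D'] order_le_comp[of a D b D']])
  show "D (f + g) = D f + D g" for f g using diffopsD(1)[OF D] by (simp add: klinear_def)
  fix V x f assume V: "zariski_open V" "x \<in> V" "V \<subseteq> U" "f \<in> regular V"
  have "D' f \<in> regular V" unfolding mem_regular
  proof
    fix y assume "y \<in> V"
    then show "D' f \<in> y" by (rule diffopsD(3)[OF D' V(1) _ V(3,4)])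
  qed
  then show "D (D' f) \<in> x" by (rule diffopsD(3)[OF D V(1-3)])
qed (fact diffopsD(1,2)[OF D] diffopsD(1,2)[OF D'])+

lemma diffops_mult:
  assumes "\<And>x. x \<in> U \<Longrightarrow> f \<in> x"
  shows "(\<lambda>g. f * g) \<in> diffops 0 U"
proof (rule diffopsI)
  fix V x g assume V: "zariski_open V" "x \<in> V" "V \<subseteq> U" "g \<in> regular V"
  then show "f * g \<in> x"
    by (intro point_closed(2)[OF open_points[OF V(1,2)]] assms) (auto simp: mem_regular)
qed (simp_all add: klinear_closed)

lemma diffops_mono:
  assumes D: "D \<in> diffops n U" and "n \<le> k"
  shows "D \<in> diffops k U"
  by (rule diffopsI[OF diffopsD(1)[OF D] order_le_mono[OF diffopsD(2)[OF D] \<open>n \<le> k\<close>] diffopsD(3)[OF D]])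

lemma stalk_diffopsE:
  assumes "D \<in> stalk_diffops n x"
  obtains U where "zariski_open U" "x \<in> U" "D \<in> diffops n U"
  using assms by (auto simp: stalk_diffops_def)

lemma stalk_diffopsI: "D \<in> diffops n U \<Longrightarrow> zariski_open U \<Longrightarrow> x \<in> U \<Longrightarrow> D \<in> stalk_diffops n x"
  by (auto simp: stalk_diffops_def)

lemma stalk_diffops_global: "x \<in> points \<Longrightarrow> diffops n points \<subseteq> stalk_diffops n x"
  using zariski_open_points stalk_diffopsI by blast

lemma stalk_diffops_mono: "D \<in> stalk_diffops n x \<Longrightarrow> n \<le> k \<Longrightarrow> D \<in> stalk_diffops k x"
  by (metis stalk_diffopsE stalk_diffopsI diffops_mono)

lemma stalk_diffops_common:
  assumes "D \<in> stalk_diffops a x" "D' \<in> stalk_diffops b x"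
  obtains U where "zariski_open U" "x \<in> U" "D \<in> diffops a U" "D' \<in> diffops b U"
proof -
  obtain U V where U: "zariski_open U" "x \<in> U" "D \<in> diffops a U" and V: "zariski_open V" "x \<in> V" "D' \<in> diffops b V"
    using assms by (meson stalk_diffopsE)
  show ?thesis
    by (rule that[of "U \<inter> V"]) (use U V in \<open>auto intro: zariski_open_Int diffops_antimono\<close>)
qed

lemma stalk_diffops_add:
  assumes "D \<in> stalk_diffops n x" "D' \<in> stalk_diffops n x"
  shows "(\<lambda>g. D g + D' g) \<in> stalk_diffops n x"
  by (rule stalk_diffops_common[OF assms]) (auto intro: stalk_diffopsI diffops_add)

lemma stalk_diffops_comp:
  assumes "D \<in> stalk_diffops a x" "D' \<in> stalk_diffops b x"
  shows "D \<circ> D' \<in> stalk_diffops (a + b) x"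
  by (rule stalk_diffops_common[OF assms]) (auto intro: stalk_diffopsI diffops_comp)

lemma stalk_diffops_mult:
  assumes "x \<in> points" "f \<in> x"
  shows "(\<lambda>g. f * g) \<in> stalk_diffops 0 x"
  by (rule stalk_diffopsI[OF diffops_mult zariski_open_regular_at[of f]]) (use assms in auto)

lemma stalk_diffops_lmult:
  assumes "x \<in> points" "f \<in> x" "D \<in> stalk_diffops n x"
  shows "(\<lambda>g. f * D g) \<in> stalk_diffops n x"
  using stalk_diffops_comp[OF stalk_diffops_mult[OF assms(1,2)] assms(3)] by (simp add: comp_def)

lemma stalk_diffops_zero:
  assumes "x \<in> points"
  shows "(\<lambda>_. 0) \<in> stalk_diffops n x"
  using stalk_diffops_mono[OF stalk_diffops_mult[OF assms point_0[OF assms]], of n] by simp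

lemma stalk_diffops_uminus:
  assumes "x \<in> points" "D \<in> stalk_diffops n x"
  shows "(\<lambda>g. - D g) \<in> stalk_diffops n x"
  using stalk_diffops_lmult[OF assms(1) point_uminus[OF assms(1) point_1[OF assms(1)]] assms(2)] by simp

lemma stalk_diffops_id:
  assumes "x \<in> points"
  shows "id \<in> stalk_diffops n x"
  using stalk_diffops_mono[OF stalk_diffops_mult[OF assms point_1[OF assms]], of n] by (simp add: id_def)

lemma stalk_diffops_sum:
  assumes "x \<in> points" "\<And>i. i \<in> I \<Longrightarrow> D i \<in> stalk_diffops n x"
  shows "(\<lambda>g. \<Sum>i\<in>I. D i g) \<in> stalk_diffops n x"
  using assms(2)
  by (induction I rule: infinite_finite_induct)
     (simp_all add: stalk_diffops_zero[OF assms(1)] stalk_diffops_add)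

text \<open>Shrink the open set on which D is defined to the part where f is regular; there D
  preserves regular functions.\<close>

lemma stalk_diffops_stalk:
  assumes "D \<in> stalk_diffops n x" "f \<in> x"
  shows "D f \<in> x"
proof -
  obtain U where U: "zariski_open U" "x \<in> U" "D \<in> diffops n U" by (rule stalk_diffopsE[OF assms(1)])
  show ?thesis
    by (rule diffopsD(3)[OF U(3), of "U \<inter> {y \<in> points. f \<in> y}"])
       (use U assms(2) in \<open>auto intro: zariski_open_Int zariski_open_regular_at open_points simp: mem_regular\<close>)
qed

lemma stalk_diffopsD:
  assumes "D \<in> stalk_diffops n x"
  shows "klinear D" "order_le n D"
  using assms by (meson stalk_diffopsE diffopsD(1,2))+

text \<open>The assumption \<open>dd_global\<close> is supplied for both coordinates by the action
  of the group; see the lemma of the same name in \<open>frobenius_action\<close>.\<close>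

locale chart =
  fixes \<tau> :: "'p::prime_card ratfun" and x :: "'p ratfun set"
  assumes coord: "\<tau> \<in> coords" and point: "x \<in> points" and coord_regular: "\<tau> \<in> x"
    and dd_global: "\<And>n. divided_derivation \<tau> n \<in> diffops n points"
begin

abbreviation dd :: "nat \<Rightarrow> 'p oper" where "dd \<equiv> divided_derivation \<tau>"

lemma dd_stalk: "dd n \<in> stalk_diffops n x"
  using stalk_diffops_global[OF point] dd_global by blast

text \<open>The matrix of values of \<open>dd l\<close> at \<tau>^i is unitriangular, so
  coefficients matching D on 1, ..., \<tau>^n are found one after another; they stay in the local
  ring because germs of operators preserve it. Agreement on these powers suffices by
  \<open>diffop_eq_0\<close>.\<close>

lemma diffop_expansion:
  assumes D: "D \<in> stalk_diffops n x"
  obtains c where "\<And>l. c l \<in> x" "\<And>g. D g = (\<Sum>l\<le>n. c l * dd l g)"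
proof -
  have dd_self: "dd l (\<tau> ^ i) = (if i < l then 0 else if i = l then 1 else dd l (\<tau> ^ i))" for i l
    by (simp add: dd_power_coord[OF coord] binomial_eq_0)
  have "\<exists>c. (\<forall>l. c l \<in> x) \<and> (\<forall>i\<le>k. D (\<tau> ^ i) = (\<Sum>l\<le>k. c l * dd l (\<tau> ^ i)))" for k
  proof (induction k)
    case 0
    show ?case
      using stalk_diffops_stalk[OF D point_1[OF point]]
      by (intro exI[of _ "\<lambda>_. D 1"]) (simp add: dd_order_0[OF coord])
  next
    case (Suc k)
    then obtain c where c: "\<And>l. c l \<in> x" "\<And>i. i \<le> k \<Longrightarrow> D (\<tau> ^ i) = (\<Sum>l\<le>k. c l * dd l (\<tau> ^ i))" by blast
    \<comment> \<open>The error at the new power becomes the new coefficient;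
      \<open>dd (Suc k)\<close> kills the lower powers, so the earlier equations survive.\<close>
    define e where "e = D (\<tau> ^ Suc k) + - (\<Sum>l\<le>k. c l * dd l (\<tau> ^ Suc k))"
    have pw: "\<tau> ^ Suc k \<in> x" by (rule point_power[OF point coord_regular])
    have "e \<in> x" unfolding e_def
      by (intro point_closed point point_uminus point_sum c stalk_diffops_stalk[OF D] stalk_diffops_stalk[OF dd_stalk] pw)
    moreover have "D (\<tau> ^ i) = (\<Sum>l\<le>Suc k. (c(Suc k := e)) l * dd l (\<tau> ^ i))" if "i \<le> Suc k" for i
    proof (cases "i = Suc k")
      case True
      have "dd (Suc k) (\<tau> ^ Suc k) = 1" using dd_self[of "Suc k" "Suc k"] by simp
      then show ?thesis using True by (simp add: e_def del: power_Suc)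
    next
      case False
      then have "dd (Suc k) (\<tau> ^ i) = 0" using that dd_self[of "Suc k" i] by simp
      then show ?thesis using False that c(2)[of i] by simp
    qed
    ultimately show ?case using c(1) by (intro exI[of _ "c(Suc k := e)"]) auto
  qed
  then obtain c where c: "\<And>l. c l \<in> x" "\<And>i. i \<le> n \<Longrightarrow> D (\<tau> ^ i) = (\<Sum>l\<le>n. c l * dd l (\<tau> ^ i))" by metis
  have S: "(\<lambda>g. - (\<Sum>l\<le>n. c l * dd l g)) \<in> stalk_diffops n x"
    by (intro stalk_diffops_uminus stalk_diffops_sum stalk_diffops_lmult stalk_diffops_mono[OF dd_stalk] point c) simp
  have "(\<lambda>g. D g + - (\<Sum>l\<le>n. c l * dd l g)) \<in> stalk_diffops n x"
    by (rule stalk_diffops_add[OF D S])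
  note z = diffop_eq_0[OF coord stalk_diffopsD[OF this]]
  have "D g + - (\<Sum>l\<le>n. c l * dd l g) = 0" for g
    by (rule z) (simp add: c(2))
  then have "D g = (\<Sum>l\<le>n. c l * dd l g)" for g by simp
  then show ?thesis using that c(1) by blast
qed

end

section \<open>Germs of differential operators of level \<open>m\<close>\<close>

text \<open>A case of Lucas' congruence, read off by applying a divided derivation to
  \<open>coord\<close> to the power pn, viewed as the p-th power of \<open>coord ^ n\<close>. It is
  what reconciles the binomial coefficients of two consecutive levels.\<close>

lemma of_nat_choose_card_mult:
  "(of_nat (CARD('p) * n choose k) :: 'p::prime_card ratfun) =
    (if CARD('p) dvd k then of_nat (n choose (k div CARD('p))) else 0)"
proof (cases "k \<le> CARD('p) * n")
  case True
  let ?d = "divided_derivation (coord :: 'p ratfun)"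
  have \<tau>: "(coord :: 'p ratfun) \<in> coords" by (simp add: coords_def)
  have "of_nat (CARD('p) * n choose k) * (coord :: 'p ratfun) ^ (CARD('p) * n - k) = ?d k ((coord ^ n) ^ CARD('p))"
    by (simp add: dd_power_coord[OF \<tau>] power_mult[symmetric] mult.commute)
  also have "\<dots> = (if CARD('p) dvd k then
      of_nat (n choose (k div CARD('p))) * coord ^ (CARD('p) * n - k) else 0)"
  proof -
    have "of_nat c ^ CARD('p) = (of_nat c :: 'p ratfun)" for c
      using const_power_card[of "of_nat c"] by (simp add: const_of_nat)
    moreover have "(n - k div CARD('p)) * CARD('p) = CARD('p) * n - k" if "CARD('p) dvd k"
      using that by (simp add: diff_mult_distrib mult.commute[of n])
    ultimately show ?thesis
      unfolding dd_power_card[OF \<tau>] dd_power_coord[OF \<tau>] by (simp add: power_mult_distrib flip: power_mult)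
  qed
  finally show ?thesis by (simp add: coord_nonzero split: if_splits)
next
  case False
  then have "n < k div CARD('p)" if "CARD('p) dvd k"
    using that by (auto elim!: dvdE)
  then show ?thesis using False by (auto simp: binomial_eq_0)
qed

lemma of_nat_choose_card_power:
  "0 < i \<Longrightarrow> i < CARD('p) ^ m \<Longrightarrow> (of_nat (CARD('p) ^ m choose i) :: 'p::prime_card ratfun) = 0"
proof (induction m arbitrary: i)
  case (Suc m)
  then show ?case
    by (auto simp: of_nat_choose_card_mult elim!: dvdE)
qed simp

text \<open>In Vandermonde's sum the coefficients of q = p^m choose k vanish in characteristic p for
  0 < k < q. Consequently a divided derivation of order between q and 2q - 1 is the composite of the
  one of order q with one of order below q, with coefficient 1.\<close>

lemma of_nat_choose_card_power_add:
  assumes "r < CARD('p) ^ m"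
  shows "(of_nat (CARD('p) ^ m + r choose r) :: 'p::prime_card ratfun) = 1"
proof -
  let ?q = "CARD('p) ^ m"
  have "(of_nat (?q + r choose r) :: 'p ratfun) =
      (\<Sum>k\<le>r. of_nat (?q choose k) * of_nat (r choose (r - k)))"
    by (simp add: vandermonde[symmetric])
  also have "\<dots> = (\<Sum>k\<le>r. if k = 0 then 1 else 0)"
    using assms by (intro sum.cong) (auto simp: of_nat_choose_card_power)
  finally show ?thesis by simp
qed

section \<open>Calculus of germs at level m\<close>

lemma oper_algebra_simps [simp]:
  "carrier (oper_algebra S) = S" "monoid.mult (oper_algebra S) = (\<circ>)" "monoid.one (oper_algebra S) = id"
  "ring.zero (oper_algebra S) = (\<lambda>_. 0)" "ring.add (oper_algebra S) = (\<lambda>D D' f. D f + D' f)"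
  "module.smult (oper_algebra S) = (\<lambda>c D f. const c * D f)"
  by (simp_all add: oper_algebra_def)

lemma oper_algebra_a_inv:
  assumes "(\<lambda>f. - D f) \<in> S"
  shows "\<ominus>\<^bsub>oper_algebra S\<^esub> D = (\<lambda>f. - D f)"
  unfolding a_inv_def m_inv_def
proof (rule the_equality)
  fix E assume "E \<in> carrier (add_monoid (oper_algebra S)) \<and>
    D \<otimes>\<^bsub>add_monoid (oper_algebra S)\<^esub> E = \<one>\<^bsub>add_monoid (oper_algebra S)\<^esub> \<and>
    E \<otimes>\<^bsub>add_monoid (oper_algebra S)\<^esub> D = \<one>\<^bsub>add_monoid (oper_algebra S)\<^esub>"
  then have "D f + E f = 0" for f by (auto dest: fun_cong)
  then show "E = (\<lambda>f. - D f)" by (auto simp: eq_neg_iff_add_eq_0 add.commute)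
qed (use assms in simp)

lemma card_gt_1: "CARD('p::prime_card) > 1"
  using prime_card[where ?'a = 'p] prime_gt_1_nat by blast

lemma card_power_ge_1: "CARD('p::prime_card) ^ m \<ge> 1"
  using card_gt_1[where ?'p = 'p] by simp

text \<open>The three order bounds in the defining relations of level m + 1, divided by p and
  rounded down, become those of level m; each of the first two comes from p n - 1 = p (n - 1) + (p -
  1).\<close>

lemma card_mult_div:
  "(2 * CARD('p::prime_card) ^ Suc m - 1) div CARD('p) = 2 * CARD('p) ^ m - 1"
  "(CARD('p) ^ Suc m - 1) div CARD('p) = CARD('p) ^ m - 1"
  "CARD('p) ^ Suc m div CARD('p) = CARD('p) ^ m"
proof -
  have *: "(CARD('p) * n - 1) div CARD('p) = n - 1" if "n \<ge> 1" for n
  proof -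
    have "CARD('p) * n = CARD('p) * (n - 1) + CARD('p)"
      using that by (cases n) simp_all
    then have "CARD('p) * n - 1 = CARD('p) * (n - 1) + (CARD('p) - 1)"
      using card_gt_1[where ?'p = 'p] by linarith
    moreover have "CARD('p) - 1 < CARD('p)" using card_gt_1[where ?'p = 'p] by linarith
    ultimately show ?thesis by (simp only: div_mult_self4 div_mult_self2 div_less)
  qed
  show "(2 * CARD('p) ^ Suc m - 1) div CARD('p) = 2 * CARD('p) ^ m - 1"
    using *[of "2 * CARD('p) ^ m"] by (simp add: mult.left_commute)
  show "(CARD('p) ^ Suc m - 1) div CARD('p) = CARD('p) ^ m - 1"
    using *[OF card_power_ge_1] by simp
  show "CARD('p) ^ Suc m div CARD('p) = CARD('p) ^ m" by simp
qed

lemma sum_multiples: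
  fixes F :: "nat \<Rightarrow> 'a::comm_monoid_add"
  assumes "p > 0"
  shows "(\<Sum>i\<le>n. if p dvd i then F (i div p) else 0) = (\<Sum>e\<le>n div p. F e)"
proof -
  have "(\<Sum>i\<le>n. if p dvd i then F (i div p) else 0) = (\<Sum>i\<in>{i \<in> {..n}. p dvd i}. F (i div p))"
    by (rule sum.inter_filter[symmetric]) simp
  also have "\<dots> = (\<Sum>e\<le>n div p. F e)"
    by (rule sum.reindex_bij_witness[of _ "\<lambda>e. p * e" "\<lambda>i. i div p"])
       (use assms in \<open>auto simp: div_le_mono less_eq_div_iff_mult_less_eq mult.commute\<close>)
  finally show ?thesis .
qed

text \<open>The power p^m is a parameter of its own, which keeps the order bounds linear in
  \<open>q\<close>.\<close>

locale level =
  fixes x :: "'p::prime_card ratfun set" and m q :: nat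
  assumes point: "x \<in> points" and q_eq: "q = CARD('p) ^ m"
begin

abbreviation fa :: "('p oper word \<Rightarrow>\<^sub>0 'p mod_ring) set" where
  "fa \<equiv> carrier (free_algebra (stalk_diffops (2 * q - 1) x))"

abbreviation germ where "germ \<equiv> D_germ m x"

lemma q_ge_1: "q \<ge> 1"
  unfolding q_eq by (rule card_power_ge_1)

lemma germ_eq: "germ = tensor_class (stalk_algebra x) (stalk_diffops (2 * q - 1) x) (D_rels m x)"
  by (simp add: fun_eq_iff D_germ_def q_eq)

lemma D_stalk_eq: "D_stalk m x = tensor_quotient (stalk_algebra x) (stalk_diffops (2 * q - 1) x) (D_rels m x)"
  by (simp add: D_stalk_def q_eq)

lemma germ_cong_add: "germ a = germ a' \<Longrightarrow> germ b = germ b' \<Longrightarrow> germ (a + b) = germ (a' + b')"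
  unfolding germ_eq by (rule tensor_class_cong_add)

lemma germ_cong_sum: "(\<And>i. i \<in> I \<Longrightarrow> germ (a i) = germ (b i)) \<Longrightarrow> germ (sum a I) = germ (sum b I)"
  unfolding germ_eq by (rule tensor_class_cong_sum)

lemma germ_cong_mult:
  "germ a = germ a' \<Longrightarrow> germ b = germ b' \<Longrightarrow> a' \<in> fa \<Longrightarrow> b \<in> fa \<Longrightarrow> germ (a * b) = germ (a' * b')"
  unfolding germ_eq by (rule tensor_class_cong_mult)

lemma germ_cong_lmult: "germ b = germ b' \<Longrightarrow> a \<in> fa \<Longrightarrow> b \<in> fa \<Longrightarrow> germ (a * b) = germ (a * b')"
  by (rule germ_cong_mult) auto

lemma germ_cong_rmult: "germ a = germ a' \<Longrightarrow> a' \<in> fa \<Longrightarrow> b \<in> fa \<Longrightarrow> germ (a * b) = germ (a' * b)"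
  by (rule germ_cong_mult) auto

lemma carrier_D_stalk: "carrier (D_stalk m x) = germ ` fa"
  by (simp add: D_stalk_eq germ_eq carrier_tensor_quotient)

lemma germ_closed: "a \<in> fa \<Longrightarrow> germ a \<in> carrier (D_stalk m x)"
  by (simp add: carrier_D_stalk)

lemma germ_add: "a \<in> fa \<Longrightarrow> b \<in> fa \<Longrightarrow> germ a \<oplus>\<^bsub>D_stalk m x\<^esub> germ b = germ (a + b)"
  unfolding D_stalk_eq germ_eq by (rule tensor_class_add)

lemma germ_mult: "a \<in> fa \<Longrightarrow> b \<in> fa \<Longrightarrow> germ a \<otimes>\<^bsub>D_stalk m x\<^esub> germ b = germ (a * b)"
  unfolding D_stalk_eq germ_eq by (rule tensor_class_mult)

lemma letter_fa: "D \<in> stalk_diffops n x \<Longrightarrow> n \<le> 2 * q - 1 \<Longrightarrow> letter D \<in> fa"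
  by (rule letter_closed) (rule stalk_diffops_mono)

abbreviation fun_letter :: "'p ratfun \<Rightarrow> ('p oper word \<Rightarrow>\<^sub>0 'p mod_ring)" where
  "fun_letter f \<equiv> letter (\<lambda>g. f * g)"

lemma fun_letter_fa: "f \<in> x \<Longrightarrow> fun_letter f \<in> fa"
  by (rule letter_fa[OF stalk_diffops_mult[OF point]]) auto

lemma scalar_fa: "scalar c \<in> fa"
  by (rule scalar_closed)

lemma stalk_algebra_minus:
  assumes "D' \<in> stalk_diffops n x"
  shows "D \<ominus>\<^bsub>stalk_algebra x\<^esub> D' = (\<lambda>f. D f - D' f)"
proof -
  have "(\<lambda>f. - D' f) \<in> (\<Union>n. stalk_diffops n x)"
    using stalk_diffops_uminus[OF point assms] by blast
  then show ?thesis by (simp add: a_minus_def stalk_algebra_def oper_algebra_a_inv)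
qed

lemma germ_letter_add:
  assumes "D \<in> stalk_diffops (2 * q - 1) x" "D' \<in> stalk_diffops (2 * q - 1) x"
  shows "germ (letter (\<lambda>f. D f + D' f)) = germ (letter D + letter D')"
  using tensor_class_letter_add[of D _ D' "stalk_algebra x"] stalk_diffops_add[OF assms] assms
  by (simp add: germ_eq stalk_algebra_def)

lemma germ_letter_smult:
  assumes "D \<in> stalk_diffops (2 * q - 1) x"
  shows "germ (letter (\<lambda>f. const c * D f)) = germ (scalar c * letter D)"
  using tensor_class_letter_smult[of D _ "stalk_algebra x" c] assms
    stalk_diffops_lmult[OF point point_closed(3)[OF point] assms, of c]
  by (simp add: germ_eq stalk_algebra_def)

lemma germ_scalar: "germ (scalar c) = germ (fun_letter (const c))"
proof -
  have "(\<lambda>f. const c * id f) \<in> stalk_diffops (2 * q - 1) x"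
    by (rule stalk_diffops_lmult[OF point point_closed(3)[OF point] stalk_diffops_id[OF point]])
  moreover have "unit_rels (stalk_algebra x) \<subseteq> D_rels m x" by (auto simp: D_rels_def q_eq)
  ultimately show ?thesis
    using tensor_class_scalar[of "stalk_algebra x" c "stalk_diffops (2 * q - 1) x" "D_rels m x"]
    by (simp add: germ_eq stalk_algebra_def)
qed

lemma germ_letter_zero: "germ (letter (\<lambda>_. 0)) = germ 0"
  using germ_letter_smult[OF stalk_diffops_zero[OF point], of 0] by (simp add: scalar_simps)

lemma germ_letter_sum:
  assumes "\<And>i. i \<in> I \<Longrightarrow> D i \<in> stalk_diffops (2 * q - 1) x"
  shows "germ (letter (\<lambda>f. \<Sum>i\<in>I. D i f)) = germ (\<Sum>i\<in>I. letter (D i))"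
  using assms
proof (induction I rule: infinite_finite_induct)
  case (insert i I)
  have "germ (letter (\<lambda>f. D i f + (\<Sum>i\<in>I. D i f))) = germ (letter (D i) + letter (\<lambda>f. \<Sum>i\<in>I. D i f))"
    by (rule germ_letter_add[OF _ stalk_diffops_sum[OF point]]) (use insert.prems in auto)
  also have "\<dots> = germ (letter (D i) + (\<Sum>i\<in>I. letter (D i)))"
    using insert by (intro germ_cong_add) auto
  finally show ?case using insert.hyps by simp
qed (simp_all add: germ_letter_zero)

lemma germ_letter_mult:
  assumes "D \<in> stalk_diffops q x" "D' \<in> stalk_diffops (q - 1) x"
  shows "germ (letter D * letter D') = germ (letter (D \<circ> D'))"
proof -
  have "D \<circ> D' \<in> stalk_diffops (2 * q - 1) x"
    using stalk_diffops_comp[OF assms] q_ge_1 by (simp add: mult_2)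
  moreover have "stalk_diffops q x \<subseteq> stalk_diffops (2 * q - 1) x" "stalk_diffops (q - 1) x \<subseteq> stalk_diffops (2 * q - 1) x"
    using stalk_diffops_mono[of _ q x "2 * q - 1"] stalk_diffops_mono[of _ "q - 1" x "2 * q - 1"] q_ge_1 by auto
  moreover have "product_rels (stalk_algebra x) (stalk_diffops q x) (stalk_diffops (q - 1) x) \<subseteq> D_rels m x"
    by (auto simp: D_rels_def q_eq)
  ultimately show ?thesis
    using tensor_class_product[OF assms, of _ "stalk_algebra x"] by (simp add: germ_eq stalk_algebra_def)
qed

text \<open>The product relations put the factor of order below q on the right. For the opposite
  order, write D D' = [D, D'] + D' D and use the bracket relation for the first summand.\<close>

lemma germ_letter_mult':
  assumes D: "D \<in> stalk_diffops (q - 1) x" and D': "D' \<in> stalk_diffops q x"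
  shows "germ (letter D * letter D') = germ (letter (D \<circ> D'))"
proof -
  have s: "D \<circ> D' \<in> stalk_diffops (2 * q - 1) x" "D' \<circ> D \<in> stalk_diffops (2 * q - 1) x"
    using stalk_diffops_comp[OF D D'] stalk_diffops_comp[OF D' D] q_ge_1 by (simp_all add: mult_2)
  define B where "B = (\<lambda>f. (D \<circ> D') f - (D' \<circ> D) f)"
  have "(\<lambda>f. (D \<circ> D') f + - (D' \<circ> D) f) \<in> stalk_diffops (2 * q - 1) x"
    by (rule stalk_diffops_add[OF s(1) stalk_diffops_uminus[OF point s(2)]])
  then have B: "B \<in> stalk_diffops (2 * q - 1) x" by (simp add: B_def)
  have Beq: "D \<otimes>\<^bsub>stalk_algebra x\<^esub> D' \<ominus>\<^bsub>stalk_algebra x\<^esub> D' \<otimes>\<^bsub>stalk_algebra x\<^esub> D = B"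
    using stalk_algebra_minus[OF s(2), of "D \<circ> D'"] by (simp add: B_def stalk_algebra_def)
  have Dq: "D \<in> stalk_diffops q x" by (rule stalk_diffops_mono[OF D]) simp
  have sub: "stalk_diffops q x \<subseteq> stalk_diffops (2 * q - 1) x"
    using stalk_diffops_mono[of _ q x "2 * q - 1"] q_ge_1 by auto
  have rels: "bracket_rels (stalk_algebra x) (stalk_diffops q x) \<subseteq> D_rels m x"
    by (auto simp: D_rels_def q_eq)
  have "germ (letter D * letter D' - letter D' * letter D) = germ (letter B)"
    using tensor_class_bracket[OF Dq D' sub _ rels] B Beq by (simp add: germ_eq)
  from germ_cong_add[OF this germ_letter_mult[OF D' D]]
  have "germ (letter D * letter D') = germ (letter B + letter (D' \<circ> D))" by simp
  also have "\<dots> = germ (letter (\<lambda>f. B f + (D' \<circ> D) f))" by (rule germ_letter_add[OF B s(2), symmetric])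
  also have "(\<lambda>f. B f + (D' \<circ> D) f) = D \<circ> D'" by (simp add: B_def fun_eq_iff)
  finally show ?thesis .
qed

lemma germ_fun_letter_mult:
  assumes "f \<in> x" "D \<in> stalk_diffops q x"
  shows "germ (fun_letter f * letter D) = germ (letter (\<lambda>g. f * D g))"
  using germ_letter_mult'[OF stalk_diffops_mono[OF stalk_diffops_mult[OF point assms(1)]] assms(2)]
  by (simp add: comp_def)

lemma germ_fun_letter_mult_fun:
  assumes "f \<in> x" "g \<in> x"
  shows "germ (fun_letter f * fun_letter g) = germ (fun_letter (f * g))"
  using germ_fun_letter_mult[OF assms(1) stalk_diffops_mono[OF stalk_diffops_mult[OF point assms(2)]]]
  by (simp add: mult.assoc)

lemma germ_fun_letter_1: "germ (fun_letter 1) = germ 1"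
  using germ_scalar[of 1] by (simp add: scalar_simps const_simps)

end

section \<open>Divided derivations at level m\<close>

locale chart_level = chart \<tau> x + level x m q
  for \<tau> :: "'p::prime_card ratfun" and x :: "'p ratfun set" and m q :: nat
begin

abbreviation dl :: "nat \<Rightarrow> ('p oper word \<Rightarrow>\<^sub>0 'p mod_ring)" where "dl n \<equiv> letter (dd n)"

definition angle :: "nat \<Rightarrow> ('p oper word \<Rightarrow>\<^sub>0 'p mod_ring)" where
  "angle l = dl (l mod q) * dl q ^ (l div q)"

lemma angle_derivation_eq: "angle_derivation m x \<tau> l = germ (angle l)"
  by (simp add: angle_derivation_def angle_def Let_def flip: q_eq)

lemma dl_fa: "n \<le> 2 * q - 1 \<Longrightarrow> dl n \<in> fa"
  by (rule letter_fa[OF dd_stalk])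

lemma angle_fa: "angle l \<in> fa"
proof -
  have "l mod q \<le> 2 * q - 1" using mod_less_divisor[of q l] q_ge_1 by linarith
  then show ?thesis
    unfolding angle_def using q_ge_1 by (intro free_algebra_closed(4) power_closed dl_fa) auto
qed

lemma angle_add_mult: "angle (l + q * k) = angle l * dl q ^ k"
  using q_ge_1 by (simp add: angle_def mult.assoc add.commute flip: power_add)

lemma germ_dl_mult:
  assumes "i \<le> q" "j < q"
  shows "germ (dl i * dl j) = germ (scalar (of_nat (i + j choose i)) * dl (i + j))"
proof -
  have "germ (dl i * dl j) = germ (letter (dd i \<circ> dd j))"
    by (rule germ_letter_mult[OF stalk_diffops_mono[OF dd_stalk] stalk_diffops_mono[OF dd_stalk]])
       (use assms in auto)
  also have "dd i \<circ> dd j = (\<lambda>f. const (of_nat (i + j choose i)) * dd (i + j) f)"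
    by (simp add: fun_eq_iff dd_comp[OF coord] const_of_nat)
  also have "germ (letter \<dots>) = germ (scalar (of_nat (i + j choose i)) * dl (i + j))"
    by (rule germ_letter_smult[OF stalk_diffops_mono[OF dd_stalk]]) (use assms in auto)
  finally show ?thesis .
qed

lemma dd_q_comp: "s < q \<Longrightarrow> dd q (dd s f) = dd (q + s) f" "s < q \<Longrightarrow> dd s (dd q f) = dd (q + s) f"
proof -
  assume s: "s < q"
  have "(of_nat (q + s choose q) :: 'p ratfun) = 1"
    using of_nat_choose_card_power_add[OF s[unfolded q_eq], folded q_eq] binomial_symmetric[of s "q + s"] by simp
  then show "dd q (dd s f) = dd (q + s) f" by (simp add: dd_comp[OF coord])
  show "dd s (dd q f) = dd (q + s) f"
    using of_nat_choose_card_power_add[OF s[unfolded q_eq], folded q_eq] by (simp add: dd_comp[OF coord] add.commute)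
qed

lemma germ_dl_split:
  assumes "s < q"
  shows "germ (dl (q + s)) = germ (dl q * dl s)"
proof -
  have "germ (dl q * dl s) = germ (letter (dd q \<circ> dd s))"
    by (rule germ_letter_mult[OF dd_stalk stalk_diffops_mono[OF dd_stalk]]) (use assms in auto)
  then show ?thesis by (simp add: comp_def dd_q_comp(1)[OF assms])
qed

text \<open>Up to order 2q - 1 at most one factor \<open>dl q\<close> occurs in
  \<open>angle\<close>. It stands on the right there, so the product rule needed is the reversed
  one, \<open>germ_letter_mult'\<close>.\<close>

lemma germ_dl_angle:
  assumes "n \<le> 2 * q - 1"
  shows "germ (dl n) = germ (angle n)"
proof (cases "n < q")
  case True
  then show ?thesis by (simp add: angle_def)
next
  case False
  then obtain s where n: "n = q + s" using le_Suc_ex by (metis not_less)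
  have s: "s < q" using assms n q_ge_1 by linarith
  have "germ (dl s * dl q) = germ (letter (dd s \<circ> dd q))"
    by (rule germ_letter_mult'[OF stalk_diffops_mono[OF dd_stalk] dd_stalk]) (use s in auto)
  moreover have "(q + s) div q = 1" using s by (simp add: div_add_self1)
  ultimately show ?thesis by (simp add: n angle_def s comp_def dd_q_comp(2)[OF s])
qed

text \<open>Only the part of l below q interacts with \<open>dl j\<close>: then j + l mod q is at
  most 2q - 1, where products are honest compositions, and the remaining powers of
  \<open>dl q\<close> are carried along on the right. For j = q the coefficient is therefore 1 in
  characteristic p, unlike that of the composite operator.\<close>

lemma germ_dl_angle_mult:
  assumes "j \<le> q"
  shows "germ (dl j * angle l) = germ (scalar (of_nat (j + l mod q choose j)) * angle (j + l))"
proof -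
  let ?r = "l mod q" and ?k = "l div q"
  have r: "?r < q" using q_ge_1 by (intro mod_less_divisor) auto
  have jr: "j + ?r \<le> 2 * q - 1" using r assms by linarith
  note fa = free_algebra_closed(4) scalar_fa dl_fa[OF jr] angle_fa power_closed dl_fa
  have "germ (dl j * dl ?r) = germ (scalar (of_nat (j + ?r choose j)) * dl (j + ?r))"
    by (rule germ_dl_mult[OF assms r])
  also have "\<dots> = germ (scalar (of_nat (j + ?r choose j)) * angle (j + ?r))"
    by (rule germ_cong_lmult[OF germ_dl_angle[OF jr]]) (intro fa)+
  finally have "germ (dl j * dl ?r * dl q ^ ?k) = germ (scalar (of_nat (j + ?r choose j)) * angle (j + ?r) * dl q ^ ?k)"
    by (rule germ_cong_rmult) (use q_ge_1 in \<open>(intro fa; simp)+\<close>)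
  moreover have "angle (j + l) = angle (j + ?r) * dl q ^ ?k"
    using angle_add_mult[of "j + ?r" ?k] by (simp add: add.assoc)
  ultimately show ?thesis by (simp add: angle_def[of l] mult.assoc)
qed

lemma germ_leibniz:
  assumes "n \<le> q" "f \<in> x"
  shows "germ (dl n * fun_letter f) = germ (\<Sum>i\<le>n. fun_letter (dd i f) * dl (n - i))"
proof -
  have d: "dd i f \<in> x" for i by (rule stalk_diffops_stalk[OF dd_stalk assms(2)])
  have s: "dd (n - i) \<in> stalk_diffops q x" for i
    by (rule stalk_diffops_mono[OF dd_stalk]) (use assms in auto)
  have "germ (dl n * fun_letter f) = germ (letter (dd n \<circ> (\<lambda>g. f * g)))"
    by (rule germ_letter_mult[OF stalk_diffops_mono[OF dd_stalk] stalk_diffops_mono[OF stalk_diffops_mult[OF point assms(2)]]])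
       (use assms in auto)
  also have "dd n \<circ> (\<lambda>g. f * g) = (\<lambda>g. \<Sum>i\<le>n. dd i f * dd (n - i) g)"
    by (simp add: fun_eq_iff dd_mult[OF coord])
  also have "germ (letter \<dots>) = germ (\<Sum>i\<le>n. letter (\<lambda>g. dd i f * dd (n - i) g))"
    using q_ge_1 by (intro germ_letter_sum stalk_diffops_mono[OF stalk_diffops_lmult[OF point d s]]) auto
  also have "\<dots> = germ (\<Sum>i\<le>n. fun_letter (dd i f) * dl (n - i))"
    by (rule germ_cong_sum) (rule germ_fun_letter_mult[OF d s, symmetric])
  finally show ?thesis .
qed

text \<open>The relations give this directly up to order q. Beyond, the operator is f
  \<open>dd q\<close> composed with \<open>dd s\<close> for some s < q, so f has to be separated
  only from \<open>dd q\<close>.\<close>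

lemma germ_fun_dl:
  assumes "f \<in> x" "n \<le> 2 * q - 1"
  shows "germ (letter (\<lambda>g. f * dd n g)) = germ (fun_letter f * dl n)"
proof (cases "n \<le> q")
  case True
  then show ?thesis using germ_fun_letter_mult[OF assms(1) stalk_diffops_mono[OF dd_stalk]] by simp
next
  case False
  then obtain s where n: "n = q + s" using le_Suc_ex by (metis nle_le)
  have s: "s < q" using assms n q_ge_1 by linarith
  have q: "q \<le> 2 * q - 1" "s \<le> 2 * q - 1" using q_ge_1 s by auto
  have "(\<lambda>g. f * dd n g) = (\<lambda>g. f * dd q g) \<circ> dd s"
    by (simp add: fun_eq_iff n dd_q_comp(1)[OF s])
  then have "germ (letter (\<lambda>g. f * dd n g)) = germ (letter (\<lambda>g. f * dd q g) * dl s)"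
    using germ_letter_mult[OF stalk_diffops_lmult[OF point assms(1) dd_stalk] stalk_diffops_mono[OF dd_stalk], of s] s
    by simp
  also have "\<dots> = germ (fun_letter f * dl q * dl s)"
    by (rule germ_cong_rmult[OF germ_fun_letter_mult[OF assms(1) dd_stalk, symmetric]])
       (intro free_algebra_closed(4) fun_letter_fa assms dl_fa q)+
  also have "\<dots> = germ (fun_letter f * dl n)"
    unfolding mult.assoc n
    by (rule germ_cong_lmult[OF germ_dl_split[OF s, symmetric]])
       (intro free_algebra_closed(4) fun_letter_fa assms dl_fa q)+
  finally show ?thesis .
qed

lemma germ_letter_expansion:
  assumes "\<And>l. c l \<in> x" "\<And>g. D g = (\<Sum>l\<le>2 * q - 1. c l * dd l g)"
  shows "germ (letter D) = germ (\<Sum>l\<le>2 * q - 1. fun_letter (c l) * dl l)"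
proof -
  have "D = (\<lambda>g. \<Sum>l\<le>2 * q - 1. c l * dd l g)" using assms(2) by (simp add: fun_eq_iff)
  then have "germ (letter D) = germ (\<Sum>l\<le>2 * q - 1. letter (\<lambda>g. c l * dd l g))"
    by (simp only:) (rule germ_letter_sum, rule stalk_diffops_mono[OF stalk_diffops_lmult[OF point assms(1) dd_stalk]], simp)
  also have "\<dots> = germ (\<Sum>l\<le>2 * q - 1. fun_letter (c l) * dl l)"
    by (rule germ_cong_sum) (rule germ_fun_dl[OF assms(1)], simp)
  finally show ?thesis .
qed

text \<open>Left combinations are lists in which an index l may recur; sums are then
  concatenations.\<close>

definition in_span :: "('p oper word \<Rightarrow>\<^sub>0 'p mod_ring) \<Rightarrow> bool" where
  "in_span a \<longleftrightarrow> (\<exists>fls. fst ` set fls \<subseteq> x \<and> germ a = germ (\<Sum>(f, l)\<leftarrow>fls. fun_letter f * angle l))"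

lemma in_span_cong: "in_span a \<Longrightarrow> germ a = germ b \<Longrightarrow> in_span b"
  by (simp add: in_span_def)

lemma in_span_0: "in_span 0"
  unfolding in_span_def by (rule exI[of _ "[]"]) simp

lemma in_span_add: "in_span a \<Longrightarrow> in_span b \<Longrightarrow> in_span (a + b)"
proof -
  assume "in_span a" "in_span b"
  then obtain us vs where us: "fst ` set us \<subseteq> x" "germ a = germ (\<Sum>(f, l)\<leftarrow>us. fun_letter f * angle l)"
    and vs: "fst ` set vs \<subseteq> x" "germ b = germ (\<Sum>(f, l)\<leftarrow>vs. fun_letter f * angle l)"
    unfolding in_span_def by blast
  have "fst ` set (us @ vs) \<subseteq> x" "germ (a + b) = germ (\<Sum>(f, l)\<leftarrow>us @ vs. fun_letter f * angle l)"
    using us(1) vs(1) germ_cong_add[OF us(2) vs(2)] by (simp_all add: image_Un)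
  then show ?thesis unfolding in_span_def by (intro exI conjI)
qed

lemma in_span_sum: "(\<And>i. i \<in> I \<Longrightarrow> in_span (a i)) \<Longrightarrow> in_span (sum a I)"
  by (induction I rule: infinite_finite_induct) (auto intro: in_span_0 in_span_add)

lemma in_span_basis: "f \<in> x \<Longrightarrow> in_span (fun_letter f * angle l)"
  unfolding in_span_def by (rule exI[of _ "[(f, l)]"]) simp

lemma span_list_fa: "fst ` set fls \<subseteq> x \<Longrightarrow> (\<Sum>(f, l)\<leftarrow>fls. fun_letter f * angle l) \<in> fa"
proof (induction fls)
  case (Cons fl fls)
  obtain f l where fl: "fl = (f, l)" by (cases fl)
  then have "fun_letter f * angle l \<in> fa"
    using Cons.prems by (intro free_algebra_closed(4) fun_letter_fa angle_fa) simp
  then show ?case using Cons fl free_algebra_closed(3) by simp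
qed (simp add: free_algebra_closed(1))

lemma in_span_lmult:
  assumes c: "c \<in> fa" and basis: "\<And>f l. f \<in> x \<Longrightarrow> in_span (c * (fun_letter f * angle l))"
    and a: "a \<in> fa" "in_span a"
  shows "in_span (c * a)"
proof -
  obtain us where us: "fst ` set us \<subseteq> x" "germ a = germ (\<Sum>(f, l)\<leftarrow>us. fun_letter f * angle l)"
    using a(2) unfolding in_span_def by blast
  have "in_span (c * (\<Sum>(f, l)\<leftarrow>us. fun_letter f * angle l))"
    using us(1)
  proof (induction us)
    case (Cons fl us)
    obtain f l where fl: "fl = (f, l)" by (cases fl)
    then show ?case using Cons in_span_add[OF basis[of f l]] by (simp add: distrib_left)
  qed (simp add: in_span_0)
  then show ?thesis
    by (rule in_span_cong) (rule germ_cong_lmult[OF us(2)[symmetric] c span_list_fa[OF us(1)]])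
qed

lemma in_span_fun_letter_mult:
  assumes "h \<in> x" "a \<in> fa" "in_span a"
  shows "in_span (fun_letter h * a)"
proof (rule in_span_lmult[OF fun_letter_fa[OF assms(1)] _ assms(2,3)])
  fix f l assume f: "f \<in> x"
  show "in_span (fun_letter h * (fun_letter f * angle l))"
    unfolding mult.assoc[symmetric]
    by (rule in_span_cong[OF in_span_basis germ_cong_rmult[OF germ_fun_letter_mult_fun[symmetric]]])
       (intro point_closed point assms f free_algebra_closed(4) fun_letter_fa angle_fa)+
qed

lemma in_span_scalar_mult:
  assumes "a \<in> fa" "in_span a"
  shows "in_span (scalar c * a)"
  by (rule in_span_cong[OF in_span_fun_letter_mult germ_cong_rmult[OF germ_scalar[symmetric]]])
     (intro point_closed point assms scalar_fa)+

text \<open>Leibniz carries \<open>dl j\<close> past the coefficient f, and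
  \<open>germ_dl_angle_mult\<close> absorbs what is left into an angle element.\<close>

lemma in_span_dl_mult:
  assumes j: "j \<le> q" and a: "a \<in> fa" "in_span a"
  shows "in_span (dl j * a)"
proof (rule in_span_lmult[OF _ _ a])
  show jfa: "dl j \<in> fa" by (rule dl_fa) (use j q_ge_1 in linarith)
  fix f l assume f: "f \<in> x"
  have d: "dd i f \<in> x" for i by (rule stalk_diffops_stalk[OF dd_stalk f])
  have jfa': "dl (j - i) \<in> fa" for i by (rule dl_fa) (use j q_ge_1 in linarith)
  have "in_span (\<Sum>i\<le>j. fun_letter (dd i f) * (dl (j - i) * angle l))"
  proof (rule in_span_sum, rule in_span_fun_letter_mult)
    fix i assume "i \<in> {..j}"
    show "in_span (dl (j - i) * angle l)"
    proof (rule in_span_cong[OF _ germ_dl_angle_mult[symmetric]])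
      have "in_span (angle (j - i + l))"
      proof (rule in_span_cong[OF in_span_basis[OF point_1[OF point]]])
        show "germ (fun_letter 1 * angle (j - i + l)) = germ (angle (j - i + l))"
          using germ_cong_rmult[OF germ_fun_letter_1 free_algebra_closed(2) angle_fa] by simp
      qed
      then show "in_span (scalar (of_nat (j - i + l mod q choose (j - i))) * angle (j - i + l))"
        by (intro in_span_scalar_mult angle_fa)
    qed (use j in auto)
  qed (intro d free_algebra_closed(4) jfa' angle_fa)+
  moreover have "germ (\<Sum>i\<le>j. fun_letter (dd i f) * (dl (j - i) * angle l)) = germ (dl j * (fun_letter f * angle l))"
  proof -
    have "germ (dl j * fun_letter f * angle l) = germ ((\<Sum>i\<le>j. fun_letter (dd i f) * dl (j - i)) * angle l)"
      by (rule germ_cong_rmult[OF germ_leibniz[OF j f]])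
         (intro sum_free_algebra_closed free_algebra_closed(4) fun_letter_fa d jfa' angle_fa)+
    then show ?thesis by (simp add: sum_distrib_right mult.assoc)
  qed
  ultimately show "in_span (dl j * (fun_letter f * angle l))" by (rule in_span_cong)
qed

text \<open>Expanding D in divided derivations reduces to \<open>dl l\<close>; for l > q this is
  \<open>dl q\<close> times \<open>dl s\<close> with s < q, two applications of the previous
  lemma.\<close>

lemma in_span_letter_mult:
  assumes D: "D \<in> stalk_diffops (2 * q - 1) x" and a: "a \<in> fa" "in_span a"
  shows "in_span (letter D * a)"
proof -
  obtain c where c: "\<And>l. c l \<in> x" "\<And>g. D g = (\<Sum>l\<le>2 * q - 1. c l * dd l g)"
    by (rule diffop_expansion[OF D]) blast
  have dl: "in_span (dl l * a)" if l: "l \<le> 2 * q - 1" for l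
  proof (cases "l \<le> q")
    case False
    then obtain s where n: "l = q + s" using le_Suc_ex by (metis nle_le)
    have s: "s < q" using l n q_ge_1 by linarith
    have q: "q \<le> 2 * q - 1" "s \<le> 2 * q - 1" using q_ge_1 s by auto
    have "in_span (dl q * (dl s * a))"
      by (intro in_span_dl_mult free_algebra_closed(4) dl_fa q a) (use s in auto)
    then show ?thesis
      unfolding mult.assoc[symmetric] n
      by (rule in_span_cong) (rule germ_cong_rmult[OF germ_dl_split[OF s, symmetric] _ a(1)], rule dl_fa, use l n in simp)
  qed (rule in_span_dl_mult[OF _ a])
  have "in_span (\<Sum>l\<le>2 * q - 1. fun_letter (c l) * (dl l * a))"
    by (intro in_span_sum in_span_fun_letter_mult c free_algebra_closed(4) dl_fa a dl) auto
  then show ?thesis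
  proof (rule in_span_cong)
    have "germ (letter D * a) = germ ((\<Sum>l\<le>2 * q - 1. fun_letter (c l) * dl l) * a)"
      by (rule germ_cong_rmult[OF germ_letter_expansion[OF c] _ a(1)])
         (intro sum_free_algebra_closed free_algebra_closed(4) fun_letter_fa c dl_fa, simp)
    then show "germ (\<Sum>l\<le>2 * q - 1. fun_letter (c l) * (dl l * a)) = germ (letter D * a)"
      by (simp add: sum_distrib_right mult.assoc)
  qed
qed

text \<open>The span contains the class of 1, which is \<open>angle 0\<close>, and is stable under
  left multiplication by scalars and letters; words are built up from the left.\<close>

lemma in_span_all:
  assumes "a \<in> fa"
  shows "in_span a"
  using assms
proof (induction rule: free_algebra_induct)
  case (word u c)
  then show ?case
  proof (induction u)
    case Nil
    have "in_span (scalar c * fun_letter 1 * angle 0)"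
      using in_span_scalar_mult[OF _ in_span_basis[OF point_1[OF point]], of 0 c]
        fun_letter_fa[OF point_1[OF point]] angle_fa by (simp add: mult.assoc free_algebra_closed(4))
    moreover have "angle 0 = letter id" using q_ge_1 by (simp add: angle_def dd_order_0[OF coord])
    moreover have "germ (letter id) = germ 1"
      using germ_fun_letter_1 by (simp add: id_def)
    ultimately have a: "germ (angle 0) = germ 1" by simp
    have f: "fun_letter 1 \<in> fa" by (rule fun_letter_fa[OF point_1[OF point]])
    have "germ (scalar c * (fun_letter 1 * angle 0)) = germ (scalar c * (1 * 1))"
      by (rule germ_cong_lmult[OF germ_cong_mult[OF germ_fun_letter_1 a free_algebra_closed(2) angle_fa] scalar_fa
          free_algebra_closed(4)[OF f angle_fa]])
    then show ?case using in_span_cong[OF \<open>in_span (scalar c * fun_letter 1 * angle 0)\<close>]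
      by (simp add: single_Nil mult.assoc)
  next
    case (Cons D u)
    then have "in_span (Poly_Mapping.single (Word u) c)" "D \<in> stalk_diffops (2 * q - 1) x" "set u \<subseteq> stalk_diffops (2 * q - 1) x"
      by auto
    then show ?case unfolding single_Cons
      by (intro in_span_letter_mult free_algebra_closed(7)) auto
  qed
qed (auto intro: in_span_0 in_span_add)

end

section \<open>The Frobenius pullback\<close>

context level
begin

section \<open>Formal sums modulo the balanced subgroup\<close>

abbreviation cls where "cls \<equiv> pullback_class m x"

definition psums :: "('p ratfun \<times> ('p oper word \<Rightarrow>\<^sub>0 'p mod_ring) set \<Rightarrow>\<^sub>0 int) set" where
  "psums = carrier (formal_sums m x)"

definition tens :: "'p ratfun \<Rightarrow> ('p oper word \<Rightarrow>\<^sub>0 'p mod_ring) \<Rightarrow>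
    ('p ratfun \<times> ('p oper word \<Rightarrow>\<^sub>0 'p mod_ring) set \<Rightarrow>\<^sub>0 int)" where
  "tens f a = frag_of (f, germ a)"

lemma mem_psums: "c \<in> psums \<longleftrightarrow> Poly_Mapping.keys c \<subseteq> x \<times> carrier (D_stalk m x)"
  by (simp add: psums_def formal_sums_def)

lemma tens_psums: "f \<in> x \<Longrightarrow> a \<in> fa \<Longrightarrow> tens f a \<in> psums"
  by (simp add: tens_def mem_psums germ_closed)

lemma psums_closed:
  "0 \<in> psums" "c \<in> psums \<Longrightarrow> d \<in> psums \<Longrightarrow> c + d \<in> psums" "c \<in> psums \<Longrightarrow> - c \<in> psums"
  "c \<in> psums \<Longrightarrow> d \<in> psums \<Longrightarrow> c - d \<in> psums"
  unfolding mem_psums by (auto dest!: subsetD[OF Poly_Mapping.keys_add] subsetD[OF Poly_Mapping.keys_diff])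

lemma psums_sum: "(\<And>i. i \<in> I \<Longrightarrow> c i \<in> psums) \<Longrightarrow> sum c I \<in> psums"
  by (induction I rule: infinite_finite_induct) (simp_all add: psums_closed)

abbreviation bal where "bal \<equiv> balanced_subgroup m x"

text \<open>The generators of \<open>balanced_subgroup\<close> written with words in place of germs,
  so that ring operations of the stalk become operations on words.\<close>

definition bal_rels where
  "bal_rels =
     {tens (f + g) a - tens f a - tens g a | f g a. f \<in> x \<and> g \<in> x \<and> a \<in> fa} \<union>
     {tens f (a + b) - tens f a - tens f b | f a b. f \<in> x \<and> a \<in> fa \<and> b \<in> fa} \<union>
     {tens (f * h ^ CARD('p)) a - tens f (fun_letter h * a) | f h a. f \<in> x \<and> h \<in> x \<and> a \<in> fa}"

lemma bal_eq: "bal = generate (formal_sums m x) bal_rels"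
proof -
  have "{frag_of (f + g, R) - frag_of (f, R) - frag_of (g, R) | f g R.
         f \<in> x \<and> g \<in> x \<and> R \<in> carrier (D_stalk m x)} =
      {tens (f + g) a - tens f a - tens g a | f g a. f \<in> x \<and> g \<in> x \<and> a \<in> fa}"
    unfolding carrier_D_stalk tens_def by blast
  moreover have "{frag_of (f, R \<oplus>\<^bsub>D_stalk m x\<^esub> R') - frag_of (f, R) - frag_of (f, R') | f R R'.
         f \<in> x \<and> R \<in> carrier (D_stalk m x) \<and> R' \<in> carrier (D_stalk m x)} =
      {tens f (a + b) - tens f a - tens f b | f a b. f \<in> x \<and> a \<in> fa \<and> b \<in> fa}" (is "?L = ?R")
  proof
    show "?L \<subseteq> ?R"
    proof
      fix c assume "c \<in> ?L"
      then obtain f a b where c: "c = frag_of (f, germ a \<oplus>\<^bsub>D_stalk m x\<^esub> germ b) - frag_of (f, germ a) - frag_of (f, germ b)"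
        and ab: "f \<in> x" "a \<in> fa" "b \<in> fa" unfolding carrier_D_stalk by blast
      have "c = tens f (a + b) - tens f a - tens f b" unfolding c germ_add[OF ab(2,3)] tens_def ..
      then show "c \<in> ?R" using ab by blast
    qed
    show "?R \<subseteq> ?L"
    proof
      fix c assume "c \<in> ?R"
      then obtain f a b where "c = tens f (a + b) - tens f a - tens f b" and ab: "f \<in> x" "a \<in> fa" "b \<in> fa" by blast
      then have "c = frag_of (f, germ a \<oplus>\<^bsub>D_stalk m x\<^esub> germ b) - frag_of (f, germ a) - frag_of (f, germ b)"
        by (simp add: germ_add tens_def)
      then show "c \<in> ?L" using ab germ_closed by blast
    qed
  qed
  moreover have "{frag_of (f * h ^ CARD('p), R) - frag_of (f, fun_germ m x h \<otimes>\<^bsub>D_stalk m x\<^esub> R) | f h R.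
         f \<in> x \<and> h \<in> x \<and> R \<in> carrier (D_stalk m x)} =
      {tens (f * h ^ CARD('p)) a - tens f (fun_letter h * a) | f h a. f \<in> x \<and> h \<in> x \<and> a \<in> fa}" (is "?L = ?R")
  proof -
    have e: "fun_germ m x h \<otimes>\<^bsub>D_stalk m x\<^esub> germ a = germ (fun_letter h * a)" if "h \<in> x" "a \<in> fa" for h a
      using germ_mult[OF fun_letter_fa[OF that(1)] that(2)] by (simp add: fun_germ_def)
    show "?L = ?R"
    proof
      show "?L \<subseteq> ?R"
      proof
        fix c assume "c \<in> ?L"
        then obtain f h a where c: "c = frag_of (f * h ^ CARD('p), germ a) - frag_of (f, fun_germ m x h \<otimes>\<^bsub>D_stalk m x\<^esub> germ a)"
          and ab: "f \<in> x" "h \<in> x" "a \<in> fa" unfolding carrier_D_stalk by blast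
        have "c = tens (f * h ^ CARD('p)) a - tens f (fun_letter h * a)" unfolding c e[OF ab(2,3)] tens_def ..
        then show "c \<in> ?R" using ab by blast
      qed
      show "?R \<subseteq> ?L"
      proof
        fix c assume "c \<in> ?R"
        then obtain f h a where "c = tens (f * h ^ CARD('p)) a - tens f (fun_letter h * a)"
          and ab: "f \<in> x" "h \<in> x" "a \<in> fa" by blast
        then have "c = frag_of (f * h ^ CARD('p), germ a) - frag_of (f, fun_germ m x h \<otimes>\<^bsub>D_stalk m x\<^esub> germ a)"
          by (simp add: e tens_def)
        then show "c \<in> ?L" using ab germ_closed by blast
      qed
    qed
  qed
  ultimately show ?thesis by (simp only: balanced_subgroup_def bal_rels_def)
qed

lemma bal_rels_psums: "bal_rels \<subseteq> psums"
  unfolding bal_rels_def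
  by (auto intro!: psums_closed(4) tens_psums point_closed point point_power
    free_algebra_closed(3) free_algebra_closed(4) fun_letter_fa)

lemma subgroup_bal: "subgroup bal (formal_sums m x)"
  unfolding bal_eq
  by (rule group.generate_is_subgroup) (use bal_rels_psums in \<open>auto simp: psums_def formal_sums_def\<close>)

lemma bal_psums: "bal \<subseteq> psums"
  unfolding psums_def by (rule subgroup.subset[OF subgroup_bal])

lemma bal_closed:
  "0 \<in> bal" "c \<in> bal \<Longrightarrow> d \<in> bal \<Longrightarrow> c + d \<in> bal" "c \<in> bal \<Longrightarrow> - c \<in> bal"
  "c \<in> bal \<Longrightarrow> d \<in> bal \<Longrightarrow> c - d \<in> bal"
proof -
  show "0 \<in> bal" using subgroup.one_closed[OF subgroup_bal] by (simp add: formal_sums_def)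
  show p: "c + d \<in> bal" if "c \<in> bal" "d \<in> bal" for c d
    using subgroup.m_closed[OF subgroup_bal that] by (simp add: formal_sums_def)
  show m: "- c \<in> bal" if "c \<in> bal" for c
  proof -
    have "Poly_Mapping.keys c \<subseteq> x \<times> carrier (D_stalk m x)" using that bal_psums mem_psums by blast
    then show ?thesis using subgroup.m_inv_closed[OF subgroup_bal that] by (simp add: formal_sums_def)
  qed
  show "c - d \<in> bal" if "c \<in> bal" "d \<in> bal" for c d using p[OF that(1) m[OF that(2)]] by simp
qed

lemma bal_induct [consumes 1, case_names zero rel add uminus]:
  assumes c: "c \<in> bal" and zero: "P 0" and rel: "\<And>r. r \<in> bal_rels \<Longrightarrow> P r"
    and add: "\<And>c d. P c \<Longrightarrow> P d \<Longrightarrow> P (c + d)" and uminus: "\<And>c. P c \<Longrightarrow> P (- c)"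
  shows "P c"
  using c unfolding bal_eq
proof (induction rule: generate.induct)
  case one
  then show ?case using zero by (simp add: formal_sums_def)
next
  case (incl h)
  then show ?case by (rule rel)
next
  case (inv h)
  then have "Poly_Mapping.keys h \<subseteq> x \<times> carrier (D_stalk m x)" using bal_rels_psums mem_psums by blast
  then show ?case using uminus[OF rel[OF inv]] by (simp add: formal_sums_def)
next
  case (eng h h')
  then show ?case using add by (simp add: formal_sums_def)
qed

lemma mem_cls: "d \<in> cls c \<longleftrightarrow> d - c \<in> bal"
  by (auto simp: pullback_class_def r_coset_def formal_sums_def) (metis diff_add_cancel)

lemma cls_eq: "cls c = cls d \<longleftrightarrow> c - d \<in> bal"
proof
  assume "cls c = cls d"
  then show "c - d \<in> bal" using mem_cls[of c c] bal_closed(1) by (simp add: mem_cls)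
next
  assume cd: "c - d \<in> bal"
  show "cls c = cls d"
  proof (rule Set.set_eqI)
    fix e
    show "e \<in> cls c \<longleftrightarrow> e \<in> cls d"
      using bal_closed(2)[OF _ cd, of "e - c"] bal_closed(4)[OF _ cd, of "e - d"] by (auto simp: mem_cls)
  qed
qed

lemma cls_cong_add: "cls c = cls c' \<Longrightarrow> cls d = cls d' \<Longrightarrow> cls (c + d) = cls (c' + d')"
  unfolding cls_eq using bal_closed(2)[of "c - c'" "d - d'"] by (simp add: algebra_simps)

lemma cls_cong_sum: "(\<And>i. i \<in> I \<Longrightarrow> cls (c i) = cls (d i)) \<Longrightarrow> cls (sum c I) = cls (sum d I)"
proof (induction I rule: infinite_finite_induct)
  case (insert i I)
  then show ?case unfolding sum.insert[OF insert(1,2)] by (intro cls_cong_add) blast+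
qed simp_all

lemma cls_psums: "cls c = cls d \<Longrightarrow> c \<in> psums \<Longrightarrow> d \<in> psums"
  using psums_closed(4)[of c "c - d"] bal_psums by (auto simp: cls_eq)

lemma normal_bal: "bal \<lhd> formal_sums m x"
  using subgroup_bal comm_group.normal_iff_subgroup[OF abelian_free_Abelian_group]
  unfolding formal_sums_def by blast

lemma carrier_pullback_stalk: "carrier (pullback_stalk m x) = cls ` psums"
  by (auto simp: pullback_stalk_def FactGroup_def RCOSETS_def pullback_class_def psums_def)

lemma cls_mult: "c \<in> psums \<Longrightarrow> d \<in> psums \<Longrightarrow> cls c \<otimes>\<^bsub>pullback_stalk m x\<^esub> cls d = cls (c + d)"
  using normal.rcos_sum[OF normal_bal, of c d]
  by (simp add: pullback_stalk_def FactGroup_def pullback_class_def psums_def formal_sums_def)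

lemma cls_one: "\<one>\<^bsub>pullback_stalk m x\<^esub> = cls 0"
proof -
  have "\<one>\<^bsub>pullback_stalk m x\<^esub> = bal" by (simp add: pullback_stalk_def FactGroup_def)
  moreover have "d \<in> bal \<longleftrightarrow> d \<in> cls 0" for d by (simp add: mem_cls)
  ultimately show ?thesis by blast
qed

section \<open>Pure tensors and scalar multiplication\<close>

lemma tens_add_left: "f \<in> x \<Longrightarrow> g \<in> x \<Longrightarrow> a \<in> fa \<Longrightarrow> cls (tens (f + g) a) = cls (tens f a + tens g a)"
  unfolding cls_eq bal_eq by (rule generate.incl) (unfold bal_rels_def diff_diff_eq[symmetric], blast)

lemma tens_add_right: "f \<in> x \<Longrightarrow> a \<in> fa \<Longrightarrow> b \<in> fa \<Longrightarrow> cls (tens f (a + b)) = cls (tens f a + tens f b)"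
  unfolding cls_eq bal_eq by (rule generate.incl) (unfold bal_rels_def diff_diff_eq[symmetric], blast)

lemma tens_balanced:
  "f \<in> x \<Longrightarrow> h \<in> x \<Longrightarrow> a \<in> fa \<Longrightarrow> cls (tens (f * h ^ CARD('p)) a) = cls (tens f (fun_letter h * a))"
  unfolding cls_eq bal_eq by (rule generate.incl) (unfold bal_rels_def, blast)

lemma tens_germ_cong: "germ a = germ b \<Longrightarrow> tens f a = tens f b"
  by (simp add: tens_def)

lemma tens_zero_left: "a \<in> fa \<Longrightarrow> cls (tens 0 a) = cls 0"
  using tens_add_left[OF point_0[OF point] point_0[OF point], of a] bal_closed(3)[of "- tens 0 a"] by (simp add: cls_eq)

lemma tens_zero_right: "f \<in> x \<Longrightarrow> cls (tens f 0) = cls 0"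
  using tens_add_right[OF _ free_algebra_closed(1) free_algebra_closed(1), of f] bal_closed(3)[of "- tens f 0"]
  by (simp add: cls_eq)

lemma tens_sum_left:
  "(\<And>i. i \<in> I \<Longrightarrow> f i \<in> x) \<Longrightarrow> a \<in> fa \<Longrightarrow> cls (tens (sum f I) a) = cls (\<Sum>i\<in>I. tens (f i) a)"
proof (induction I rule: infinite_finite_induct)
  case (insert i I)
  have "cls (tens (f i + sum f I) a) = cls (tens (f i) a + tens (sum f I) a)"
    using insert.prems by (intro tens_add_left point_sum[OF point]) auto
  also have "\<dots> = cls (tens (f i) a + (\<Sum>i\<in>I. tens (f i) a))"
    using insert by (intro cls_cong_add) auto
  finally show ?case using insert.hyps by simp
qed (simp_all add: tens_zero_left)

lemma tens_sum_right:
  "f \<in> x \<Longrightarrow> (\<And>i. i \<in> I \<Longrightarrow> a i \<in> fa) \<Longrightarrow> cls (tens f (sum a I)) = cls (\<Sum>i\<in>I. tens f (a i))"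
proof (induction I rule: infinite_finite_induct)
  case (insert i I)
  have "cls (tens f (a i + sum a I)) = cls (tens f (a i) + tens f (sum a I))"
    using insert.prems by (intro tens_add_right sum_free_algebra_closed) auto
  also have "\<dots> = cls (tens f (a i) + (\<Sum>i\<in>I. tens f (a i)))"
    using insert by (intro cls_cong_add) auto
  finally show ?case using insert.hyps by simp
qed (simp_all add: tens_zero_right)

lemma frag_extend_bal:
  assumes "c \<in> bal" and "\<And>r. r \<in> bal_rels \<Longrightarrow> frag_extend F r \<in> bal"
  shows "frag_extend F c \<in> bal"
  using assms(1)
  by (induction rule: bal_induct) (simp_all add: assms(2) bal_closed frag_extend_add frag_extend_minus)

lemma frag_extend_psums:
  assumes "c \<in> psums" and F: "\<And>f a. f \<in> x \<Longrightarrow> a \<in> fa \<Longrightarrow> F (f, germ a) \<in> psums"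
  shows "frag_extend F c \<in> psums"
proof -
  have "Poly_Mapping.keys (F k) \<subseteq> x \<times> carrier (D_stalk m x)" if "k \<in> Poly_Mapping.keys c" for k
    using that assms(1) F unfolding mem_psums carrier_D_stalk by blast
  then show ?thesis
    unfolding mem_psums[of "frag_extend F c"] using keys_frag_extend[of F c] by blast
qed

definition frag_smult where "frag_smult f = frag_extend (\<lambda>(g, R). frag_of (f * g, R))"

lemma frag_smult_tens [simp]: "frag_smult f (tens g a) = tens (f * g) a"
  by (simp add: frag_smult_def tens_def)

lemma frag_smult_simps:
  "frag_smult f 0 = 0" "frag_smult f (c + d) = frag_smult f c + frag_smult f d"
  "frag_smult f (c - d) = frag_smult f c - frag_smult f d"
  by (simp_all add: frag_smult_def frag_extend_add frag_extend_diff)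

lemma frag_smult_psums: "f \<in> x \<Longrightarrow> c \<in> psums \<Longrightarrow> frag_smult f c \<in> psums"
  unfolding frag_smult_def
  by (rule frag_extend_psums) (auto simp: mem_psums germ_closed intro: point_closed point)

lemma frag_smult_bal:
  assumes f: "f \<in> x" and c: "c \<in> bal"
  shows "frag_smult f c \<in> bal"
  unfolding frag_smult_def
proof (rule frag_extend_bal[OF c], fold frag_smult_def)
  have fx: "f * g \<in> x" if "g \<in> x" for g by (intro point_closed point f that)
  fix r assume "r \<in> bal_rels"
  then consider g h a where "r = tens (g + h) a - tens g a - tens h a" "g \<in> x" "h \<in> x" "a \<in> fa"
    | g a b where "r = tens g (a + b) - tens g a - tens g b" "g \<in> x" "a \<in> fa" "b \<in> fa"
    | g h a where "r = tens (g * h ^ CARD('p)) a - tens g (fun_letter h * a)" "g \<in> x" "h \<in> x" "a \<in> fa"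
    unfolding bal_rels_def by blast
  then show "frag_smult f r \<in> bal"
  proof cases
    case 1
    then show ?thesis using tens_add_left[OF fx fx, of g h a]
      by (simp add: frag_smult_simps cls_eq distrib_left diff_diff_eq)
  next
    case 2
    then show ?thesis using tens_add_right[OF fx, of g a b]
      by (simp add: frag_smult_simps cls_eq diff_diff_eq)
  next
    case 3
    then show ?thesis using tens_balanced[OF fx, of g h a]
      by (simp add: frag_smult_simps cls_eq mult.assoc)
  qed
qed

lemma frag_smult_cong: "f \<in> x \<Longrightarrow> cls c = cls d \<Longrightarrow> cls (frag_smult f c) = cls (frag_smult f d)"
  using frag_smult_bal[of f "c - d"] by (simp add: cls_eq frag_smult_simps)

text \<open>The union defining \<open>pullback_smult\<close> runs over all representatives; since
  scaling preserves the balanced subgroup, all contribute the same class.\<close>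

lemma pullback_smult_cls:
  assumes f: "f \<in> x"
  shows "pullback_smult m x f (cls c) = cls (frag_smult f c)"
proof -
  have "cls (frag_smult f d) = cls (frag_smult f c)" if "d \<in> cls c" for d
    using that by (intro frag_smult_cong f) (simp add: mem_cls cls_eq)
  moreover have "c \<in> cls c" using bal_closed(1) by (simp add: mem_cls)
  ultimately show ?thesis unfolding pullback_smult_def frag_smult_def[symmetric] by blast
qed

end

context chart_level
begin

text \<open>The operator through which \<open>\<partial>\<^sup>[\<^sup>n\<^sup>]\<close> acts on the pullback, dictated by the Leibniz rule.\<close>

definition pull_dd where
  "pull_dd n = frag_extend (\<lambda>(g, R). \<Sum>e\<le>n div CARD('p).
     frag_of (dd (n - CARD('p) * e) g, germ (dl e) \<otimes>\<^bsub>D_stalk m x\<^esub> R))"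

lemma pull_dd_simps:
  "pull_dd n 0 = 0" "pull_dd n (c + d) = pull_dd n c + pull_dd n d"
  "pull_dd n (c - d) = pull_dd n c - pull_dd n d"
  by (simp_all add: pull_dd_def frag_extend_add frag_extend_diff)

text \<open>The bound keeps every e up to n div p at most q, the range in which
  \<open>germ_leibniz\<close> is available at level m.\<close>

context
  fixes n :: nat
  assumes n: "n \<le> CARD('p) * q"
begin

lemma dl_div_fa: "e \<le> n div CARD('p) \<Longrightarrow> dl e \<in> fa"
proof -
  assume "e \<le> n div CARD('p)"
  also have "\<dots> \<le> q" using div_le_mono[OF n, of "CARD('p)"] card_gt_1[where ?'p = 'p] by simp
  finally show ?thesis using q_ge_1 by (intro dl_fa) linarith
qed

lemma pull_dd_tens:
  assumes "a \<in> fa"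
  shows "pull_dd n (tens f a) = (\<Sum>e\<le>n div CARD('p). tens (dd (n - CARD('p) * e) f) (dl e * a))"
  unfolding pull_dd_def tens_def frag_extend_of case_prod_conv
  by (intro sum.cong refl) (simp only: germ_mult[OF dl_div_fa assms] atMost_iff)

text \<open>Both sides become the sum of \<open>G b e\<close> over b + e \<le> n div p. On the left,
  derivatives of h^p survive only in orders p b, where they are p-th powers of derivatives of h. On
  the right, \<open>dl e\<close> is moved past h by Leibniz, and the resulting derivative of h
  crosses the tensor sign as a p-th power.\<close>

lemma pull_dd_balanced:
  assumes f: "f \<in> x" and h: "h \<in> x" and a: "a \<in> fa"
  shows "cls (pull_dd n (tens (f * h ^ CARD('p)) a)) = cls (pull_dd n (tens f (fun_letter h * a)))"
proof -
  let ?p = "CARD('p)" and ?N = "n div CARD('p)"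
  have p0: "?p > 0" by simp
  have d: "dd i g \<in> x" if "g \<in> x" for i g by (rule stalk_diffops_stalk[OF dd_stalk that])
  have NQ: "?N \<le> q" using div_le_mono[OF n, of ?p] by simp
  define G where "G b e = tens (dd (n - ?p * (b + e)) f * dd b h ^ ?p) (dl e * a)" for b e
  have left: "cls (tens (dd (n - ?p * e) (f * h ^ ?p)) (dl e * a)) = cls (\<Sum>b\<le>?N - e. G b e)"
    if e: "e \<le> ?N" for e
  proof -
    let ?k = "n - ?p * e"
    have pe: "?p * e \<le> n" using e p0 by (metis less_eq_div_iff_mult_less_eq mult.commute)
    have "(?p * e + ?k) div ?p = e + ?k div ?p" by simp
    then have k: "?k div ?p = ?N - e" using pe by simp
    have "dd ?k (f * h ^ ?p) = (\<Sum>i\<le>?k. dd (?k - i) f * dd i (h ^ ?p))"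
      unfolding mult.commute[of f] dd_mult[OF coord] by (simp only: mult.commute)
    also have "\<dots> = (\<Sum>i\<le>?k. if ?p dvd i then dd (?k - ?p * (i div ?p)) f * dd (i div ?p) h ^ ?p else 0)"
      by (rule sum.cong) (simp_all add: dd_power_card[OF coord])
    also have "\<dots> = (\<Sum>b\<le>?N - e. dd (?k - ?p * b) f * dd b h ^ ?p)"
      unfolding k[symmetric] by (rule sum_multiples[OF p0])
    also have "\<dots> = (\<Sum>b\<le>?N - e. dd (n - ?p * (b + e)) f * dd b h ^ ?p)"
      by (simp add: diff_diff_eq distrib_left add.commute)
    finally have "dd ?k (f * h ^ ?p) = (\<Sum>b\<le>?N - e. dd (n - ?p * (b + e)) f * dd b h ^ ?p)" .
    then show ?thesis unfolding G_def
      by (simp only:) (intro tens_sum_left point_closed point point_power d f h free_algebra_closed(4) dl_div_fa e a)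
  qed
  have right: "cls (tens (dd (n - ?p * e) f) (dl e * (fun_letter h * a))) = cls (\<Sum>b\<le>e. G b (e - b))"
    if e: "e \<le> ?N" for e
  proof -
    have eb: "dl (e - b) \<in> fa" for b by (rule dl_div_fa) (use e in simp)
    have "germ (dl e * fun_letter h * a) = germ ((\<Sum>b\<le>e. fun_letter (dd b h) * dl (e - b)) * a)"
      by (rule germ_cong_rmult[OF germ_leibniz])
         (use e NQ in \<open>(intro h a sum_free_algebra_closed free_algebra_closed(4) fun_letter_fa d eb | simp)+\<close>)
    then have "tens (dd (n - ?p * e) f) (dl e * (fun_letter h * a)) =
        tens (dd (n - ?p * e) f) (\<Sum>b\<le>e. fun_letter (dd b h) * (dl (e - b) * a))"
      by (intro tens_germ_cong) (simp add: sum_distrib_right mult.assoc)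
    also have "cls \<dots> = cls (\<Sum>b\<le>e. tens (dd (n - ?p * e) f) (fun_letter (dd b h) * (dl (e - b) * a)))"
      by (intro tens_sum_right d f free_algebra_closed(4) fun_letter_fa h eb a)
    also have "\<dots> = cls (\<Sum>b\<le>e. G b (e - b))"
    proof (rule cls_cong_sum)
      fix b assume "b \<in> {..e}"
      then have "G b (e - b) = tens (dd (n - ?p * e) f * dd b h ^ ?p) (dl (e - b) * a)" by (simp add: G_def)
      then show "cls (tens (dd (n - ?p * e) f) (fun_letter (dd b h) * (dl (e - b) * a))) = cls (G b (e - b))"
        using tens_balanced[OF d[OF f] d[OF h] free_algebra_closed(4)[OF eb a], of "n - ?p * e" b b] by simp
    qed
    finally show ?thesis .
  qed
  have "cls (pull_dd n (tens (f * h ^ ?p) a)) = cls (\<Sum>e\<le>?N. \<Sum>b\<le>?N - e. G b e)"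
    unfolding pull_dd_tens[OF a] by (rule cls_cong_sum) (simp add: left)
  \<comment> \<open>The same triangle is summed along its diagonals k = b + e; on the right-hand
    side k is the order of the derivation before Leibniz is applied to it.\<close>
  also have "(\<Sum>e\<le>?N. \<Sum>b\<le>?N - e. G b e) = (\<Sum>(b, e)\<in>{(b, e). b + e \<le> ?N}. G b e)"
    unfolding sum.Sigma[OF finite_atMost ballI[OF finite_atMost]]
    by (rule sum.reindex_bij_witness[of _ "\<lambda>(b, e). (e, b)" "\<lambda>(e, b). (b, e)"]) auto
  also have "\<dots> = (\<Sum>k\<le>?N. \<Sum>b\<le>k. G b (k - b))" by (rule sum.triangle_reindex_eq)
  also have "cls \<dots> = cls (pull_dd n (tens f (fun_letter h * a)))"
    unfolding pull_dd_tens[OF free_algebra_closed(4)[OF fun_letter_fa[OF h] a]]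
    by (rule cls_cong_sum) (simp add: right)
  finally show ?thesis .
qed

lemma pull_dd_bal:
  assumes c: "c \<in> bal"
  shows "pull_dd n c \<in> bal"
  unfolding pull_dd_def
proof (rule frag_extend_bal[OF c], fold pull_dd_def)
  have d: "dd i g \<in> x" if "g \<in> x" for i g by (rule stalk_diffops_stalk[OF dd_stalk that])
  fix r assume "r \<in> bal_rels"
  then consider g h a where "r = tens (g + h) a - tens g a - tens h a" "g \<in> x" "h \<in> x" "a \<in> fa"
    | g a b where "r = tens g (a + b) - tens g a - tens g b" "g \<in> x" "a \<in> fa" "b \<in> fa"
    | g h a where "r = tens (g * h ^ CARD('p)) a - tens g (fun_letter h * a)" "g \<in> x" "h \<in> x" "a \<in> fa"
    unfolding bal_rels_def by blast
  then show "pull_dd n r \<in> bal"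
  proof cases
    case 1
    have "cls (pull_dd n (tens (g + h) a)) = cls (pull_dd n (tens g a) + pull_dd n (tens h a))"
      unfolding pull_dd_tens[OF 1(4)] sum.distrib[symmetric] dd_add[OF coord]
      by (intro cls_cong_sum tens_add_left d 1 free_algebra_closed(4) dl_div_fa) simp
    then show ?thesis using 1(1) by (simp add: pull_dd_simps cls_eq diff_diff_eq)
  next
    case 2
    have "cls (pull_dd n (tens g (a + b))) = cls (pull_dd n (tens g a) + pull_dd n (tens g b))"
      unfolding pull_dd_tens[OF 2(3)] pull_dd_tens[OF 2(4)] pull_dd_tens[OF free_algebra_closed(3)[OF 2(3,4)]]
        sum.distrib[symmetric] distrib_left
      by (intro cls_cong_sum tens_add_right d 2 free_algebra_closed(4) dl_div_fa) simp_all
    then show ?thesis using 2(1) by (simp add: pull_dd_simps cls_eq diff_diff_eq)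
  next
    case 3
    then show ?thesis using pull_dd_balanced[of g h a] by (simp add: pull_dd_simps cls_eq)
  qed
qed

lemma pull_dd_cong: "cls c = cls d \<Longrightarrow> cls (pull_dd n c) = cls (pull_dd n d)"
  using pull_dd_bal[of "c - d"] by (simp add: cls_eq pull_dd_simps)

end

end

section \<open>Berthelot's map at a point\<close>

locale can_point = lo: chart_level \<tau> x m q + hi: chart_level \<tau> x "Suc m" q'
  for \<tau> :: "'p::prime_card ratfun" and x :: "'p ratfun set" and m q q' :: nat +
  fixes k :: "('p oper word \<Rightarrow>\<^sub>0 'p mod_ring) set \<Rightarrow> 'p pullback"
  assumes k_closed: "R \<in> carrier (D_stalk (Suc m) x) \<Longrightarrow> k R \<in> carrier (pullback_stalk m x)"
    and k_add: "R \<in> carrier (D_stalk (Suc m) x) \<Longrightarrow> R' \<in> carrier (D_stalk (Suc m) x) \<Longrightarrow>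
      k (R \<oplus>\<^bsub>D_stalk (Suc m) x\<^esub> R') = k R \<otimes>\<^bsub>pullback_stalk m x\<^esub> k R'"
    and k_lmult: "f \<in> x \<Longrightarrow> R \<in> carrier (D_stalk (Suc m) x) \<Longrightarrow>
      k (fun_germ (Suc m) x f \<otimes>\<^bsub>D_stalk (Suc m) x\<^esub> R) = pullback_smult m x f (k R)"
    and k_angle: "k (angle_derivation (Suc m) x \<tau> l) =
      (if CARD('p) dvd l then pure_tensor m x 1 (angle_derivation m x \<tau> (l div CARD('p)))
       else \<one>\<^bsub>pullback_stalk m x\<^esub>)"
begin

abbreviation (input) dd where "dd \<equiv> divided_derivation \<tau>"

abbreviation (input) dl :: "nat \<Rightarrow> ('p oper word \<Rightarrow>\<^sub>0 'p mod_ring)" where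
  "dl n \<equiv> letter (divided_derivation \<tau> n)"

lemma q'_eq: "q' = CARD('p) * q"
  by (simp add: lo.q_eq hi.q_eq)

lemma dd_x: "f \<in> x \<Longrightarrow> dd i f \<in> x"
  by (rule stalk_diffops_stalk[OF lo.dd_stalk])

text \<open>A relation on representatives: the word w is sent by the map to the class of c. Carrying
  the two memberships along spares separate side conditions at each multiplication.\<close>

definition rep where
  "rep w c \<longleftrightarrow> w \<in> hi.fa \<and> c \<in> lo.psums \<and> k (hi.germ w) = lo.cls c"

lemma rep_fa: "rep w c \<Longrightarrow> w \<in> hi.fa"
  by (simp add: rep_def)

lemma rep_exists: "w \<in> hi.fa \<Longrightarrow> \<exists>c. rep w c"
  using k_closed[OF hi.germ_closed, of w] by (auto simp: rep_def lo.carrier_pullback_stalk)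

lemma rep_cong:
  "rep w c \<Longrightarrow> hi.germ w = hi.germ w' \<Longrightarrow> w' \<in> hi.fa \<Longrightarrow> lo.cls c = lo.cls c' \<Longrightarrow> rep w' c'"
  using lo.cls_psums[of c c'] by (simp add: rep_def)

lemma rep_cong_right: "rep w c \<Longrightarrow> lo.cls c = lo.cls c' \<Longrightarrow> rep w c'"
  using rep_cong[of w c w c'] by (simp add: rep_def)

lemma rep_unique: "rep w c \<Longrightarrow> rep w d \<Longrightarrow> lo.cls c = lo.cls d"
  by (simp add: rep_def)

lemma rep_add: "rep w c \<Longrightarrow> rep w' c' \<Longrightarrow> rep (w + w') (c + c')"
  unfolding rep_def
proof (intro conjI; elim conjE)
  assume a: "w \<in> hi.fa" "w' \<in> hi.fa" "c \<in> lo.psums" "c' \<in> lo.psums"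
    "k (hi.germ w) = lo.cls c" "k (hi.germ w') = lo.cls c'"
  show "w + w' \<in> hi.fa" using a(1,2) by (rule free_algebra_closed)
  show "c + c' \<in> lo.psums" using a(3,4) by (rule lo.psums_closed)
  have "k (hi.germ (w + w')) = k (hi.germ w) \<otimes>\<^bsub>pullback_stalk m x\<^esub> k (hi.germ w')"
    using k_add[OF hi.germ_closed[OF a(1)] hi.germ_closed[OF a(2)]] hi.germ_add[OF a(1,2)] by simp
  then show "k (hi.germ (w + w')) = lo.cls (c + c')"
    using a lo.cls_mult by simp
qed

text \<open>Only additivity of the map is given; a value c at 0 satisfies c + c = c modulo the
  balanced subgroup, hence is trivial there.\<close>

lemma rep_0: "rep 0 0"
proof -
  obtain c where c: "rep 0 c" using rep_exists[OF free_algebra_closed(1)] by blast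
  from rep_unique[OF rep_add[OF this this, simplified] this] have "c \<in> lo.bal"
    by (simp add: lo.cls_eq)
  then have "lo.cls c = lo.cls 0" by (simp add: lo.cls_eq)
  then show ?thesis by (rule rep_cong_right[OF c])
qed

lemma rep_sum: "(\<And>i. i \<in> I \<Longrightarrow> rep (w i) (c i)) \<Longrightarrow> rep (sum w I) (sum c I)"
  by (induction I rule: infinite_finite_induct) (simp_all add: rep_0 rep_add)

lemma rep_fun_letter: 
  assumes f: "f \<in> x" and w: "rep w c"
  shows "rep (hi.fun_letter f * w) (lo.frag_smult f c)"
proof -
  have a: "w \<in> hi.fa" "c \<in> lo.psums" "k (hi.germ w) = lo.cls c" using w by (simp_all add: rep_def)
  have "k (hi.germ (hi.fun_letter f * w)) = pullback_smult m x f (k (hi.germ w))"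
    using k_lmult[OF f hi.germ_closed[OF a(1)]] hi.germ_mult[OF hi.fun_letter_fa[OF f] a(1)]
    by (simp add: fun_germ_def)
  also have "\<dots> = lo.cls (lo.frag_smult f c)"
    by (simp add: a lo.pullback_smult_cls[OF f])
  finally show ?thesis
    unfolding rep_def by (intro conjI free_algebra_closed(4) hi.fun_letter_fa f a lo.frag_smult_psums)
qed

lemma rep_scalar:
  assumes w: "rep w c"
  shows "rep (scalar b * w) (lo.frag_smult (const b) c)"
proof -
  have b: "const b \<in> x" by (rule point_closed(3)[OF lo.point])
  show ?thesis
    by (rule rep_cong[OF rep_fun_letter[OF b w] hi.germ_cong_rmult[OF hi.germ_scalar[symmetric] hi.scalar_fa rep_fa[OF w]]
          free_algebra_closed(4)[OF hi.scalar_fa rep_fa[OF w]]]) simp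
qed

definition angle_rep where
  "angle_rep l = (if CARD('p) dvd l then lo.tens 1 (lo.angle (l div CARD('p))) else 0)"

lemma rep_angle: "rep (hi.angle l) (angle_rep l)"
  using k_angle[of l] hi.angle_fa[of l] lo.psums_closed(1)
    lo.tens_psums[OF point_1[OF lo.point] lo.angle_fa, of "l div CARD('p)"]
  by (simp add: rep_def angle_rep_def hi.angle_derivation_eq lo.angle_derivation_eq lo.cls_one
      pure_tensor_def lo.tens_def)

lemma dvd_mod_card: "CARD('p) dvd l mod q' \<longleftrightarrow> CARD('p) dvd l"
  by (simp add: q'_eq dvd_mod_iff)

lemma div_mod_card: "l mod q' div CARD('p) = l div CARD('p) mod q"
  by (simp add: q'_eq div_mult2_eq mod_mult2_eq)

text \<open>Balancing would turn the scalar into its p-th root, which is the scalar itself in the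
  prime field.\<close>

lemma tens_scalar:
  assumes a: "a \<in> lo.fa"
  shows "lo.cls (lo.tens (const b) a) = lo.cls (lo.tens 1 (scalar b * a))"
proof -
  have b: "const b \<in> x" by (rule point_closed(3)[OF lo.point])
  have "lo.cls (lo.tens (const b) a) = lo.cls (lo.tens 1 (lo.fun_letter (const b) * a))"
    using lo.tens_balanced[OF point_1[OF lo.point] b a] by (simp add: const_power_card)
  also have "lo.tens 1 (lo.fun_letter (const b) * a) = lo.tens 1 (scalar b * a)"
    by (rule lo.tens_germ_cong[OF lo.germ_cong_rmult[OF lo.germ_scalar[symmetric] lo.scalar_fa a]])
  finally show ?thesis .
qed

text \<open>The product is a scalar times \<open>hi.angle (j + l)\<close>, whose image vanishes
  unless p divides j + l. If it does, the scalar is a binomial coefficient of p N over j, where p N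
  = j + l mod q'; in characteristic p it is 0 unless p divides j, and otherwise it is N over j/p,
  exactly the coefficient of the corresponding product at level m.\<close>

lemma rep_dl_angle:
  assumes j: "j \<le> q'"
  shows "rep (dl j * hi.angle l) (if CARD('p) dvd j \<and> CARD('p) dvd l
    then lo.tens 1 (dl (j div CARD('p)) * lo.angle (l div CARD('p))) else 0)" (is "rep _ ?c")
proof -
  let ?p = "CARD('p)" and ?b = "of_nat (j + l mod q' choose j) :: 'p mod_ring"
  have w: "dl j * hi.angle l \<in> hi.fa"
    using j hi.q_ge_1 by (intro free_algebra_closed(4) hi.dl_fa hi.angle_fa) linarith
  have "lo.cls (lo.frag_smult (const ?b) (angle_rep (j + l))) = lo.cls ?c"
  proof (cases "?p dvd j + l")
    case False
    then have c: "?c = 0" by auto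
    show ?thesis unfolding c using False by (simp add: angle_rep_def lo.frag_smult_simps)
  next
    case True
    have b: "const ?b = (if ?p dvd j then of_nat ((j + l mod q') div ?p choose (j div ?p)) else 0)"
    proof -
      have "?p dvd j + l mod q'"
        using True dvd_mod_card[of "j + l"] dvd_mod_card[of "j + l mod q'"] by (simp add: mod_add_right_eq)
      then have "j + l mod q' = ?p * ((j + l mod q') div ?p)" by simp
      then have "const ?b = of_nat (?p * ((j + l mod q') div ?p) choose j)" by (simp add: const_of_nat)
      then show ?thesis unfolding of_nat_choose_card_mult .
    qed
    show ?thesis
    proof (cases "?p dvd j")
      case False
      then have "const ?b = 0" using b by simp
      then show ?thesis using True False lo.tens_zero_left[OF lo.angle_fa] by (simp add: angle_rep_def)
    next
      case dj: True
      then have dl: "?p dvd l" using True by (simp add: dvd_add_right_iff)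
      let ?j = "j div ?p" and ?l = "l div ?p"
      have jq: "?j \<le> q" using div_le_mono[OF j, of ?p] by (simp add: q'_eq)
      have "(j + l mod q') div ?p = ?j + ?l mod q"
        using dj div_add[of ?p j "l mod q'"] dl dvd_mod_card[of l] div_mod_card[of l] by simp
      then have "const ?b = const (of_nat (?j + ?l mod q choose ?j))" using b dj by (simp add: const_of_nat)
      moreover have "(j + l) div ?p = ?j + ?l" using dj dl by (simp add: div_add)
      ultimately have "lo.frag_smult (const ?b) (angle_rep (j + l)) =
          lo.tens (const (of_nat (?j + ?l mod q choose ?j))) (lo.angle (?j + ?l))"
        using True by (simp add: angle_rep_def)
      also have "lo.cls \<dots> = lo.cls (lo.tens 1 (scalar (of_nat (?j + ?l mod q choose ?j)) * lo.angle (?j + ?l)))"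
        by (rule tens_scalar[OF lo.angle_fa])
      also have "lo.tens 1 (scalar (of_nat (?j + ?l mod q choose ?j)) * lo.angle (?j + ?l)) =
          lo.tens 1 (dl ?j * lo.angle ?l)"
        by (rule lo.tens_germ_cong[OF lo.germ_dl_angle_mult[OF jq, symmetric]])
      finally show ?thesis using dj dl by simp
    qed
  qed
  then show ?thesis
    by (rule rep_cong[OF rep_scalar[OF rep_angle] hi.germ_dl_angle_mult[OF j, symmetric] w])
qed

text \<open>Leibniz at level m + 1 gives terms indexed by i, and by the preceding lemma those with n
  - i not divisible by p have image zero. The surviving ones, n - i = p e, are the terms of
  \<open>pull_dd\<close>; if p does not divide l both sides are zero.\<close>

lemma rep_dl_basis:
  assumes n: "n \<le> q'" and f: "f \<in> x"
  shows "rep (dl n * (hi.fun_letter f * hi.angle l)) (lo.pull_dd n (lo.frag_smult f (angle_rep l)))"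
proof -
  let ?p = "CARD('p)" and ?l = "l div CARD('p)" and ?N = "n div CARD('p)"
  let ?e = "\<lambda>j. if ?p dvd j \<and> ?p dvd l then lo.tens 1 (dl (j div ?p) * lo.angle ?l) else 0"
  have n': "n \<le> ?p * q" using n by (simp add: q'_eq)
  have nfa: "dl (n - i) \<in> hi.fa" for i using n hi.q_ge_1 by (intro hi.dl_fa) linarith
  have "rep (\<Sum>i\<le>n. hi.fun_letter (dd i f) * (dl (n - i) * hi.angle l)) (\<Sum>i\<le>n. lo.frag_smult (dd i f) (?e (n - i)))"
    by (rule rep_sum, rule rep_fun_letter[OF dd_x[OF f] rep_dl_angle]) (use n in simp)
  moreover have "hi.germ (\<Sum>i\<le>n. hi.fun_letter (dd i f) * (dl (n - i) * hi.angle l)) =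
      hi.germ (dl n * (hi.fun_letter f * hi.angle l))"
  proof -
    have "hi.germ (dl n * hi.fun_letter f * hi.angle l) =
        hi.germ ((\<Sum>i\<le>n. hi.fun_letter (dd i f) * dl (n - i)) * hi.angle l)"
      by (rule hi.germ_cong_rmult[OF hi.germ_leibniz[OF n f]])
         (intro sum_free_algebra_closed free_algebra_closed(4) hi.fun_letter_fa dd_x f nfa hi.angle_fa)+
    then show ?thesis by (simp add: sum_distrib_right mult.assoc)
  qed
  moreover have "dl n * (hi.fun_letter f * hi.angle l) \<in> hi.fa"
    using nfa[of 0] by (intro free_algebra_closed(4) hi.fun_letter_fa f hi.angle_fa) simp
  moreover have "(\<Sum>i\<le>n. lo.frag_smult (dd i f) (?e (n - i))) = lo.pull_dd n (lo.frag_smult f (angle_rep l))"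
  proof (cases "?p dvd l")
    case False
    then show ?thesis by (simp add: angle_rep_def lo.frag_smult_simps lo.pull_dd_simps)
  next
    case True
    have "(\<Sum>i\<le>n. lo.frag_smult (dd i f) (?e (n - i))) = (\<Sum>j\<le>n. lo.frag_smult (dd (n - j) f) (?e j))"
      by (rule sum.reindex_bij_witness[of _ "\<lambda>j. n - j" "\<lambda>i. n - i"]) auto
    also have "\<dots> = (\<Sum>j\<le>n. if ?p dvd j then lo.tens (dd (n - ?p * (j div ?p)) f) (dl (j div ?p) * lo.angle ?l) else 0)"
      by (rule sum.cong) (simp_all add: True lo.frag_smult_simps)
    also have "\<dots> = (\<Sum>e\<le>?N. lo.tens (dd (n - ?p * e) f) (dl e * lo.angle ?l))"
      by (rule sum_multiples) simp
    also have "\<dots> = lo.pull_dd n (lo.frag_smult f (angle_rep l))"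
      using True by (simp add: angle_rep_def lo.pull_dd_tens[OF n' lo.angle_fa])
    finally show ?thesis .
  qed
  ultimately show ?thesis using rep_cong by simp
qed

text \<open>Additivity extends the previous lemma from generators to their combinations s. The image
  d found for s may differ from the given c by a balanced element, which \<open>pull_dd_cong\<close>
  permits.\<close>

lemma rep_dl:
  assumes n: "n \<le> q'" and w: "rep w c"
  shows "rep (dl n * w) (lo.pull_dd n c)"
proof -
  have n': "n \<le> CARD('p) * q" using n by (simp add: q'_eq)
  have nfa: "dl n \<in> hi.fa" using n hi.q_ge_1 by (intro hi.dl_fa) linarith
  obtain us where us: "fst ` set us \<subseteq> x" "hi.germ w = hi.germ (\<Sum>(f, l)\<leftarrow>us. hi.fun_letter f * hi.angle l)"
    using hi.in_span_all[OF rep_fa[OF w]] unfolding hi.in_span_def by blast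
  define s where "s = (\<Sum>(f, l)\<leftarrow>us. hi.fun_letter f * hi.angle l)"
  have "\<exists>d. rep s d \<and> rep (dl n * s) (lo.pull_dd n d)"
    unfolding s_def using us(1)
  proof (induction us)
    case Nil
    then show ?case using rep_0 by (auto simp: lo.pull_dd_simps)
  next
    case (Cons u us)
    obtain f l where u: "u = (f, l)" by (cases u)
    then have f: "f \<in> x" using Cons.prems by simp
    obtain d where d: "rep (\<Sum>(f, l)\<leftarrow>us. hi.fun_letter f * hi.angle l) d"
      "rep (dl n * (\<Sum>(f, l)\<leftarrow>us. hi.fun_letter f * hi.angle l)) (lo.pull_dd n d)"
      using Cons by auto
    show ?case
      using rep_add[OF rep_fun_letter[OF f rep_angle] d(1)] rep_add[OF rep_dl_basis[OF n f] d(2)]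
      by (intro exI[of _ "lo.frag_smult f (angle_rep l) + d"]) (simp add: u distrib_left lo.pull_dd_simps)
  qed
  then obtain d where d: "rep s d" "rep (dl n * s) (lo.pull_dd n d)" by blast
  have sw: "hi.germ s = hi.germ w" using us(2) by (simp add: s_def)
  have "lo.cls d = lo.cls c"
    by (rule rep_unique[OF rep_cong[OF d(1) sw rep_fa[OF w] refl] w])
  then show ?thesis
    by (intro rep_cong[OF d(2) hi.germ_cong_lmult[OF sw nfa rep_fa[OF d(1)]]] lo.pull_dd_cong n'
        free_algebra_closed(4) nfa rep_fa[OF w])
qed

text \<open>A derivative of 1 vanishes in positive order, so of the terms of \<open>pull_dd\<close>
  only p e = n can remain.\<close>

lemma rep_dl_tens:
  assumes n: "n \<le> q'" and a: "a \<in> lo.fa" and w: "rep w (lo.tens 1 a)"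
  shows "rep (dl n * w) (if CARD('p) dvd n then lo.tens 1 (dl (n div CARD('p)) * a) else 0)"
proof (rule rep_cong_right[OF rep_dl[OF n w]])
  let ?p = "CARD('p)" and ?N = "n div CARD('p)"
  have n': "n \<le> ?p * q" using n by (simp add: q'_eq)
  have le: "?p * e \<le> n" if "e \<le> ?N" for e
    using that by (simp add: less_eq_div_iff_mult_less_eq mult.commute)
  have "lo.cls (lo.pull_dd n (lo.tens 1 a)) = lo.cls (\<Sum>e\<le>?N. if n = ?p * e then lo.tens 1 (dl e * a) else 0)"
    unfolding lo.pull_dd_tens[OF n' a]
  proof (rule lo.cls_cong_sum)
    fix e assume e: "e \<in> {..?N}"
    then have "n - ?p * e = 0 \<longleftrightarrow> n = ?p * e" using le[of e] by auto
    moreover have "dl e * a \<in> lo.fa" using e by (intro free_algebra_closed(4) lo.dl_div_fa[OF n'] a) simp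
    ultimately show "lo.cls (lo.tens (dd (n - ?p * e) 1) (dl e * a)) =
        lo.cls (if n = ?p * e then lo.tens 1 (dl e * a) else 0)"
      using lo.tens_zero_left by (simp add: dd_one[OF lo.coord])
  qed
  also have "(\<Sum>e\<le>?N. if n = ?p * e then lo.tens 1 (dl e * a) else 0) =
      (\<Sum>e\<le>?N. if e = ?N then if ?p dvd n then lo.tens 1 (dl ?N * a) else 0 else 0)"
    by (rule sum.cong) auto
  finally show "lo.cls (lo.pull_dd n (lo.tens 1 a)) =
      lo.cls (if ?p dvd n then lo.tens 1 (dl ?N * a) else 0)" by simp
qed

text \<open>Above q' the operator factors as \<open>dl q'\<close> times \<open>dl s\<close> with s <
  q', and the previous lemma applies to each factor in turn. As p divides q', divisibility of n and
  of s agree, and the images recombine by the same splitting at level m.\<close>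

lemma rep_dl_tens':
  assumes n: "n \<le> 2 * q' - 1" and a: "a \<in> lo.fa" and w: "rep w (lo.tens 1 a)"
  shows "rep (dl n * w) (if CARD('p) dvd n then lo.tens 1 (dl (n div CARD('p)) * a) else 0)"
proof (cases "n \<le> q'")
  case True
  then show ?thesis by (rule rep_dl_tens[OF _ a w])
next
  case False
  let ?p = "CARD('p)"
  obtain s where ns: "n = q' + s" using False le_Suc_ex by (metis nle_le)
  have s: "s < q'" using n ns hi.q_ge_1 by linarith
  have nfa: "dl n \<in> hi.fa" by (rule hi.dl_fa[OF n])
  have germ: "hi.germ (dl q' * (dl s * w)) = hi.germ (dl n * w)"
    unfolding mult.assoc[symmetric] ns
    by (rule hi.germ_cong_rmult[OF hi.germ_dl_split[OF s, symmetric] _ rep_fa[OF w]]) (use nfa ns in simp)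
  have nw: "dl n * w \<in> hi.fa" by (rule free_algebra_closed(4)[OF nfa rep_fa[OF w]])
  have dn: "?p dvd n \<longleftrightarrow> ?p dvd s" unfolding ns q'_eq by (rule dvd_add_right_iff) simp
  note r = rep_dl_tens[OF less_imp_le[OF s] a w]
  show ?thesis
  proof (cases "?p dvd s")
    case False
    \<comment> \<open>Already \<open>dl s * w\<close> has image zero, and \<open>pull_dd\<close>
      sends zero to zero.\<close>
    then show ?thesis using rep_cong[OF rep_dl[OF order_refl r] germ nw refl] dn by (simp add: lo.pull_dd_simps)
  next
    case True
    have sq: "s div ?p < q" using s by (simp add: q'_eq less_mult_imp_div_less mult.commute)
    have sfa: "dl (s div ?p) \<in> lo.fa" using sq by (intro lo.dl_fa) linarith
    have rs: "rep (dl s * w) (lo.tens 1 (dl (s div ?p) * a))" using r True by simp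
    have nq: "n div ?p = q + s div ?p" using True by (simp add: ns q'_eq div_add)
    have "rep (dl q' * (dl s * w)) (lo.tens 1 (dl q * (dl (s div ?p) * a)))"
      using rep_dl_tens[OF order_refl free_algebra_closed(4)[OF sfa a] rs] by (simp add: q'_eq)
    moreover have "lo.tens 1 (dl q * (dl (s div ?p) * a)) = lo.tens 1 (dl (n div ?p) * a)"
      unfolding mult.assoc[symmetric] nq
      by (rule lo.tens_germ_cong[OF lo.germ_cong_rmult[OF lo.germ_dl_split[OF sq, symmetric] lo.dl_fa a]])
         (use sq in linarith)
    ultimately show ?thesis using rep_cong[OF _ germ nw refl] True dn by simp
  qed
qed

text \<open>
  An operator of level \<open>Suc m\<close> and one of level \<open>m\<close> correspond under the map as soon as they are
  related through \<open>p\<close>-th powers: their coefficients in the coordinate \<open>\<tau>\<close> then are as well.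
\<close>

lemma rep_letter:
  assumes D: "D \<in> stalk_diffops (2 * q' - 1) x" and D': "D' \<in> stalk_diffops (2 * q - 1) x"
    and DD': "\<And>h. D (h ^ CARD('p)) = D' h ^ CARD('p)"
    and a: "a \<in> lo.fa" and w: "rep w (lo.tens 1 a)"
  shows "rep (letter D * w) (lo.tens 1 (letter D' * a))"
proof -
  let ?p = "CARD('p)" and ?N = "2 * q' - 1" and ?M = "2 * q - 1"
  obtain c where c: "\<And>l. c l \<in> x" "\<And>g. D g = (\<Sum>l\<le>?N. c l * dd l g)"
    by (rule lo.diffop_expansion[OF D]) blast
  obtain d where d: "\<And>l. d l \<in> x" "\<And>g. D' g = (\<Sum>l\<le>?M. d l * dd l g)"
    by (rule lo.diffop_expansion[OF D']) blast
  have p0: "?p > 0" by simp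
  have "?N div ?p = ?M" unfolding lo.q_eq hi.q_eq by (rule card_mult_div(1))
  then have reindex: "(\<Sum>l\<le>?N. if ?p dvd l then F (l div ?p) else 0) = (\<Sum>l\<le>?M. F l)"
    for F :: "nat \<Rightarrow> 'b::comm_monoid_add"
    using sum_multiples[OF p0, of F ?N] by simp
  have fr: "sum f I ^ ?p = (\<Sum>i\<in>I. f i ^ ?p)" for f :: "nat \<Rightarrow> 'p ratfun" and I
    by (rule freshmans_dream_sum) (simp_all add: CHAR_ratfun prime_card)
  have dd_self: "dd l (\<tau> ^ i) = (if i < l then 0 else if i = l then 1 else dd l (\<tau> ^ i))" for i l
    by (simp add: dd_power_coord[OF lo.coord] binomial_eq_0)
  \<comment> \<open>Compare both expansions on the p-th power of \<tau>^i: terms with l > i vanish,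
    those with l < i agree by induction, and the term l = i is the bare coefficient.\<close>
  have coeff: "c (?p * l) = d l ^ ?p" if "l \<le> ?M" for l
    using that
  proof (induction l rule: less_induct)
    case (less i)
    have eq: "(\<Sum>l\<le>?M. c (?p * l) * dd l h ^ ?p) = (\<Sum>l\<le>?M. d l ^ ?p * dd l h ^ ?p)" for h
    proof -
      have "D (h ^ ?p) = (\<Sum>l\<le>?N. if ?p dvd l then c (?p * (l div ?p)) * dd (l div ?p) h ^ ?p else 0)"
        unfolding c(2) by (rule sum.cong) (simp_all add: dd_power_card[OF lo.coord])
      also have "\<dots> = (\<Sum>l\<le>?M. c (?p * l) * dd l h ^ ?p)" by (rule reindex)
      finally show ?thesis using DD'[of h] by (simp add: d(2) fr power_mult_distrib)
    qed
    have split: "(\<Sum>l\<le>?M. e l * dd l (\<tau> ^ i) ^ ?p) = (\<Sum>l<i. e l * dd l (\<tau> ^ i) ^ ?p) + e i" for e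
    proof -
      have "(\<Sum>l\<le>?M. e l * dd l (\<tau> ^ i) ^ ?p) = (\<Sum>l\<in>{..i}. e l * dd l (\<tau> ^ i) ^ ?p)"
      proof (rule sum.mono_neutral_right)
        show "\<forall>l\<in>{..?M} - {..i}. e l * dd l (\<tau> ^ i) ^ ?p = 0"
        proof
          fix l assume "l \<in> {..?M} - {..i}"
          then have "dd l (\<tau> ^ i) = 0" using dd_self[of l i] by auto
          then show "e l * dd l (\<tau> ^ i) ^ ?p = 0" using p0 by simp
        qed
      qed (use less.prems in auto)
      also have "{..i} = insert i {..<i}" by auto
      also have "(\<Sum>l\<in>insert i {..<i}. e l * dd l (\<tau> ^ i) ^ ?p) = (\<Sum>l<i. e l * dd l (\<tau> ^ i) ^ ?p) + e i"
        using dd_self[of i i] by simp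
      finally show ?thesis .
    qed
    have "(\<Sum>l<i. c (?p * l) * dd l (\<tau> ^ i) ^ ?p) = (\<Sum>l<i. d l ^ ?p * dd l (\<tau> ^ i) ^ ?p)"
      using less by (intro sum.cong) auto
    then show ?case using eq[of "\<tau> ^ i"] split[of "\<lambda>l. c (?p * l)"] split[of "\<lambda>l. d l ^ ?p"] by simp
  qed
  have wfa: "w \<in> hi.fa" by (rule rep_fa[OF w])
  have sfa: "(\<Sum>l\<le>?N. hi.fun_letter (c l) * dl l) \<in> hi.fa"
    by (intro sum_free_algebra_closed free_algebra_closed(4) hi.fun_letter_fa c hi.dl_fa) simp
  have dfa: "dl l \<in> lo.fa" if "l \<le> ?M" for l by (rule lo.dl_fa[OF that])
  have "rep (\<Sum>l\<le>?N. hi.fun_letter (c l) * (dl l * w))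
      (\<Sum>l\<le>?N. lo.frag_smult (c l) (if ?p dvd l then lo.tens 1 (dl (l div ?p) * a) else 0))"
    by (rule rep_sum, rule rep_fun_letter[OF c(1) rep_dl_tens'[OF _ a w]]) simp
  moreover have "hi.germ (\<Sum>l\<le>?N. hi.fun_letter (c l) * (dl l * w)) = hi.germ (letter D * w)"
    using hi.germ_cong_rmult[OF hi.germ_letter_expansion[OF c] sfa wfa]
    by (simp add: sum_distrib_right mult.assoc)
  moreover have "letter D * w \<in> hi.fa"
    by (rule free_algebra_closed(4)[OF hi.letter_fa[OF D order_refl] wfa])
  moreover have "lo.cls (\<Sum>l\<le>?N. lo.frag_smult (c l) (if ?p dvd l then lo.tens 1 (dl (l div ?p) * a) else 0)) =
      lo.cls (lo.tens 1 (letter D' * a))"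
  proof -
    have "(\<Sum>l\<le>?N. lo.frag_smult (c l) (if ?p dvd l then lo.tens 1 (dl (l div ?p) * a) else 0)) =
        (\<Sum>l\<le>?N. if ?p dvd l then lo.tens (c (?p * (l div ?p))) (dl (l div ?p) * a) else 0)"
      by (rule sum.cong) (simp_all add: lo.frag_smult_simps)
    also have "\<dots> = (\<Sum>l\<le>?M. lo.tens (c (?p * l)) (dl l * a))" by (rule reindex)
    also have "\<dots> = (\<Sum>l\<le>?M. lo.tens (1 * d l ^ ?p) (dl l * a))"
      by (rule sum.cong) (simp_all add: coeff)
    also have "lo.cls \<dots> = lo.cls (\<Sum>l\<le>?M. lo.tens 1 (lo.fun_letter (d l) * (dl l * a)))"
      by (intro lo.cls_cong_sum lo.tens_balanced point_1 lo.point d free_algebra_closed(4) dfa a) simp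
    also have "\<dots> = lo.cls (lo.tens 1 (\<Sum>l\<le>?M. lo.fun_letter (d l) * (dl l * a)))"
      by (intro lo.tens_sum_right[symmetric] point_1 lo.point free_algebra_closed(4) lo.fun_letter_fa d dfa a) simp
    also have "lo.tens 1 (\<Sum>l\<le>?M. lo.fun_letter (d l) * (dl l * a)) = lo.tens 1 (letter D' * a)"
    proof (rule lo.tens_germ_cong)
      have "lo.germ (letter D' * a) = lo.germ ((\<Sum>l\<le>?M. lo.fun_letter (d l) * dl l) * a)"
        by (rule lo.germ_cong_rmult[OF lo.germ_letter_expansion[OF d] _ a])
           (intro sum_free_algebra_closed free_algebra_closed(4) lo.fun_letter_fa d dfa, simp)
      then show "lo.germ (\<Sum>l\<le>?M. lo.fun_letter (d l) * (dl l * a)) = lo.germ (letter D' * a)"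
        by (simp add: sum_distrib_right mult.assoc)
    qed
    finally show ?thesis .
  qed
  ultimately show ?thesis by (rule rep_cong)
qed

lemma rep_1: "rep 1 (lo.tens 1 1)"
proof -
  have hi1: "hi.angle 0 = letter id" and lo1: "lo.angle 0 = letter id"
    using hi.q_ge_1 lo.q_ge_1 by (simp_all add: hi.angle_def lo.angle_def dd_order_0[OF lo.coord])
  have "hi.germ (hi.angle 0) = hi.germ 1" "lo.germ (lo.angle 0) = lo.germ 1"
    unfolding hi1 lo1 using hi.germ_fun_letter_1 lo.germ_fun_letter_1 by (simp_all add: id_def)
  then show ?thesis
    using rep_cong[OF rep_angle[of 0] _ free_algebra_closed(2)] lo.tens_germ_cong[of "lo.angle 0" 1 1]
    by (simp add: angle_rep_def)
qed

end

section \<open>The Kostant form contains the binomials in \<open>H\<close>\<close>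

text \<open>The falling factorial y (y - 1) ... (y - n + 1) in a possibly noncommutative ring, with
  the factors ordered as in \<open>binomial_H\<close>.\<close>

definition ffact_ring :: "'a::ring_1 \<Rightarrow> nat \<Rightarrow> 'a" where
  "ffact_ring y n = prod_list (map (\<lambda>i. y - of_nat i) [0..<n])"

lemma ffact_ring_0 [simp]: "ffact_ring y 0 = 1"
  by (simp add: ffact_ring_def)

lemma ffact_ring_Suc: "ffact_ring y (Suc n) = ffact_ring y n * (y - of_nat n)"
  by (simp add: ffact_ring_def)

lemma ffact_ring_commute: "ffact_ring y n * (y - of_nat k) = (y - of_nat k) * ffact_ring y n"
proof (induction n)
  case (Suc n)
  have "(y - of_nat n) * (y - of_nat k) = (y - of_nat k) * (y - of_nat n)"
    unfolding left_diff_distrib right_diff_distrib mult_of_nat_commute[of n y] mult_of_nat_commute[of k y]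
      mult_of_nat_commute[of n "of_nat k"] by (simp only: algebra_simps)
  then have "ffact_ring y (Suc n) * (y - of_nat k) = ffact_ring y n * (y - of_nat k) * (y - of_nat n)"
    by (simp only: ffact_ring_Suc mult.assoc)
  also have "\<dots> = (y - of_nat k) * ffact_ring y (Suc n)"
    by (simp only: Suc.IH) (simp only: ffact_ring_Suc mult.assoc)
  finally show ?case .
qed simp

lemma ffact_ring_Suc_shift: "ffact_ring (y + 1) (Suc n) = (y + 1) * ffact_ring y n"
proof (induction n)
  case 0
  then show ?case by (simp add: ffact_ring_Suc)
next
  case (Suc n)
  have "y + 1 - of_nat (Suc n) = y - of_nat n" by simp
  then have "ffact_ring (y + 1) (Suc (Suc n)) = ffact_ring (y + 1) (Suc n) * (y - of_nat n)"
    by (subst ffact_ring_Suc) (simp only:)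
  also have "\<dots> = (y + 1) * ffact_ring y (Suc n)"
    by (simp only: Suc.IH) (simp only: mult.assoc ffact_ring_Suc)
  finally show ?case .
qed

lemma of_nat_left_commute: "a * (of_nat c * b) = of_nat c * (a * b :: 'a::semiring_1)"
  unfolding mult.assoc[symmetric] mult_of_nat_commute[of c a] ..

lemma of_nat_mult_triple: "of_nat (c * d) * (a * b * g) = of_nat d * (a * (of_nat c * b) * (g :: 'a::semiring_1))"
  unfolding of_nat_left_commute[of a] mult.commute[of c d] of_nat_mult mult.assoc ..

section \<open>Commutation rules for an sl2-triple\<close>

context
  fixes e f h :: "'a::ring_1"
  assumes ef: "e * f = f * e + h" and he: "h * e = e * h + 2 * e" and hf: "h * f = f * h - 2 * f"
begin

lemma e_f_power: "e * f ^ k = f ^ k * e + of_nat k * f ^ (k - 1) * (h - of_nat k + 1)"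
proof (induction k)
  case (Suc k)
  \<comment> \<open>The bracket relation amounts to h f = f (h - 2), so moving f to the left lowers
    the argument by 2.\<close>
  have c: "(h - of_nat k + 1) * f = f * (h - of_nat (Suc k)) " 
  proof -
    have "(h - of_nat k + 1) * f = h * f - of_nat k * f + f" by (simp add: algebra_simps)
    also have "\<dots> = f * (h - of_nat (Suc k))"
      unfolding hf by (simp add: algebra_simps mult_of_nat_commute[of k f] mult_2)
    finally show ?thesis .
  qed
  have k: "of_nat k * f ^ (k - 1) * f = of_nat k * f ^ k"
    by (cases k) (simp_all add: mult.assoc power_commutes)
  have "e * f ^ Suc k = (e * f ^ k) * f" by (simp add: power_Suc2 mult.assoc del: power_Suc)
  also have "\<dots> = f ^ k * (e * f) + of_nat k * f ^ (k - 1) * ((h - of_nat k + 1) * f)"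
    by (simp add: Suc.IH distrib_right mult.assoc)
  also have "\<dots> = f ^ k * f * e + f ^ k * h + of_nat k * f ^ (k - 1) * f * (h - of_nat (Suc k))"
    unfolding c ef by (simp only: distrib_left mult.assoc)
  also have "\<dots> = f ^ Suc k * e + f ^ k * (h + of_nat k * (h - of_nat (Suc k)))"
    unfolding k by (simp only: power_Suc2 distrib_left of_nat_left_commute[of "f ^ k"] mult.assoc add.assoc)
  also have "h + of_nat k * (h - of_nat (Suc k)) = of_nat (Suc k) * (h - of_nat (Suc k) + 1)"
    by (simp add: algebra_simps)
  also have "f ^ k * (of_nat (Suc k) * (h - of_nat (Suc k) + 1)) = of_nat (Suc k) * f ^ k * (h - of_nat (Suc k) + 1)"
    by (simp only: of_nat_left_commute[of "f ^ k"] mult.assoc)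
  finally show ?case by simp
qed simp

text \<open>From e h = (h - 2) e, applied factor by factor.\<close>

lemma e_ffact: "e * ffact_ring (h - of_nat c) j = ffact_ring (h - of_nat (c + 2)) j * e"
proof (induction j)
  case (Suc j)
  have "e * (h - of_nat c - of_nat j) = (h - of_nat (c + 2) - of_nat j) * e"
    using he by (simp add: algebra_simps mult_of_nat_commute[of c e] mult_of_nat_commute[of j e] mult_2)
  note c = this
  have "e * ffact_ring (h - of_nat c) (Suc j) = e * ffact_ring (h - of_nat c) j * (h - of_nat c - of_nat j)"
    by (simp only: ffact_ring_Suc mult.assoc)
  also have "\<dots> = ffact_ring (h - of_nat (c + 2)) j * (e * (h - of_nat c - of_nat j))"
    by (simp only: Suc.IH mult.assoc)
  also have "\<dots> = ffact_ring (h - of_nat (c + 2)) (Suc j) * e"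
    by (simp only: c ffact_ring_Suc mult.assoc)
  finally show ?case .
qed simp

text \<open>Kostant's formula for divided powers has terms F^[n-j] binom(H - m - n + 2j, j) E^[m-j].
  It is multiplied here by m! n! to have integer coefficients; the product over i < j is n!/(n-j)!.
  The hypothesis m \<le> n prevents truncation in m + n - 2j.\<close>

lemma kostant_formula:
  assumes "m \<le> n"
  shows "e ^ m * f ^ n = (\<Sum>j\<le>m. of_nat ((m choose j) * (\<Prod>i<j. n - i)) *
    (f ^ (n - j) * ffact_ring (h - of_nat (m + n - 2 * j)) j * e ^ (m - j)))"
  using assms
proof (induction m)
  case 0
  then show ?case by simp
next
  case (Suc m)
  let ?N = "\<lambda>j. \<Prod>i<j. n - i"
  define T where "T j = of_nat ((m choose j) * ?N j) *
    (f ^ (n - j) * ffact_ring (h - of_nat (m + n - 2 * j)) j * e ^ (m - j))" for j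
  \<comment> \<open>Multiplying the j-th term by e gives \<open>A j\<close>, where e passes through
    and j stays, plus \<open>B j\<close>, where e is spent against one f and j rises. The new term
    of index j + 1 collects \<open>A (Suc j)\<close> and \<open>B j\<close>.\<close>
  define A where "A j = of_nat ((m choose j) * ?N j) *
    (f ^ (n - j) * ffact_ring (h - of_nat (m + n - 2 * j + 2)) j * e ^ (Suc m - j))" for j
  define B where "B j = of_nat ((m choose j) * ?N (Suc j)) *
    (f ^ (n - Suc j) * ((h - of_nat (n - j) + 1) * ffact_ring (h - of_nat (m + n - 2 * j)) j) * e ^ (m - j))" for j
  have T: "e * T j = A j + B j" if j: "j \<le> m" for j
  proof -
    let ?X = "ffact_ring (h - of_nat (m + n - 2 * j)) j"
    have "e * T j = of_nat ((m choose j) * ?N j) * ((e * f ^ (n - j)) * ?X * e ^ (m - j))"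
      unfolding T_def of_nat_left_commute[of e] mult.assoc ..
    also have "(e * f ^ (n - j)) * ?X * e ^ (m - j) =
        f ^ (n - j) * (e * ?X) * e ^ (m - j) +
        of_nat (n - j) * (f ^ (n - Suc j) * ((h - of_nat (n - j) + 1) * ?X) * e ^ (m - j))"
      unfolding e_f_power by (simp add: distrib_right mult.assoc)
    also have "f ^ (n - j) * (e * ?X) * e ^ (m - j) =
        f ^ (n - j) * ffact_ring (h - of_nat (m + n - 2 * j + 2)) j * e ^ (Suc m - j)"
      unfolding e_ffact using j by (simp add: Suc_diff_le mult.assoc)
    finally have "e * T j = A j + of_nat ((m choose j) * ?N j) *
        (of_nat (n - j) * (f ^ (n - Suc j) * ((h - of_nat (n - j) + 1) * ?X) * e ^ (m - j)))"
      by (simp only: A_def distrib_left)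
    also have "of_nat ((m choose j) * ?N j) *
        (of_nat (n - j) * (f ^ (n - Suc j) * ((h - of_nat (n - j) + 1) * ?X) * e ^ (m - j))) = B j"
      by (simp add: B_def mult.assoc)
    finally show ?thesis .
  qed
  have "e ^ Suc m * f ^ n = e * (\<Sum>j\<le>m. T j)"
    using Suc unfolding T_def by (simp add: mult.assoc)
  also have "\<dots> = (\<Sum>j\<le>m. A j) + (\<Sum>j\<le>m. B j)"
    by (simp add: sum_distrib_left T sum.distrib)
  also have "(\<Sum>j\<le>m. A j) = (\<Sum>j\<le>Suc m. A j)" by (simp add: A_def binomial_eq_0)
  also have "\<dots> = A 0 + (\<Sum>j\<le>m. A (Suc j))" by (rule sum.atMost_Suc_shift)
  also have "A 0 + (\<Sum>j\<le>m. A (Suc j)) + (\<Sum>j\<le>m. B j) = A 0 + (\<Sum>j\<le>m. A (Suc j) + B j)"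
    by (simp add: sum.distrib add.assoc)
  also have "\<dots> = (\<Sum>j\<le>Suc m. of_nat ((Suc m choose j) * ?N j) *
    (f ^ (n - j) * ffact_ring (h - of_nat (Suc m + n - 2 * j)) j * e ^ (Suc m - j)))" (is "_ = sum ?C _")
  proof -
    have "A (Suc j) + B j = ?C (Suc j)" if j: "j \<le> m" for j
    proof -
      define y where "y = h - of_nat (m + n - 2 * j)"
      let ?X = "ffact_ring y j"
      have jn: "2 * j \<le> m + n" "j \<le> n" "j < n" using j Suc.prems by auto
      have s1: "h - of_nat (m + n - 2 * Suc j + 2) = y"
        if "2 * Suc j \<le> m + n" using that by (simp add: y_def)
      have A: "A (Suc j) = of_nat (?N (Suc j)) * (f ^ (n - Suc j) * (of_nat (m choose Suc j) * ((y - of_nat j) * ?X)) * e ^ (m - j))"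
      \<comment> \<open>For j = m the subtraction m + n - 2 Suc j may truncate, but there the
        binomial coefficient is zero.\<close>
      proof (cases "j = m")
        case True
        then show ?thesis by (simp add: A_def binomial_eq_0 del: prod.lessThan_Suc)
      next
        case False
        then have le: "2 * Suc j \<le> m + n" using j Suc.prems by auto
        show ?thesis
          unfolding A_def s1[OF le] ffact_ring_Suc ffact_ring_commute diff_Suc_Suc
          by (rule of_nat_mult_triple)
      qed
      have B: "B j = of_nat (?N (Suc j)) * (f ^ (n - Suc j) * (of_nat (m choose j) * ((h - of_nat (n - j) + 1) * ?X)) * e ^ (m - j))"
        unfolding B_def y_def[symmetric] by (rule of_nat_mult_triple)
      have "y + 1 = h - of_nat (Suc m + n - 2 * Suc j)"
      proof -
        have "m + n - 2 * j = Suc (Suc m + n - 2 * Suc j)" using jn Suc.prems j by auto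
        then show ?thesis by (simp add: y_def)
      qed
      then have C: "?C (Suc j) = of_nat (?N (Suc j)) * (f ^ (n - Suc j) * (of_nat (Suc m choose Suc j) * ((y + 1) * ?X)) * e ^ (m - j))"
        unfolding ffact_ring_Suc_shift[symmetric] diff_Suc_Suc
        by (simp only: of_nat_mult_triple)
      \<comment> \<open>With the second factor written as y + 1 + (m - j), Pascal's rule yields the
        right side plus a remainder, which cancels by the absorption identity for binomial
        coefficients.\<close>
      have "of_nat (m choose Suc j) * (y - of_nat j) + of_nat (m choose j) * (h - of_nat (n - j) + 1) =
          of_nat (Suc m choose Suc j) * (y + 1)"
      proof -
        have hy: "h - of_nat (n - j) + 1 = y + 1 + of_nat (m - j)"
        proof -
          have "m + n - 2 * j = (n - j) + (m - j)" using j jn by auto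
          then show ?thesis by (simp add: y_def)
        qed
        have "(m choose Suc j) * Suc j = (m choose j) * (m - j)"
          using binomial_absorb_comp[of m j] binomial_absorption[of j m] by (simp add: mult.commute)
        then have "of_nat (m choose Suc j) * of_nat (Suc j) = (of_nat (m choose j) * of_nat (m - j) :: 'a)"
          by (metis of_nat_mult)
        then show ?thesis unfolding hy by (simp add: algebra_simps)
      qed
      then have "of_nat (m choose Suc j) * ((y - of_nat j) * ?X) + of_nat (m choose j) * ((h - of_nat (n - j) + 1) * ?X) =
          of_nat (Suc m choose Suc j) * ((y + 1) * ?X)"
        unfolding mult.assoc[symmetric] distrib_right[symmetric] by simp
      then show ?thesis unfolding A B C by (simp only: distrib_left[symmetric] distrib_right[symmetric])
    qed
    moreover have "A 0 = ?C 0" by (simp add: A_def)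
    ultimately show ?thesis unfolding sum.atMost_Suc_shift by simp
  qed
  finally show ?case .
qed

end

text \<open>In Kostant's formula for E^[n] F^[n] the term j = n is the binomial of h over n itself.
  The other terms contain binomials of lower degree in shifted arguments, which belong to the
  subring K by induction. The map s plays the role of the central embedding of the
  rationals.\<close>

lemma binomials_generated:
  fixes e f h :: "'a::ring_1" and s :: "rat \<Rightarrow> 'a"
  assumes ef: "e * f = f * e + h" and he: "h * e = e * h + 2 * e" and hf: "h * f = f * h - 2 * f"
    and s: "s 1 = 1" "\<And>a b. s (a + b) = s a + s b" "\<And>a b. s (a * b) = s a * s b" "\<And>a y. s a * y = y * s a"
    and K: "1 \<in> K" "\<And>a b. a \<in> K \<Longrightarrow> b \<in> K \<Longrightarrow> a + b \<in> K" "\<And>a b. a \<in> K \<Longrightarrow> b \<in> K \<Longrightarrow> a * b \<in> K"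
      "\<And>a. a \<in> K \<Longrightarrow> - a \<in> K"
    and E: "\<And>n. s (1 / fact n) * e ^ n \<in> K" and F: "\<And>n. s (1 / fact n) * f ^ n \<in> K"
  shows "s (1 / fact n) * ffact_ring h n \<in> K"
proof (induction n rule: less_induct)
  case (less n)
  define bin where "bin y j = s (1 / fact j) * ffact_ring y j" for y j
  have s0: "s 0 = 0" using s(2)[of 0 0] by simp
  have sn: "s (of_nat k) = of_nat k" for k by (induction k) (simp_all add: s s0)
  have s_left: "y * (s a * z) = s a * (y * z)" for a y z
    unfolding mult.assoc[symmetric] s(4)[of a y] ..
  have s_triple: "(s a * u) * (s b * v) * (s c * w) = s a * s b * s c * (u * v * w)" for a b c u v w
    by (simp only: mult.assoc s_left[of u] s_left[of v])
  have K0: "0 \<in> K" using K(2)[OF K(1) K(4)[OF K(1)]] by simp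
  have Ksum: "(\<And>i. i \<in> I \<Longrightarrow> g i \<in> K) \<Longrightarrow> sum g I \<in> K" for g and I :: "nat set"
    by (induction I rule: infinite_finite_induct) (auto simp: K0 intro: K)
  \<comment> \<open>Pascal's rule bin (y + 1) (j + 1) = bin y (j + 1) + bin y j, solved for bin y (j
    + 1), lowers the argument by 1; the outer induction is on the shift c, the inner one on
    j.\<close>
  have shift: "bin (h - of_nat c) j \<in> K" if "j < n" for c j
    using that
  proof (induction c arbitrary: j)
    case 0
    then show ?case using less.IH by (simp add: bin_def)
  next
    case step: (Suc c)
    note step = step.IH
    show ?case using \<open>j < n\<close>
    proof (induction j)
      case 0
      then show ?case by (simp add: bin_def s K)
    next
      case (Suc j)
      let ?y = "h - of_nat (Suc c)"
      have y: "?y + 1 = h - of_nat c" by simp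
      have "ffact_ring (?y + 1) (Suc j) - ffact_ring ?y (Suc j) = of_nat (Suc j) * ffact_ring ?y j"
        unfolding ffact_ring_Suc_shift ffact_ring_Suc[of ?y] ffact_ring_commute
        by (simp add: algebra_simps)
      then have r1: "ffact_ring ?y (Suc j) = ffact_ring (h - of_nat c) (Suc j) - of_nat (Suc j) * ffact_ring ?y j"
        unfolding y by (simp add: algebra_simps)
      have r2: "s (1 / fact (Suc j)) * of_nat (Suc j) = s (1 / fact j)"
        unfolding sn[symmetric] s(3)[symmetric] by (rule arg_cong[of _ _ s]) (simp add: fact_Suc del: of_nat_Suc)
      have "bin ?y (Suc j) = bin (h - of_nat c) (Suc j) + - (s (1 / fact (Suc j)) * of_nat (Suc j) * ffact_ring ?y j)"
        unfolding bin_def r1 right_diff_distrib mult.assoc by (rule diff_conv_add_uminus)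
      then have "bin ?y (Suc j) = bin (h - of_nat c) (Suc j) + - bin ?y j"
        unfolding r2 by (simp only: bin_def)
      then show ?case using K(2)[OF step[OF Suc.prems] K(4)[OF Suc.IH[OF Suc_lessD[OF Suc.prems]]]] by simp
    qed
  qed
  have N: "(\<Prod>i<j. n - i) * fact (n - j) = fact n" if "j \<le> n" for j
    using that
  proof (induction j)
    case (Suc j)
    then have "fact (n - j) = (n - j) * fact (n - Suc j)" by (simp add: Suc_diff_Suc[symmetric])
    then show ?case using Suc by (simp add: mult.assoc)
  qed simp
  \<comment> \<open>This undoes the clearing of denominators in \<open>kostant_formula\<close>: the
    factorials are redistributed as one for each of the three factors of a term.\<close>
  have coef: "s (1 / fact n) * s (1 / fact n) * of_nat ((n choose j) * (\<Prod>i<j. n - i)) =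
      s (1 / fact (n - j)) * s (1 / fact j) * s (1 / fact (n - j))" if "j \<le> n" for j
  proof -
    have "of_nat ((n choose j) * (\<Prod>i<j. n - i)) * fact (n - j) * fact (n - j) * fact j = (fact n * fact n :: rat)"
    proof -
      have "((n choose j) * (\<Prod>i<j. n - i)) * fact (n - j) * fact (n - j) * fact j =
          (fact j * fact (n - j) * (n choose j)) * ((\<Prod>i<j. n - i) * fact (n - j))" by (simp add: mult_ac)
      also have "\<dots> = fact n * fact n" using binomial_fact_lemma[OF that] N[OF that] by simp
      finally show ?thesis by (metis of_nat_fact of_nat_mult)
    qed
    then have "1 / fact n * (1 / fact n) * of_nat ((n choose j) * (\<Prod>i<j. n - i)) =
        (1 / fact (n - j) * (1 / fact j) * (1 / fact (n - j)) :: rat)"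
      by (simp add: field_simps)
    then show ?thesis unfolding sn[symmetric] s(3)[symmetric] by (rule arg_cong)
  qed
  let ?t = "\<lambda>j. (s (1 / fact (n - j)) * f ^ (n - j)) * bin (h - of_nat (2 * (n - j))) j * (s (1 / fact (n - j)) * e ^ (n - j))"
  have "(s (1 / fact n) * e ^ n) * (s (1 / fact n) * f ^ n) = s (1 / fact n) * s (1 / fact n) * (e ^ n * f ^ n)"
    by (simp only: mult.assoc s_left[of "e ^ n"])
  also have "\<dots> = (\<Sum>j\<le>n. s (1 / fact n) * s (1 / fact n) * of_nat ((n choose j) * (\<Prod>i<j. n - i)) *
      (f ^ (n - j) * ffact_ring (h - of_nat (n + n - 2 * j)) j * e ^ (n - j)))"
    unfolding kostant_formula[OF ef he hf order_refl] sum_distrib_left by (simp only: mult.assoc)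
  also have "\<dots> = (\<Sum>j\<le>n. ?t j)"
  proof (rule sum.cong[OF refl])
    fix j assume "j \<in> {..n}"
    then have j: "j \<le> n" by simp
    have "n + n - 2 * j = 2 * (n - j)" by simp
    then show "s (1 / fact n) * s (1 / fact n) * of_nat ((n choose j) * (\<Prod>i<j. n - i)) *
      (f ^ (n - j) * ffact_ring (h - of_nat (n + n - 2 * j)) j * e ^ (n - j)) = ?t j"
      unfolding coef[OF j] bin_def s_triple by (simp only:)
  qed
  also have "{..n} = insert n {..<n}" by auto
  also have "(\<Sum>j\<in>insert n {..<n}. ?t j) = bin h n + (\<Sum>j<n. ?t j)" by (simp add: s)
  finally have fin: "bin h n = (s (1 / fact n) * e ^ n) * (s (1 / fact n) * f ^ n) + - (\<Sum>j<n. ?t j)"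
    by simp
  have "(\<Sum>j<n. ?t j) \<in> K"
    by (intro Ksum K(3) E F shift) simp
  then have "bin h n \<in> K"
    unfolding fin by (rule K(2)[OF K(3)[OF E F] K(4)])
  then show ?case by (simp add: bin_def)
qed

section \<open>The enveloping algebra of sl2\<close>

lemma carrier_free_algebra_UNIV [simp]: "carrier (free_algebra UNIV) = UNIV"
  by (auto simp: mem_free_algebra)

text \<open>The empty word factors only into empty words, so the constant coefficient is
  multiplicative.\<close>

lemma lookup_mult_word_0:
  fixes a b :: "'g word \<Rightarrow>\<^sub>0 'r::comm_ring_1"
  shows "Poly_Mapping.lookup (a * b) 0 = Poly_Mapping.lookup a 0 * Poly_Mapping.lookup b 0"
proof -
  have z: "u + v = 0 \<longleftrightarrow> u = 0 \<and> v = 0" for u v :: "'g word"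
    by (cases u; cases v) (simp add: zero_word_def)
  have s: "(\<Sum>w\<in>Poly_Mapping.keys c. if w = 0 then Poly_Mapping.lookup c w else 0) = Poly_Mapping.lookup c 0"
    for c :: "'g word \<Rightarrow>\<^sub>0 'r"
    by (simp add: sum.delta in_keys_iff)
  have "a * b = (\<Sum>u\<in>Poly_Mapping.keys a. \<Sum>v\<in>Poly_Mapping.keys b.
      Poly_Mapping.single (u + v) (Poly_Mapping.lookup a u * Poly_Mapping.lookup b v))"
    by (subst (1) sum_single_lookup[of a, symmetric], subst (1) sum_single_lookup[of b, symmetric])
       (simp add: sum_product mult_single)
  then have "Poly_Mapping.lookup (a * b) 0 = (\<Sum>u\<in>Poly_Mapping.keys a. \<Sum>v\<in>Poly_Mapping.keys b.
      (if u = 0 then Poly_Mapping.lookup a u else 0) * (if v = 0 then Poly_Mapping.lookup b v else 0))"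
    by (auto simp: lookup_sum lookup_single when_def z intro!: sum.cong)
  also have "\<dots> = Poly_Mapping.lookup a 0 * Poly_Mapping.lookup b 0"
    by (simp add: sum_product[symmetric] s)
  finally show ?thesis .
qed

lemma ideal_sl2_ideal: "ideal sl2_ideal (free_algebra UNIV)"
  unfolding sl2_ideal_def by (rule ring.genideal_ideal[OF ring_free_algebra]) simp

lemma sl2_ideal_closed:
  "0 \<in> sl2_ideal" "a \<in> sl2_ideal \<Longrightarrow> b \<in> sl2_ideal \<Longrightarrow> a + b \<in> sl2_ideal"
  "a \<in> sl2_ideal \<Longrightarrow> c * a \<in> sl2_ideal" "a \<in> sl2_ideal \<Longrightarrow> a * c \<in> sl2_ideal" "a \<in> sl2_ideal \<Longrightarrow> - a \<in> sl2_ideal"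
proof -
  interpret ideal sl2_ideal "free_algebra UNIV" by (rule ideal_sl2_ideal)
  show "0 \<in> sl2_ideal" using additive_subgroup.zero_closed[OF additive_subgroup_axioms] by simp
  show "a \<in> sl2_ideal \<Longrightarrow> b \<in> sl2_ideal \<Longrightarrow> a + b \<in> sl2_ideal"
    using additive_subgroup.a_closed[OF additive_subgroup_axioms, of a b] by simp
  show l: "a \<in> sl2_ideal \<Longrightarrow> c * a \<in> sl2_ideal" for a c using I_l_closed[of a c] by simp
  show "a \<in> sl2_ideal \<Longrightarrow> a * c \<in> sl2_ideal" using I_r_closed[of a c] by simp
  show "a \<in> sl2_ideal \<Longrightarrow> - a \<in> sl2_ideal" using l[of a "- 1"] by simp
qed

text \<open>The kernel of the constant coefficient is an ideal containing the three relations. Hence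
  1 is not in \<open>sl2_ideal\<close>, and the quotient satisfies 0 \<noteq> 1 as the class
  \<open>ring_1\<close> demands.\<close>

lemma sl2_ideal_augmentation: "a \<in> sl2_ideal \<Longrightarrow> Poly_Mapping.lookup a 0 = 0"
proof -
  let ?J = "{a :: sl2 word \<Rightarrow>\<^sub>0 rat. Poly_Mapping.lookup a 0 = 0}"
  have "ideal ?J (free_algebra UNIV)"
  proof (rule idealI)
    show "subgroup ?J (add_monoid (free_algebra UNIV))"
    proof (rule subgroup.intro)
      fix a assume "a \<in> ?J"
      moreover have "inv\<^bsub>add_monoid (free_algebra UNIV)\<^esub> a = - a"
        using free_algebra_a_inv[of a UNIV] by (simp add: a_inv_def)
      ultimately show "inv\<^bsub>add_monoid (free_algebra UNIV)\<^esub> a \<in> ?J" by simp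
    qed (simp_all add: lookup_add)
  qed (simp_all add: ring_free_algebra lookup_mult_word_0)
  moreover have l: "Poly_Mapping.lookup (letter g) 0 = (0 :: rat)" for g :: sl2
    by (simp add: letter_def lookup_single when_def zero_word_def)
  have "{letter sl2_E * letter sl2_F - letter sl2_F * letter sl2_E - letter sl2_H,
      letter sl2_H * letter sl2_E - letter sl2_E * letter sl2_H - 2 * letter sl2_E,
      letter sl2_H * letter sl2_F - letter sl2_F * letter sl2_H + 2 * letter sl2_F} \<subseteq> ?J"
    by (simp add: lookup_minus lookup_add lookup_mult_word_0 l)
  ultimately have "sl2_ideal \<subseteq> ?J"
    unfolding sl2_ideal_def by (intro ring.genideal_minimal[OF ring_free_algebra])
  then show "a \<in> sl2_ideal \<Longrightarrow> Poly_Mapping.lookup a 0 = 0" by blast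
qed

definition sl2_cong :: "(sl2 word \<Rightarrow>\<^sub>0 rat) \<Rightarrow> (sl2 word \<Rightarrow>\<^sub>0 rat) \<Rightarrow> bool" where
  "sl2_cong a b \<longleftrightarrow> a - b \<in> sl2_ideal"

lemma sl2_cong_refl: "sl2_cong a a"
  by (simp add: sl2_cong_def sl2_ideal_closed)

text \<open>The enveloping algebra as a type, so that computations in it can use the ring classes.\<close>

quotient_type sl2_alg = "sl2 word \<Rightarrow>\<^sub>0 rat" / sl2_cong
proof (rule equivpI)
  show "reflp sl2_cong" by (rule reflpI) (rule sl2_cong_refl)
  show "symp sl2_cong"
  proof (rule sympI)
    show "sl2_cong b a" if "sl2_cong a b" for a b
      using sl2_ideal_closed(5)[of "a - b"] that by (simp add: sl2_cong_def)
  qed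
  show "transp sl2_cong"
  proof (rule transpI)
    show "sl2_cong a c" if "sl2_cong a b" "sl2_cong b c" for a b c
      using sl2_ideal_closed(2)[of "a - b" "b - c"] that by (simp add: sl2_cong_def)
  qed
qed

instantiation sl2_alg :: ring_1
begin

lift_definition zero_sl2_alg :: sl2_alg is 0 .
lift_definition one_sl2_alg :: sl2_alg is 1 .

lift_definition plus_sl2_alg :: "sl2_alg \<Rightarrow> sl2_alg \<Rightarrow> sl2_alg" is "(+)"
proof -
  fix a b c d :: "sl2 word \<Rightarrow>\<^sub>0 rat"
  assume "sl2_cong a b" "sl2_cong c d"
  then show "sl2_cong (a + c) (b + d)"
    using sl2_ideal_closed(2)[of "a - b" "c - d"] by (simp add: sl2_cong_def algebra_simps)
qed

lift_definition minus_sl2_alg :: "sl2_alg \<Rightarrow> sl2_alg \<Rightarrow> sl2_alg" is "(-)"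
proof -
  fix a b c d :: "sl2 word \<Rightarrow>\<^sub>0 rat"
  assume "sl2_cong a b" "sl2_cong c d"
  then show "sl2_cong (a - c) (b - d)"
    using sl2_ideal_closed(2)[OF _ sl2_ideal_closed(5), of "a - b" "c - d"] by (simp add: sl2_cong_def algebra_simps)
qed

lift_definition uminus_sl2_alg :: "sl2_alg \<Rightarrow> sl2_alg" is uminus
proof -
  fix a b :: "sl2 word \<Rightarrow>\<^sub>0 rat"
  assume "sl2_cong a b"
  then show "sl2_cong (- a) (- b)"
    using sl2_ideal_closed(5)[of "a - b"] by (simp add: sl2_cong_def)
qed

lift_definition times_sl2_alg :: "sl2_alg \<Rightarrow> sl2_alg \<Rightarrow> sl2_alg" is "(*)"
proof -
  fix a b c d :: "sl2 word \<Rightarrow>\<^sub>0 rat"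
  assume "sl2_cong a b" "sl2_cong c d"
  then have "(a - b) * c + b * (c - d) \<in> sl2_ideal"
    by (intro sl2_ideal_closed(2-4)) (simp_all add: sl2_cong_def)
  then show "sl2_cong (a * c) (b * d)" by (simp add: sl2_cong_def algebra_simps)
qed

instance
proof
  have "\<not> sl2_cong 0 1"
    using sl2_ideal_augmentation[of "0 - 1"] by (auto simp: sl2_cong_def lookup_minus lookup_one)
  then show "(0 :: sl2_alg) \<noteq> 1" by transfer
qed (transfer; simp add: sl2_cong_refl algebra_simps)+

end

abbreviation "sl2_class \<equiv> abs_sl2_alg"

lemma sl2_class_simps:
  "sl2_class (a + b) = sl2_class a + sl2_class b" "sl2_class (a * b) = sl2_class a * sl2_class b"
  "sl2_class (a - b) = sl2_class a - sl2_class b" "sl2_class (- a) = - sl2_class a" "sl2_class 1 = 1"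
  by (simp_all add: plus_sl2_alg.abs_eq times_sl2_alg.abs_eq minus_sl2_alg.abs_eq uminus_sl2_alg.abs_eq one_sl2_alg.abs_eq)

lemma sl2_class_power: "sl2_class (a ^ n) = sl2_class a ^ n"
  by (induction n) (simp_all add: sl2_class_simps)

lemma sl2_class_of_nat: "sl2_class (of_nat n) = of_nat n"
  by (induction n) (simp_all add: sl2_class_simps zero_sl2_alg.abs_eq)

lemma sl2_class_ffact:
  "sl2_class (prod_list (map (\<lambda>i. a - of_nat i) [0..<n])) = ffact_ring (sl2_class a) n"
  by (induction n) (simp_all add: sl2_class_simps ffact_ring_Suc sl2_class_of_nat)

text \<open>The bridge over which identities computed in the type \<open>sl2_alg\<close> pass to the
  coset ring \<open>sl2_envelope\<close>.\<close>

lemma envelope_class_eq: "envelope_class a = envelope_class b \<longleftrightarrow> sl2_class a = sl2_class b"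
proof -
  have mem: "c \<in> envelope_class a \<longleftrightarrow> c - a \<in> sl2_ideal" for a c
    by (auto simp: envelope_class_def a_r_coset_def r_coset_def) (metis diff_add_cancel)
  have "envelope_class a = envelope_class b \<longleftrightarrow> sl2_cong a b"
  proof
    assume "envelope_class a = envelope_class b"
    then show "sl2_cong a b" using mem[of a a] by (simp add: sl2_cong_def mem sl2_ideal_closed)
  next
    assume ab: "sl2_cong a b"
    show "envelope_class a = envelope_class b"
    proof (rule Set.set_eqI)
      fix c
      show "c \<in> envelope_class a \<longleftrightarrow> c \<in> envelope_class b"
        using sl2_ideal_closed(2)[of "c - a" "a - b"] sl2_ideal_closed(2)[of "c - b" "- (a - b)"]
          sl2_ideal_closed(5)[of "a - b"] ab by (auto simp: mem sl2_cong_def)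
    qed
  qed
  then show ?thesis by (simp add: sl2_alg.abs_eq_iff)
qed

lemma ring_sl2_envelope: "ring sl2_envelope"
  unfolding sl2_envelope_def by (rule ideal.quotient_is_ring[OF ideal_sl2_ideal])

lemma envelope_class_hom: "envelope_class \<in> Ring.ring_hom (free_algebra UNIV) sl2_envelope"
  using ideal.rcos_ring_hom[OF ideal_sl2_ideal]
  unfolding sl2_envelope_def envelope_class_def[abs_def] by simp

lemma envelope_class_simps:
  "envelope_class a \<in> carrier sl2_envelope" "envelope_class 1 = \<one>\<^bsub>sl2_envelope\<^esub>"
  "envelope_class (a + b) = envelope_class a \<oplus>\<^bsub>sl2_envelope\<^esub> envelope_class b"
  "envelope_class (a * b) = envelope_class a \<otimes>\<^bsub>sl2_envelope\<^esub> envelope_class b"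
  using ring_hom_closed[OF envelope_class_hom, of a] ring_hom_one[OF envelope_class_hom]
    ring_hom_add[OF envelope_class_hom, of a b] ring_hom_mult[OF envelope_class_hom, of a b] by simp_all

lemma envelope_class_uminus: "envelope_class (- a) = \<ominus>\<^bsub>sl2_envelope\<^esub> envelope_class a"
proof -
  interpret E: ring sl2_envelope by (rule ring_sl2_envelope)
  have "envelope_class (- a) \<oplus>\<^bsub>sl2_envelope\<^esub> envelope_class a = envelope_class 0"
    by (simp add: envelope_class_simps(3)[symmetric])
  moreover have "envelope_class 0 = \<zero>\<^bsub>sl2_envelope\<^esub>"
    using envelope_class_simps(3)[of 0 0] envelope_class_simps(1)[of 0]
    by (metis E.add.l_cancel_one' add_0)
  ultimately have "\<ominus>\<^bsub>sl2_envelope\<^esub> envelope_class a = envelope_class (- a)"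
    using E.minus_equality[of "envelope_class (- a)" "envelope_class a"] envelope_class_simps(1) by simp
  then show ?thesis ..
qed

section \<open>The Kostant form\<close>

definition kostant_gens :: "envelope set" where
  "kostant_gens = range (divided_power sl2_E) \<union> range (divided_power sl2_F)"

lemma carrier_kostant_form: "carrier kostant_form = generate_ring sl2_envelope kostant_gens"
  by (simp add: kostant_form_def kostant_gens_def)

lemma kostant_form_simps [simp]:
  "monoid.mult kostant_form = monoid.mult sl2_envelope" "monoid.one kostant_form = monoid.one sl2_envelope"
  "ring.zero kostant_form = ring.zero sl2_envelope" "ring.add kostant_form = ring.add sl2_envelope"
  by (simp_all add: kostant_form_def)

lemma ring_kostant_form: "ring kostant_form"
  unfolding kostant_form_def
  by (rule ring.generate_ring_is_ring[OF ring_sl2_envelope])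
     (auto simp: divided_power_def envelope_class_simps(1))

lemma divided_power_kostant:
  "divided_power sl2_E n \<in> carrier kostant_form" "divided_power sl2_F n \<in> carrier kostant_form"
  unfolding carrier_kostant_form kostant_gens_def by (auto intro!: generate_ring.incl)

lemma binomial_H_kostant: "binomial_H n \<in> carrier kostant_form"
proof -
  \<comment> \<open>\<open>?K\<close> is the Kostant form seen inside the type
    \<open>sl2_alg\<close>; by \<open>envelope_class_eq\<close> membership does not depend on the
    representative.\<close>
  let ?K = "{z. \<exists>a. z = sl2_class a \<and> envelope_class a \<in> carrier kostant_form}"
  let ?s = "\<lambda>r. sl2_class (scalar r)"
  have rel: "sl2_class a = sl2_class b" if "a - b \<in> sl2_ideal" for a b
    using that by (simp add: sl2_alg.abs_eq_iff sl2_cong_def)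
  have gen: "r \<in> sl2_ideal" if "r \<in> {letter sl2_E * letter sl2_F - letter sl2_F * letter sl2_E - letter sl2_H,
      letter sl2_H * letter sl2_E - letter sl2_E * letter sl2_H - 2 * letter sl2_E,
      letter sl2_H * letter sl2_F - letter sl2_F * letter sl2_H + 2 * letter sl2_F}" for r
    unfolding sl2_ideal_def by (rule subsetD[OF ring.genideal_self[OF ring_free_algebra] that]) simp
  have two: "sl2_class 2 = 2" using sl2_class_of_nat[of 2] by simp
  have "?s (1 / fact n) * ffact_ring (sl2_class (letter sl2_H)) n \<in> ?K"
  proof (rule binomials_generated[where e = "sl2_class (letter sl2_E)" and f = "sl2_class (letter sl2_F)"])
    show "sl2_class (letter sl2_E) * sl2_class (letter sl2_F) =
        sl2_class (letter sl2_F) * sl2_class (letter sl2_E) + sl2_class (letter sl2_H)"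
      unfolding sl2_class_simps[symmetric] by (rule rel) (rule gen, simp)
    show "sl2_class (letter sl2_H) * sl2_class (letter sl2_E) =
        sl2_class (letter sl2_E) * sl2_class (letter sl2_H) + 2 * sl2_class (letter sl2_E)"
      unfolding sl2_class_simps[symmetric] two[symmetric] by (rule rel) (rule gen, simp)
    show "sl2_class (letter sl2_H) * sl2_class (letter sl2_F) =
        sl2_class (letter sl2_F) * sl2_class (letter sl2_H) - 2 * sl2_class (letter sl2_F)"
      unfolding sl2_class_simps[symmetric] two[symmetric] by (rule rel) (rule gen, simp)
    show "?s 1 = 1" "?s (a + b) = ?s a + ?s b" "?s (a * b) = ?s a * ?s b" for a b
      by (simp_all add: scalar_simps sl2_class_simps)
    show "?s a * y = y * ?s a" for a y
      by (induction y) (simp add: sl2_class_simps(2)[symmetric] scalar_commute)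
    show "1 \<in> ?K"
      using ring.ring_simprules(6)[OF ring_kostant_form] by (intro CollectI exI[of _ 1]) (simp add: sl2_class_simps envelope_class_simps)
    show "a + b \<in> ?K" "a * b \<in> ?K" if ab: "a \<in> ?K" "b \<in> ?K" for a b
    proof -
      obtain u v where u: "a = sl2_class u" "b = sl2_class v"
        "envelope_class u \<in> carrier kostant_form" "envelope_class v \<in> carrier kostant_form" using ab by blast
      then have "envelope_class (u + v) \<in> carrier kostant_form" "envelope_class (u * v) \<in> carrier kostant_form"
        by (simp_all add: envelope_class_simps carrier_kostant_form generate_ring.eng_add generate_ring.eng_mult)
      moreover have "a + b = sl2_class (u + v)" "a * b = sl2_class (u * v)" using u by (simp_all add: sl2_class_simps)
      ultimately show "a + b \<in> ?K" "a * b \<in> ?K" by blast+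
    qed
    show "- a \<in> ?K" if a: "a \<in> ?K" for a
    proof -
      obtain u where u: "a = sl2_class u" "envelope_class u \<in> carrier kostant_form" using a by blast
      then have "envelope_class (- u) \<in> carrier kostant_form"
        by (simp add: envelope_class_uminus carrier_kostant_form generate_ring.a_inv)
      moreover have "- a = sl2_class (- u)" using u by (simp add: sl2_class_simps)
      ultimately show ?thesis by blast
    qed
    show "?s (1 / fact i) * sl2_class (letter sl2_E) ^ i \<in> ?K" for i
      using divided_power_kostant(1)[of i] unfolding divided_power_def
      by (intro CollectI exI[of _ "scalar (1 / fact i) * letter sl2_E ^ i"]) (simp add: sl2_class_simps sl2_class_power)
    show "?s (1 / fact i) * sl2_class (letter sl2_F) ^ i \<in> ?K" for i
      using divided_power_kostant(2)[of i] unfolding divided_power_def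
      by (intro CollectI exI[of _ "scalar (1 / fact i) * letter sl2_F ^ i"]) (simp add: sl2_class_simps sl2_class_power)
  qed
  then obtain a where a: "?s (1 / fact n) * ffact_ring (sl2_class (letter sl2_H)) n = sl2_class a"
    "envelope_class a \<in> carrier kostant_form" by blast
  have "binomial_H n = envelope_class a"
    unfolding binomial_H_def envelope_class_eq a(1)[symmetric] by (simp add: sl2_class_simps sl2_class_ffact)
  then show ?thesis using a(2) by simp
qed

section \<open>Distributions\<close>

lemma ideal_reduction_ideal: "ideal (reduction_ideal p) kostant_form"
  unfolding reduction_ideal_def
proof (rule ring.genideal_ideal[OF ring_kostant_form])
  interpret K: ring kostant_form by (rule ring_kostant_form)
  show "{[p] \<cdot>\<^bsub>kostant_form\<^esub> \<one>\<^bsub>kostant_form\<^esub>} \<subseteq> carrier kostant_form"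
    using K.add.nat_pow_closed[OF K.one_closed, of p] by simp
qed

lemma ring_dist_ring: "ring (dist_ring p)"
  unfolding dist_ring_def by (rule ideal.quotient_is_ring[OF ideal_reduction_ideal])

lemma ring_Dist: "ring (Dist :: ('p::prime_card mod_ring, distribution) module)"
proof -
  interpret R: ring "dist_ring CARD('p)" by (rule ring_dist_ring)
  show ?thesis
  proof (rule ringI)
    show "abelian_group (Dist :: ('p mod_ring, distribution) module)"
      by (rule abelian_groupI) (auto simp: Dist_def R.a_ac intro: R.add.l_inv_ex)
    show "monoid (Dist :: ('p mod_ring, distribution) module)"
      by (rule monoidI) (auto simp: Dist_def R.m_assoc)
  qed (auto simp: Dist_def R.l_distr R.r_distr)
qed

lemma dist_class_hom:
  "dist_class CARD('p) \<in> Ring.ring_hom kostant_form (Dist :: ('p::prime_card mod_ring, distribution) module)"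
proof -
  have "dist_class CARD('p) \<in> Ring.ring_hom kostant_form (dist_ring CARD('p))"
    using ideal.rcos_ring_hom[OF ideal_reduction_ideal]
    unfolding dist_ring_def dist_class_def[abs_def] by simp
  then show ?thesis by (simp add: Ring.ring_hom_def Dist_def)
qed

lemma carrier_Dist:
  "carrier (Dist :: ('p::prime_card mod_ring, distribution) module) = dist_class CARD('p) ` carrier kostant_form"
  by (auto simp: Dist_def dist_ring_def FactRing_def A_RCOSETS_def' dist_class_def)

lemma Dist_smult_closed:
  "u \<in> carrier (Dist :: ('p::prime_card mod_ring, distribution) module) \<Longrightarrow>
   c \<odot>\<^bsub>(Dist :: ('p mod_ring, distribution) module)\<^esub> u \<in> carrier (Dist :: ('p mod_ring, distribution) module)"
proof -
  interpret R: ring "dist_ring CARD('p)" by (rule ring_dist_ring)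
  assume "u \<in> carrier (Dist :: ('p mod_ring, distribution) module)"
  then show ?thesis using R.add.int_pow_closed[of u "to_int_mod_ring c"] by (simp add: Dist_def)
qed

lemma Dist_smult_simps:
  "c \<odot>\<^bsub>(Dist :: ('p::prime_card mod_ring, distribution) module)\<^esub> \<zero>\<^bsub>(Dist :: ('p mod_ring, distribution) module)\<^esub> =
    \<zero>\<^bsub>(Dist :: ('p mod_ring, distribution) module)\<^esub>"
  "u \<in> carrier (Dist :: ('p mod_ring, distribution) module) \<Longrightarrow>
    1 \<odot>\<^bsub>(Dist :: ('p mod_ring, distribution) module)\<^esub> u = u"
proof -
  interpret R: ring "dist_ring CARD('p)" by (rule ring_dist_ring)
  show "c \<odot>\<^bsub>(Dist :: ('p mod_ring, distribution) module)\<^esub> \<zero>\<^bsub>(Dist :: ('p mod_ring, distribution) module)\<^esub> =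
    \<zero>\<^bsub>(Dist :: ('p mod_ring, distribution) module)\<^esub>"
    using R.add.int_pow_one[of "to_int_mod_ring c"] by (simp add: Dist_def)
  have "to_int_mod_ring (1 :: 'p mod_ring) = 1" by (simp add: one_mod_ring.rep_eq to_int_mod_ring.rep_eq)
  then show "u \<in> carrier (Dist :: ('p mod_ring, distribution) module) \<Longrightarrow>
    1 \<odot>\<^bsub>(Dist :: ('p mod_ring, distribution) module)\<^esub> u = u"
    using R.add.int_pow_1[of u] by (simp add: Dist_def)
qed

definition pbw :: "'p::prime_card itself \<Rightarrow> nat \<Rightarrow> distribution set" where
  "pbw _ n = (let A = (Dist :: ('p mod_ring, distribution) module); p = CARD('p) in
    {dist_E p a \<otimes>\<^bsub>A\<^esub> dist_H p b \<otimes>\<^bsub>A\<^esub> dist_F p c | a b c. a + b + c \<le> n})"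

locale frobenius_action =
  fixes \<phi> :: "distribution \<Rightarrow> distribution" and \<rho> :: "distribution \<Rightarrow> 'p::prime_card oper"
  assumes \<phi>: "transpose_frobenius TYPE('p) \<phi>" and \<rho>: "action_morphism \<rho>"
begin

abbreviation A :: "('p mod_ring, distribution) module" where "A \<equiv> Dist"

sublocale A: ring A
  by (rule ring_Dist)

lemma phi:
  "\<phi> \<in> Ring.ring_hom A A" "u \<in> carrier A \<Longrightarrow> \<phi> (c \<odot>\<^bsub>A\<^esub> u) = c \<odot>\<^bsub>A\<^esub> \<phi> u"
  "\<phi> (dist_E CARD('p) n) = (if CARD('p) dvd n then dist_E CARD('p) (n div CARD('p)) else \<zero>\<^bsub>A\<^esub>)"
  "\<phi> (dist_F CARD('p) n) = (if CARD('p) dvd n then dist_F CARD('p) (n div CARD('p)) else \<zero>\<^bsub>A\<^esub>)"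
  "\<phi> (dist_H CARD('p) n) = (if CARD('p) dvd n then dist_H CARD('p) (n div CARD('p)) else \<zero>\<^bsub>A\<^esub>)"
  using \<phi> by (simp_all add: transpose_frobenius_def Let_def)

lemma rho:
  "\<rho> \<in> Ring.ring_hom A global_diffops" "u \<in> carrier A \<Longrightarrow> \<rho> (c \<odot>\<^bsub>A\<^esub> u) = (\<lambda>f. const c * \<rho> u f)"
  "\<rho> (dist_E CARD('p) n) = divided_derivation coord n"
  "\<rho> (dist_F CARD('p) n) = divided_derivation (inverse coord) n"
  "u \<in> dist_order TYPE('p) n \<Longrightarrow> \<rho> u \<in> diffops n points"
  using \<rho> by (auto simp: action_morphism_def Let_def global_diffops_def image_subset_iff)

lemma phi_simps:
  "u \<in> carrier A \<Longrightarrow> \<phi> u \<in> carrier A"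
  "u \<in> carrier A \<Longrightarrow> v \<in> carrier A \<Longrightarrow> \<phi> (u \<oplus>\<^bsub>A\<^esub> v) = \<phi> u \<oplus>\<^bsub>A\<^esub> \<phi> v"
  "u \<in> carrier A \<Longrightarrow> v \<in> carrier A \<Longrightarrow> \<phi> (u \<otimes>\<^bsub>A\<^esub> v) = \<phi> u \<otimes>\<^bsub>A\<^esub> \<phi> v"
  "\<phi> \<one>\<^bsub>A\<^esub> = \<one>\<^bsub>A\<^esub>" "\<phi> \<zero>\<^bsub>A\<^esub> = \<zero>\<^bsub>A\<^esub>"
  "u \<in> carrier A \<Longrightarrow> v \<in> carrier A \<Longrightarrow> \<phi> (u \<ominus>\<^bsub>A\<^esub> v) = \<phi> u \<ominus>\<^bsub>A\<^esub> \<phi> v"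
proof -
  interpret h: ring_hom_ring A A \<phi>
    by (rule ring_hom_ringI2) (rule A.ring_axioms A.ring_axioms phi(1))+
  show "u \<in> carrier A \<Longrightarrow> \<phi> u \<in> carrier A" "\<phi> \<one>\<^bsub>A\<^esub> = \<one>\<^bsub>A\<^esub>" "\<phi> \<zero>\<^bsub>A\<^esub> = \<zero>\<^bsub>A\<^esub>"
    "u \<in> carrier A \<Longrightarrow> v \<in> carrier A \<Longrightarrow> \<phi> (u \<oplus>\<^bsub>A\<^esub> v) = \<phi> u \<oplus>\<^bsub>A\<^esub> \<phi> v"
    "u \<in> carrier A \<Longrightarrow> v \<in> carrier A \<Longrightarrow> \<phi> (u \<otimes>\<^bsub>A\<^esub> v) = \<phi> u \<otimes>\<^bsub>A\<^esub> \<phi> v"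
    by simp_all
  show "u \<in> carrier A \<Longrightarrow> v \<in> carrier A \<Longrightarrow> \<phi> (u \<ominus>\<^bsub>A\<^esub> v) = \<phi> u \<ominus>\<^bsub>A\<^esub> \<phi> v"
    by (simp add: a_minus_def)
qed

lemma rho_add: "u \<in> carrier A \<Longrightarrow> v \<in> carrier A \<Longrightarrow> \<rho> (u \<oplus>\<^bsub>A\<^esub> v) = (\<lambda>f. \<rho> u f + \<rho> v f)"
  using ring_hom_add[OF rho(1)] by (simp add: global_diffops_def)

lemma rho_mult: "u \<in> carrier A \<Longrightarrow> v \<in> carrier A \<Longrightarrow> \<rho> (u \<otimes>\<^bsub>A\<^esub> v) = \<rho> u \<circ> \<rho> v"
  using ring_hom_mult[OF rho(1)] by (simp add: global_diffops_def)

lemma rho_one: "\<rho> \<one>\<^bsub>A\<^esub> = id"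
  using ring_hom_one[OF rho(1)] by (simp add: global_diffops_def)

lemma rho_zero: "\<rho> \<zero>\<^bsub>A\<^esub> = (\<lambda>_. 0)"
proof
  fix f
  have "\<rho> \<zero>\<^bsub>A\<^esub> f = \<rho> \<zero>\<^bsub>A\<^esub> f + \<rho> \<zero>\<^bsub>A\<^esub> f"
    using fun_cong[OF rho_add[OF A.zero_closed A.zero_closed], of f] by (simp only: A.l_zero A.zero_closed)
  then show "\<rho> \<zero>\<^bsub>A\<^esub> f = 0" by (metis add_0_right add_left_imp_eq)
qed

lemma rho_inverse:
  assumes u: "u \<in> carrier A" and v: "v \<in> carrier A" and uv: "u \<oplus>\<^bsub>A\<^esub> v = \<zero>\<^bsub>A\<^esub>"
  shows "\<rho> v f = - \<rho> u f"
proof -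
  have "\<rho> u f + \<rho> v f = 0"
    using fun_cong[OF rho_add[OF u v], of f] unfolding uv rho_zero by simp
  then show ?thesis by (simp add: eq_neg_iff_add_eq_0 add.commute)
qed

lemma rho_minus:
  assumes u: "u \<in> carrier A" and v: "v \<in> carrier A"
  shows "\<rho> (u \<ominus>\<^bsub>A\<^esub> v) = (\<lambda>f. \<rho> u f - \<rho> v f)"
proof
  fix f
  have "(u \<ominus>\<^bsub>A\<^esub> v) \<oplus>\<^bsub>A\<^esub> v = u" using u v by (simp add: a_minus_def A.a_assoc A.l_neg)
  then have "\<rho> u f = \<rho> (u \<ominus>\<^bsub>A\<^esub> v) f + \<rho> v f"
    using rho_add[OF A.minus_closed[OF u v] v] by simp
  then show "\<rho> (u \<ominus>\<^bsub>A\<^esub> v) f = \<rho> u f - \<rho> v f" by simp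
qed

lemma dist_class_simps:
  "u \<in> carrier kostant_form \<Longrightarrow> dist_class CARD('p) u \<in> carrier A"
  "dist_class CARD('p) \<one>\<^bsub>sl2_envelope\<^esub> = \<one>\<^bsub>A\<^esub>"
  "u \<in> carrier kostant_form \<Longrightarrow> v \<in> carrier kostant_form \<Longrightarrow>
    dist_class CARD('p) (u \<oplus>\<^bsub>sl2_envelope\<^esub> v) = dist_class CARD('p) u \<oplus>\<^bsub>A\<^esub> dist_class CARD('p) v"
  "u \<in> carrier kostant_form \<Longrightarrow> v \<in> carrier kostant_form \<Longrightarrow>
    dist_class CARD('p) (u \<otimes>\<^bsub>sl2_envelope\<^esub> v) = dist_class CARD('p) u \<otimes>\<^bsub>A\<^esub> dist_class CARD('p) v"
  using ring_hom_closed[OF dist_class_hom[where ?'p = 'p], of u] ring_hom_one[OF dist_class_hom[where ?'p = 'p]]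
    ring_hom_add[OF dist_class_hom[where ?'p = 'p], of u v] ring_hom_mult[OF dist_class_hom[where ?'p = 'p], of u v]
  by simp_all

lemma dist_closed: "dist_E CARD('p) n \<in> carrier A" "dist_F CARD('p) n \<in> carrier A" "dist_H CARD('p) n \<in> carrier A"
  by (intro dist_class_simps divided_power_kostant binomial_H_kostant)+

lemma dist_order_eq: "dist_order TYPE('p) n = lin_span A (pbw TYPE('p) n)"
  by (simp add: dist_order_def pbw_def Let_def)

lemma pbw_closed: "pbw TYPE('p) n \<subseteq> carrier A"
  unfolding pbw_def Let_def using dist_closed by blast

lemma dist_order_closed: "u \<in> dist_order TYPE('p) n \<Longrightarrow> u \<in> carrier A"
  unfolding dist_order_eq
proof (induction rule: lin_span.induct)
  case (step b v c)
  then show ?case using pbw_closed by (intro A.a_closed Dist_smult_closed) auto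
qed simp

lemma pbw_dist_order: "u \<in> pbw TYPE('p) n \<Longrightarrow> u \<in> dist_order TYPE('p) n"
proof -
  assume u: "u \<in> pbw TYPE('p) n"
  then have "u \<in> carrier A" using pbw_closed by blast
  then show ?thesis
    using lin_span.step[OF u lin_span.zero, of A 1] by (simp add: dist_order_eq Dist_smult_simps)
qed

lemma dist_E_F_order: "dist_E CARD('p) n \<in> dist_order TYPE('p) n" "dist_F CARD('p) n \<in> dist_order TYPE('p) n"
proof -
  have one: "dist_E CARD('p) 0 = \<one>\<^bsub>A\<^esub>" "dist_F CARD('p) 0 = \<one>\<^bsub>A\<^esub>" "dist_H CARD('p) 0 = \<one>\<^bsub>A\<^esub>"
    using dist_class_simps(2)
    by (simp_all add: divided_power_def binomial_H_def scalar_simps envelope_class_simps)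
  have "dist_E CARD('p) n \<otimes>\<^bsub>A\<^esub> dist_H CARD('p) 0 \<otimes>\<^bsub>A\<^esub> dist_F CARD('p) 0 = dist_E CARD('p) n"
    "dist_E CARD('p) 0 \<otimes>\<^bsub>A\<^esub> dist_H CARD('p) 0 \<otimes>\<^bsub>A\<^esub> dist_F CARD('p) n = dist_F CARD('p) n"
    by (simp_all only: one A.r_one A.l_one dist_closed A.one_closed)
  moreover have "dist_E CARD('p) n \<otimes>\<^bsub>A\<^esub> dist_H CARD('p) 0 \<otimes>\<^bsub>A\<^esub> dist_F CARD('p) 0 \<in> pbw TYPE('p) n"
    "dist_E CARD('p) 0 \<otimes>\<^bsub>A\<^esub> dist_H CARD('p) 0 \<otimes>\<^bsub>A\<^esub> dist_F CARD('p) n \<in> pbw TYPE('p) n"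
    unfolding pbw_def Let_def by force+
  ultimately show "dist_E CARD('p) n \<in> dist_order TYPE('p) n" "dist_F CARD('p) n \<in> dist_order TYPE('p) n"
    using pbw_dist_order by metis+
qed

text \<open>Regularity on the whole line is not checked on the charts: the derivations are the
  images under \<open>\<rho>\<close> of the divided powers of E and F, and \<open>\<rho>\<close>
  respects orders.\<close>

lemma dd_global: "(\<tau> :: 'p ratfun) \<in> coords \<Longrightarrow> divided_derivation \<tau> n \<in> diffops n points"
  using rho(5)[OF dist_E_F_order(1), unfolded rho(3)] rho(5)[OF dist_E_F_order(2), unfolded rho(4)]
  by (auto simp: coords_def)

text \<open>A spanning monomial goes to zero, or, if p divides all three exponents, to the monomial
  with exponents divided by p, whose order is at most n div p. The bound k is kept separate so that
  \<open>card_mult_div\<close> can supply it.\<close>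

lemma phi_dist_order:
  assumes "u \<in> dist_order TYPE('p) n" "n div CARD('p) = k"
  shows "\<phi> u \<in> dist_order TYPE('p) k"
  using assms(1) unfolding dist_order_eq
proof (induction rule: lin_span.induct)
  case zero
  show ?case unfolding phi_simps by (rule lin_span.zero)
next
  case (step b v c)
  then have bc: "b \<in> carrier A" using pbw_closed by blast
  have vc: "v \<in> carrier A" using step(2) dist_order_closed by (simp add: dist_order_eq)
  have eq: "\<phi> (c \<odot>\<^bsub>A\<^esub> b \<oplus>\<^bsub>A\<^esub> v) = c \<odot>\<^bsub>A\<^esub> \<phi> b \<oplus>\<^bsub>A\<^esub> \<phi> v"
    by (simp only: phi_simps(2)[OF Dist_smult_closed[OF bc] vc] phi(2)[OF bc])
  obtain i j l where b: "b = dist_E CARD('p) i \<otimes>\<^bsub>A\<^esub> dist_H CARD('p) j \<otimes>\<^bsub>A\<^esub> dist_F CARD('p) l" and le: "i + j + l \<le> n"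
    using step(1) unfolding pbw_def Let_def by blast
  have \<phi>b: "\<phi> b = \<phi> (dist_E CARD('p) i) \<otimes>\<^bsub>A\<^esub> \<phi> (dist_H CARD('p) j) \<otimes>\<^bsub>A\<^esub> \<phi> (dist_F CARD('p) l)"
    unfolding b by (simp only: phi_simps dist_closed A.m_closed)
  show ?case
  proof (cases "CARD('p) dvd i \<and> CARD('p) dvd j \<and> CARD('p) dvd l")
    case True
    then have "i div CARD('p) + j div CARD('p) + l div CARD('p) = (i + j + l) div CARD('p)" by (simp add: div_add)
    also have "\<dots> \<le> k" using div_le_mono[OF le, of "CARD('p)"] assms(2) by simp
    finally have "\<phi> b \<in> pbw TYPE('p) k" unfolding \<phi>b phi pbw_def Let_def using True by auto
    then show ?thesis unfolding eq using step(3) by (intro lin_span.step)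
  next
    case False
    then have "\<phi> b = \<zero>\<^bsub>A\<^esub>"
      unfolding \<phi>b phi using dist_closed by (auto simp del: One_nat_def)
    then have "c \<odot>\<^bsub>A\<^esub> \<phi> b \<oplus>\<^bsub>A\<^esub> \<phi> v = \<phi> v"
      by (simp add: Dist_smult_simps phi_simps vc)
    then show ?thesis unfolding eq using step(3) by simp
  qed
qed

text \<open>
  Both sides are compatible with sums and products in \<open>v\<close>, so the divided powers of \<open>E\<close> and \<open>F\<close>
  suffice; there it is the behaviour of divided derivations on \<open>p\<close>-th powers.
\<close>

lemma rho_frobenius:
  assumes "v \<in> carrier A"
  shows "\<rho> v (h ^ CARD('p)) = \<rho> (\<phi> v) h ^ CARD('p)"
proof -
  interpret E: ring sl2_envelope by (rule ring_sl2_envelope)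
  have gens: "kostant_gens \<subseteq> carrier sl2_envelope"
    by (auto simp: kostant_gens_def divided_power_def envelope_class_simps(1))
  have p0: "CARD('p) > 0" by simp
  have fd: "(a + b) ^ CARD('p) = a ^ CARD('p) + b ^ CARD('p)" for a b :: "'p ratfun"
    by (rule freshmans_dream) (simp_all add: CHAR_ratfun prime_card)
  obtain u where v: "v = dist_class CARD('p) u" and u: "u \<in> generate_ring sl2_envelope kostant_gens"
    using assms by (auto simp: carrier_Dist carrier_kostant_form)
  have "\<forall>h. \<rho> (dist_class CARD('p) u) (h ^ CARD('p)) = \<rho> (\<phi> (dist_class CARD('p) u)) h ^ CARD('p)"
    using u
  proof (induction rule: generate_ring.induct)
    case one
    show ?case by (simp add: dist_class_simps phi_simps rho_one)
  next
    case (incl u)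
    then consider n where "u = divided_power sl2_E n" | n where "u = divided_power sl2_F n"
      by (auto simp: kostant_gens_def)
    then show ?case
    proof cases
      case 1
      then show ?thesis using p0 dd_power_card[of "coord :: 'p ratfun"] by (auto simp: phi rho rho_zero coords_def)
    next
      case 2
      then show ?thesis using p0 dd_power_card[of "inverse coord :: 'p ratfun"] by (auto simp: phi rho rho_zero coords_def)
    qed
  next
    case (a_inv u)
    then have uk: "u \<in> carrier kostant_form" "\<ominus>\<^bsub>sl2_envelope\<^esub> u \<in> carrier kostant_form"
      by (simp_all add: carrier_kostant_form generate_ring.a_inv)
    have uE: "u \<in> carrier sl2_envelope" using E.generate_ring_incl[OF gens] a_inv by blast
    let ?u = "dist_class CARD('p) u" and ?v = "dist_class CARD('p) (\<ominus>\<^bsub>sl2_envelope\<^esub> u)"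
    have c: "?u \<in> carrier A" "?v \<in> carrier A" by (rule dist_class_simps(1)[OF uk(1)] dist_class_simps(1)[OF uk(2)])+
    have z: "dist_class CARD('p) \<zero>\<^bsub>sl2_envelope\<^esub> = \<zero>\<^bsub>A\<^esub>"
      using ring_hom_zero[OF dist_class_hom[where ?'p = 'p] ring_kostant_form ring_Dist] by simp
    have s: "?u \<oplus>\<^bsub>A\<^esub> ?v = \<zero>\<^bsub>A\<^esub>"
      using dist_class_simps(3)[OF uk] z E.r_neg[OF uE] by simp
    have "\<phi> ?u \<oplus>\<^bsub>A\<^esub> \<phi> ?v = \<zero>\<^bsub>A\<^esub>" using phi_simps(2)[OF c] s phi_simps(5) by simp
    note r = rho_inverse[OF c s] rho_inverse[OF phi_simps(1)[OF c(1)] phi_simps(1)[OF c(2)] this]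
    \<comment> \<open>The freshman's dream applied to a + (- a) = 0.\<close>
    have "(- a) ^ CARD('p) = - (a ^ CARD('p))" for a :: "'p ratfun"
      using fd[of a "- a"] zero_power[OF p0, where ?'a = "'p ratfun"] by (simp add: eq_neg_iff_add_eq_0 add.commute)
    then show ?case using a_inv.IH by (simp add: r)
  next
    case (eng_add u u')
    then have k: "u \<in> carrier kostant_form" "u' \<in> carrier kostant_form" by (simp_all add: carrier_kostant_form)
    note c = dist_class_simps(1)[OF k(1)] dist_class_simps(1)[OF k(2)]
    show ?case
      using eng_add.IH by (simp add: dist_class_simps(3)[OF k] phi_simps(2)[OF c] rho_add c phi_simps(1) fd)
  next
    case (eng_mult u u')
    then have k: "u \<in> carrier kostant_form" "u' \<in> carrier kostant_form" by (simp_all add: carrier_kostant_form)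
    note c = dist_class_simps(1)[OF k(1)] dist_class_simps(1)[OF k(2)]
    show ?case
      using eng_mult.IH by (simp add: dist_class_simps(4)[OF k] phi_simps(3)[OF c] rho_mult c phi_simps(1))
  qed
  then show ?thesis by (simp add: v)
qed

section \<open>Induced maps on the algebras of level m\<close>

abbreviation ufa :: "nat \<Rightarrow> (distribution word \<Rightarrow>\<^sub>0 'p mod_ring) set" where
  "ufa m \<equiv> carrier (free_algebra (dist_order TYPE('p) (2 * CARD('p) ^ m - 1)))"

lemma dist_algebra_relsE:
  assumes "r \<in> linearity_rels A V \<union> U_rels m" and V: "V \<subseteq> carrier A"
  obtains (add) v w where "r = letter (v \<oplus>\<^bsub>A\<^esub> w) - letter v - letter w" "v \<in> V" "w \<in> V"
    | (smult) c v where "r = letter (c \<odot>\<^bsub>A\<^esub> v) - scalar c * letter v" "v \<in> V"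
    | (unit) c where "r = scalar c - letter (c \<odot>\<^bsub>A\<^esub> \<one>\<^bsub>A\<^esub>)"
    | (bracket) u v where "r = letter u * letter v - letter v * letter u - letter (u \<otimes>\<^bsub>A\<^esub> v \<ominus>\<^bsub>A\<^esub> v \<otimes>\<^bsub>A\<^esub> u)"
        "u \<in> dist_order TYPE('p) (CARD('p) ^ m)" "v \<in> dist_order TYPE('p) (CARD('p) ^ m)"
    | (product) u v where "r = letter u * letter v - letter (u \<otimes>\<^bsub>A\<^esub> v)"
        "u \<in> dist_order TYPE('p) (CARD('p) ^ m - 1)" "v \<in> dist_order TYPE('p) (CARD('p) ^ m)"
  using assms(1) unfolding linearity_rels_def U_rels_def unit_rels_def bracket_rels_def product_rels_def by blast

text \<open>Since \<open>\<phi>\<close> divides orders by p, each defining relation of level m + 1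
  goes to a defining relation of level m. All representatives of a coset then have the same image
  class, so the union in \<open>frobenius_level\<close> is that class.\<close>

lemma frobenius_level_class:
  assumes w: "w \<in> ufa (Suc m)"
  shows "frobenius_level \<phi> m (U_class (Suc m) w) = U_class m (free_map \<phi> w)"
proof -
  let ?V = "dist_order TYPE('p) (2 * CARD('p) ^ Suc m - 1)" and ?W = "dist_order TYPE('p) (2 * CARD('p) ^ m - 1)"
  have VA: "?V \<subseteq> carrier A" using dist_order_closed by blast
  have VW: "\<phi> ` ?V \<subseteq> ?W" using phi_dist_order[OF _ card_mult_div(1)] by blast
  have "free_map \<phi> r \<in> tensor_ideal A ?W (U_rels m)"
    if r: "r \<in> linearity_rels A ?V \<union> U_rels (Suc m)" "r \<in> carrier (free_algebra ?V)" for r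
  proof (rule tensor_ideal_rel[OF _ free_map_closed[OF r(2) VW]])
    show "free_map \<phi> r \<in> linearity_rels A ?W \<union> U_rels m"
      using r(1) VA
    proof (cases rule: dist_algebra_relsE)
      case (add v w)
      then have "v \<in> carrier A" "w \<in> carrier A" "\<phi> v \<in> ?W" "\<phi> w \<in> ?W" using VA VW by auto
      then show ?thesis unfolding add(1) linearity_rels_def by (auto simp: free_map_diff phi_simps(2))
    next
      case (smult c v)
      then have "v \<in> carrier A" "\<phi> v \<in> ?W" using VA VW by auto
      then show ?thesis unfolding smult(1) linearity_rels_def by (auto simp: free_map_diff free_map_mult phi(2))
    next
      case (unit c)
      show ?thesis unfolding unit U_rels_def unit_rels_def
        by (auto simp: free_map_diff phi(2) phi_simps(4))
    next
      case (bracket u v)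
      then have c: "u \<in> carrier A" "v \<in> carrier A" using dist_order_closed by auto
      have "\<phi> u \<in> dist_order TYPE('p) (CARD('p) ^ m)" "\<phi> v \<in> dist_order TYPE('p) (CARD('p) ^ m)"
        using bracket phi_dist_order[OF _ card_mult_div(3)] by auto
      moreover have "\<phi> (u \<otimes>\<^bsub>A\<^esub> v \<ominus>\<^bsub>A\<^esub> v \<otimes>\<^bsub>A\<^esub> u) = \<phi> u \<otimes>\<^bsub>A\<^esub> \<phi> v \<ominus>\<^bsub>A\<^esub> \<phi> v \<otimes>\<^bsub>A\<^esub> \<phi> u"
        using c by (simp add: phi_simps)
      ultimately show ?thesis unfolding bracket(1) U_rels_def bracket_rels_def
        by (auto simp: free_map_diff free_map_mult)
    next
      case (product u v)
      then have c: "u \<in> carrier A" "v \<in> carrier A" using dist_order_closed by auto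
      have "\<phi> u \<in> dist_order TYPE('p) (CARD('p) ^ m - 1)" "\<phi> v \<in> dist_order TYPE('p) (CARD('p) ^ m)"
        using product phi_dist_order[OF _ card_mult_div(2)] phi_dist_order[OF _ card_mult_div(3)] by auto
      then show ?thesis unfolding product(1) U_rels_def product_rels_def
        using c by (auto simp: free_map_diff free_map_mult phi_simps)
    qed
  qed
  note ideal = tensor_ideal_map[OF VW this]
  have "U_class m (free_map \<phi> w') = U_class m (free_map \<phi> w)" if "w' \<in> U_class (Suc m) w" for w'
    using that ideal[where a = "w' - w"] by (simp add: U_class_def tensor_class_eq mem_tensor_class free_map_diff)
  moreover have "w \<in> U_class (Suc m) w" by (simp add: U_class_def mem_tensor_class tensor_ideal_closed(1))
  ultimately show ?thesis unfolding frobenius_level_def by blast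
qed

lemma rho_free_map:
  "w \<in> ufa m \<Longrightarrow> free_map \<rho> w \<in> carrier (free_algebra (diffops (2 * CARD('p) ^ m - 1) points))"
  by (rule free_map_closed) (auto intro: rho(5))

lemma action_level_class:
  assumes w: "w \<in> ufa m"
  shows "action_level \<rho> m (U_class m w) = (\<lambda>x\<in>points. D_germ m x (free_map \<rho> w))"
  unfolding action_level_def
proof (rule restrict_ext)
  fix x :: "'p ratfun set" assume x: "x \<in> points"
  interpret level x m "CARD('p) ^ m" by (rule level.intro[OF x refl])
  let ?V = "dist_order TYPE('p) (2 * CARD('p) ^ m - 1)" and ?W = "stalk_diffops (2 * CARD('p) ^ m - 1) x"
  have VA: "?V \<subseteq> carrier A" using dist_order_closed by blast
  have st: "\<rho> u \<in> stalk_diffops n x" if "u \<in> dist_order TYPE('p) n" for u n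
    using stalk_diffops_global[OF x] rho(5)[OF that] by blast
  have VW: "\<rho> ` ?V \<subseteq> ?W" using st by blast
  have "free_map \<rho> r \<in> tensor_ideal (stalk_algebra x) ?W (D_rels m x)"
    if r: "r \<in> linearity_rels A ?V \<union> U_rels m" "r \<in> carrier (free_algebra ?V)" for r
  proof -
    have rel: "free_map \<rho> r \<in> tensor_ideal (stalk_algebra x) ?W (D_rels m x)"
      if "free_map \<rho> r \<in> linearity_rels (stalk_algebra x) ?W \<union> D_rels m x"
      by (rule tensor_ideal_rel[OF that free_map_closed[OF r(2) VW]])
    show ?thesis
      using r(1) VA
    proof (cases rule: dist_algebra_relsE)
      case (add v w)
      then have v: "v \<in> carrier A" "w \<in> carrier A" "\<rho> v \<in> ?W" "\<rho> w \<in> ?W" using VA VW by auto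
      have "\<rho> (v \<oplus>\<^bsub>A\<^esub> w) = \<rho> v \<oplus>\<^bsub>stalk_algebra x\<^esub> \<rho> w"
        by (simp add: rho_add v stalk_algebra_def)
      then have "free_map \<rho> r = letter (\<rho> v \<oplus>\<^bsub>stalk_algebra x\<^esub> \<rho> w) - letter (\<rho> v) - letter (\<rho> w)"
        by (simp add: add(1) free_map_diff)
      then have "free_map \<rho> r \<in> linearity_rels (stalk_algebra x) ?W"
        unfolding linearity_rels_def using v by blast
      then show ?thesis by (intro rel UnI1)
    next
      case (smult c v)
      then have v: "v \<in> carrier A" "\<rho> v \<in> ?W" using VA VW by auto
      have "\<rho> (c \<odot>\<^bsub>A\<^esub> v) = c \<odot>\<^bsub>stalk_algebra x\<^esub> \<rho> v"
        by (simp add: rho(2) v stalk_algebra_def)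
      then have "free_map \<rho> r = letter (c \<odot>\<^bsub>stalk_algebra x\<^esub> \<rho> v) - scalar c * letter (\<rho> v)"
        by (simp add: smult(1) free_map_diff free_map_mult)
      then have "free_map \<rho> r \<in> linearity_rels (stalk_algebra x) ?W"
        unfolding linearity_rels_def using v by blast
      then show ?thesis by (intro rel UnI1)
    next
      case (unit c)
      have "\<rho> (c \<odot>\<^bsub>A\<^esub> \<one>\<^bsub>A\<^esub>) = c \<odot>\<^bsub>stalk_algebra x\<^esub> \<one>\<^bsub>stalk_algebra x\<^esub>"
        by (simp add: rho(2) rho_one stalk_algebra_def)
      then have "free_map \<rho> r = scalar c - letter (c \<odot>\<^bsub>stalk_algebra x\<^esub> \<one>\<^bsub>stalk_algebra x\<^esub>)"
        by (simp add: unit free_map_diff)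
      then have "free_map \<rho> r \<in> D_rels m x" unfolding D_rels_def unit_rels_def by blast
      then show ?thesis by (intro rel UnI2)
    next
      case (bracket u v)
      then have c: "u \<in> carrier A" "v \<in> carrier A" using dist_order_closed by auto
      have \<rho>': "\<rho> u \<in> stalk_diffops (CARD('p) ^ m) x" "\<rho> v \<in> stalk_diffops (CARD('p) ^ m) x"
        using bracket st by auto
      have "\<rho> (u \<otimes>\<^bsub>A\<^esub> v \<ominus>\<^bsub>A\<^esub> v \<otimes>\<^bsub>A\<^esub> u) = \<rho> u \<otimes>\<^bsub>stalk_algebra x\<^esub> \<rho> v \<ominus>\<^bsub>stalk_algebra x\<^esub> \<rho> v \<otimes>\<^bsub>stalk_algebra x\<^esub> \<rho> u"
        using stalk_algebra_minus[OF stalk_diffops_comp[OF \<rho>'(2,1)], of "\<rho> u \<circ> \<rho> v"]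
        by (simp add: rho_minus rho_mult c stalk_algebra_def)
      then have "free_map \<rho> r = letter (\<rho> u) * letter (\<rho> v) - letter (\<rho> v) * letter (\<rho> u) -
          letter (\<rho> u \<otimes>\<^bsub>stalk_algebra x\<^esub> \<rho> v \<ominus>\<^bsub>stalk_algebra x\<^esub> \<rho> v \<otimes>\<^bsub>stalk_algebra x\<^esub> \<rho> u)"
        by (simp add: bracket(1) free_map_diff free_map_mult)
      then have "free_map \<rho> r \<in> D_rels m x" unfolding D_rels_def bracket_rels_def using \<rho>' by blast
      then show ?thesis by (intro rel UnI2)
    next
      case (product u v)
      then have c: "u \<in> carrier A" "v \<in> carrier A" using dist_order_closed by auto
      have "\<rho> u \<in> stalk_diffops (CARD('p) ^ m - 1) x" "\<rho> v \<in> stalk_diffops (CARD('p) ^ m) x"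
        using product st by auto
      \<comment> \<open>The product relations on the two sides have the factor of smaller order on
        opposite sides, so the image is not itself a listed relation; it lies in the ideal by the
        reversed product rule.\<close>
      from germ_letter_mult'[OF this]
      have "letter (\<rho> u) * letter (\<rho> v) - letter (\<rho> u \<circ> \<rho> v) \<in> tensor_ideal (stalk_algebra x) ?W (D_rels m x)"
        by (simp add: germ_eq tensor_class_eq)
      then show ?thesis unfolding product(1) by (simp add: free_map_diff free_map_mult rho_mult c)
    qed
  qed
  note ideal = tensor_ideal_map[OF VW this]
  have "D_germ m x (free_map \<rho> w') = D_germ m x (free_map \<rho> w)" if "w' \<in> U_class m w" for w'
    using that ideal[where a = "w' - w"] by (simp add: germ_eq U_class_def tensor_class_eq mem_tensor_class free_map_diff)
  moreover have "w \<in> U_class m w" by (simp add: U_class_def mem_tensor_class tensor_ideal_closed(1))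
  ultimately show "(\<Union>w\<in>U_class m w. D_germ m x (free_map \<rho> w)) = D_germ m x (free_map \<rho> w)" by blast
qed

text \<open>One word of global operators gives the germs at all points, so \<open>points\<close>
  serves as the neighbourhood everywhere.\<close>

lemma action_level_sections:
  assumes w: "w \<in> ufa m"
  shows "action_level \<rho> m (U_class m w) \<in> D_sections m points"
proof -
  note g = rho_free_map[OF w]
  have "D_germ m x (free_map \<rho> w) \<in> carrier (D_stalk m x)" if x: "x \<in> points" for x
  proof -
    interpret level x m "CARD('p) ^ m" by (rule level.intro[OF x refl])
    show ?thesis by (rule germ_closed[OF free_algebra_mono[OF stalk_diffops_global[OF x] g]])
  qed
  then show ?thesis
    unfolding action_level_class[OF w] D_sections_def
    using zariski_open_points g by (auto intro!: exI[of _ points] bexI[of _ "free_map \<rho> w"])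
qed

lemma can_rho_germ:
  assumes \<kappa>: "berthelot_can m \<kappa>" and x: "x \<in> points" and w: "w \<in> ufa (Suc m)"
  shows "\<kappa> x (D_germ (Suc m) x (free_map \<rho> w)) = pure_tensor m x 1 (D_germ m x (free_map \<rho> (free_map \<phi> w)))"
proof -
  obtain \<tau> where \<tau>: "\<tau> \<in> coords" "\<tau> \<in> x" by (rule point_contains_coord[OF x])
  have chart: "chart \<tau> x" by (rule chart.intro[OF \<tau>(1) x \<tau>(2) dd_global[OF \<tau>(1)]])
  have can: "can_point_axioms \<tau> x m (\<kappa> x)"
    by (rule can_point_axioms.intro)
       (use \<kappa>[unfolded berthelot_can_def, THEN conjunct1, rule_format, OF x] \<tau> in auto)
  interpret can_point \<tau> x m "CARD('p) ^ m" "CARD('p) ^ Suc m" "\<kappa> x"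
    by (rule can_point.intro[OF chart_level.intro[OF chart level.intro[OF x refl]]
        chart_level.intro[OF chart level.intro[OF x refl]] can])
  let ?V = "dist_order TYPE('p) (2 * CARD('p) ^ Suc m - 1)"
  have st: "\<rho> u \<in> stalk_diffops n x" if "u \<in> dist_order TYPE('p) n" for u n
    using stalk_diffops_global[OF x] rho(5)[OF that] by blast
  have "\<phi> ` ?V \<subseteq> dist_order TYPE('p) (2 * CARD('p) ^ m - 1)"
    using phi_dist_order[OF _ card_mult_div(1)] by blast
  moreover have "\<rho> ` dist_order TYPE('p) (2 * CARD('p) ^ m - 1) \<subseteq> stalk_diffops (2 * CARD('p) ^ m - 1) x"
    using st by blast
  ultimately have fa: "free_map \<rho> (free_map \<phi> w) \<in> lo.fa" if "w \<in> ufa (Suc m)" for w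
    by (intro free_map_closed[OF free_map_closed[OF that]])
  \<comment> \<open>Formulated with \<open>rep\<close>, the claim for a word is directly the premise
    of \<open>rep_letter\<close> for the word with one more letter on the left.\<close>
  have "rep (free_map \<rho> w) (lo.tens 1 (free_map \<rho> (free_map \<phi> w)))"
    using w
  proof (induction rule: free_algebra_induct)
    case zero
    show ?case using rep_cong_right[OF rep_0 lo.tens_zero_right[OF point_1[OF x], symmetric]] by simp
  next
    case (add a b)
    then show ?case
      unfolding free_map_add
      using rep_cong_right[OF rep_add lo.tens_add_right[OF point_1[OF x] fa fa, symmetric]] by blast
  next
    case (word us c)
    then show ?case
    proof (induction us)
      case Nil
      have "rep (scalar c * 1) (lo.tens 1 (scalar c * 1))"
        using rep_cong_right[OF rep_scalar[OF rep_1] _] tens_scalar[OF free_algebra_closed(2), of c] by simp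
      then show ?case unfolding single_Nil free_map_scalar by simp
    next
      case (Cons v us)
      then have v: "v \<in> ?V" and us: "set us \<subseteq> ?V"
        and IH: "rep (free_map \<rho> (Poly_Mapping.single (Word us) c))
          (lo.tens 1 (free_map \<rho> (free_map \<phi> (Poly_Mapping.single (Word us) c))))" by auto
      have "Poly_Mapping.single (Word us) c \<in> ufa (Suc m)"
        by (rule free_algebra_closed(7)) (use us in simp)
      from rep_letter[OF st[OF v] st[OF phi_dist_order[OF v card_mult_div(1)]]
          rho_frobenius[OF dist_order_closed[OF v]] fa[OF this] IH]
      show ?case unfolding single_Cons by (simp only: free_map_mult free_map_letter)
    qed
  qed
  then show ?thesis unfolding rep_def pure_tensor_def lo.tens_def by (elim conjE)
qed

end

theorem proposition3p1p1:
  fixes m :: nat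
    and \<phi> :: "distribution \<Rightarrow> distribution"
    and \<rho> :: "distribution \<Rightarrow> 'p::prime_card oper"
    and \<kappa> :: "'p ratfun set \<Rightarrow> ('p oper word \<Rightarrow>\<^sub>0 'p mod_ring) set \<Rightarrow> 'p pullback"
  assumes "CARD('p) > 2"
    and "transpose_frobenius TYPE('p) \<phi>"
    and "action_morphism \<rho>"
    and "berthelot_can m \<kappa>"
  shows "\<forall>u\<in>carrier (U_level (Suc m)).
    can_global m \<kappa> (action_level \<rho> (Suc m) u) = one_tensor m (action_level \<rho> m (frobenius_level \<phi> m u))"
proof
  interpret frobenius_action \<phi> \<rho> by (rule frobenius_action.intro) (rule assms)+
  fix u :: "(distribution word \<Rightarrow>\<^sub>0 'p mod_ring) set"
  assume "u \<in> carrier (U_level (Suc m))"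
  then obtain w where u: "u = U_class (Suc m) w" and w: "w \<in> ufa (Suc m)"
    unfolding U_level_def carrier_tensor_quotient U_class_def by blast
  have \<phi>w: "free_map \<phi> w \<in> ufa m"
    by (rule free_map_closed[OF w]) (use phi_dist_order[OF _ card_mult_div(1)] in blast)
  \<comment> \<open>The maps on global sections are restricted functions, so
    \<open>action_level_sections\<close> is required before they can be evaluated; the same holds
    below for \<open>one_tensor\<close>.\<close>
  have "can_global m \<kappa> (action_level \<rho> (Suc m) u) = (\<lambda>x\<in>points. \<kappa> x (action_level \<rho> (Suc m) u x))"
    unfolding can_global_def u using action_level_sections[OF w] by simp
  also have "\<dots> = (\<lambda>x\<in>points. pure_tensor m x 1 (action_level \<rho> m (frobenius_level \<phi> m u) x))"
    unfolding u frobenius_level_class[OF w]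
    by (rule restrict_ext) (simp add: action_level_class[OF w] action_level_class[OF \<phi>w] can_rho_germ[OF assms(4) _ w])
  also have "\<dots> = one_tensor m (action_level \<rho> m (frobenius_level \<phi> m u))"
    unfolding one_tensor_def u frobenius_level_class[OF w] using action_level_sections[OF \<phi>w] by simp
  finally show "can_global m \<kappa> (action_level \<rho> (Suc m) u) =
    one_tensor m (action_level \<rho> m (frobenius_level \<phi> m u))" .
qed

end
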